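(* Let $d\ge 2$. There is a Poisson action $V=(V_g)_{g\in\mathbb R^d}$ of $\mathbb R^d$ of $0$ entropy such that for each $0\ne g\in\mathbb R^d$, the transformation $V_g$ is Bernoullian and of infinite entropy.
   Context: For an infinite $\sigma$-finite non-atomic standard measure space $(X,\mu)$, the Poisson suspension $(X^\bullet,\mu^\bullet)$ is the standard probability space of countable point configurations (counting measures) on $X$, where $\mu^\bullet$ is the unique probability such that for every measurable $A\subset X$ with $0<\mu(A)<\infty$ the random variable $N_A(\omega)=\omega(A)$ is Poisson distributed with parameter $\mu(A)$, and $N_{A_1},\dots,N_{A_k}$ are independent for pairwise disjoint $A_1,\dots,A_k$. A $\mu$-preserving invertible transformation $R$ of $X$ induces the $\mu^\bullet$-preserving transformation $R^\bullet$ of $X^\bullet$ (push-forward of configurations by $R$), and a measure preserving action of a group on $(X,\mu)$ induces in this way an action on $(X^\bullet,\mu^\bullet)$, called its Poisson suspension. A probability preserving action of a group is called Poisson if it is isomorphic to the Poisson suspension of an infinite measure preserving action of this group. The entropy of a probability preserving $\mathbb R^d$-action is the Kolmogorov–Sinai entropy of its restriction to $\mathbb Z^d$. A transformation is Bernoullian if it is isomorphic to a Bernoulli shift (possibly with a non-atomic or infinite-entropy base). *)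

theory Defs
  imports "HOL-Probability.Probability"
begin

definition standard_borel :: "'a measure \<Rightarrow> bool" where
  "standard_borel M \<longleftrightarrow>
     (\<exists>\<tau>. topspace \<tau> = space M \<and> completely_metrizable_space \<tau> \<and> second_countable \<tau> \<and>
          sets M = sigma_sets (space M) {U. openin \<tau> U})"

text \<open>Standardness is understood modulo null sets, as usual in ergodic theory. This matters for
  the configuration space below, which becomes standard Borel only after a null set of
  configurations (those charging some set of a fixed exhaustion infinitely often) is removed.\<close>

definition standard_measure :: "'a measure \<Rightarrow> bool" where
  "standard_measure M \<longleftrightarrow>
     sigma_finite_measure M \<and>
     (\<exists>S\<in>sets M. (AE x in M. x \<in> S) \<and> standard_borel (restrict_space M S))"

definition non_atomic :: "'a measure \<Rightarrow> bool" where
  "non_atomic M \<longleftrightarrow>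
     (\<forall>A\<in>sets M. emeasure M A > 0 \<longrightarrow>
        (\<exists>B\<in>sets M. B \<subseteq> A \<and> 0 < emeasure M B \<and> emeasure M B < emeasure M A))"

definition iso_mod0 :: "'a measure \<Rightarrow> 'b measure \<Rightarrow> ('a \<Rightarrow> 'b) \<Rightarrow> bool" where
  "iso_mod0 M N \<phi> \<longleftrightarrow>
     \<phi> \<in> measurable M N \<and> distr M N \<phi> = N \<and>
     (\<exists>\<psi>\<in>measurable N M. (AE x in M. \<psi> (\<phi> x) = x) \<and> (AE y in N. \<phi> (\<psi> y) = y))"

text \<open>A measure preserving action of a topological group is a continuous homomorphism into the
  group of measure preserving invertible transformations (identified when they agree almost
  everywhere) with the weak topology.\<close>

definition mp_action :: "'a measure \<Rightarrow> ('g::{topological_space,group_add} \<Rightarrow> 'a \<Rightarrow> 'a) \<Rightarrow> bool" where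
  "mp_action M T \<longleftrightarrow>
     (\<forall>g. iso_mod0 M M (T g)) \<and>
     (AE x in M. T 0 x = x) \<and>
     (\<forall>g h. AE x in M. T (g + h) x = T g (T h x)) \<and>
     (\<forall>A\<in>sets M. emeasure M A < \<infinity> \<longrightarrow>
        (\<forall>h. ((\<lambda>g. emeasure M (sym_diff (T g -` A \<inter> space M) (T h -` A \<inter> space M))) \<longlongrightarrow> 0) (at h)))"

definition pp_action :: "'a measure \<Rightarrow> ('g::{topological_space,group_add} \<Rightarrow> 'a \<Rightarrow> 'a) \<Rightarrow> bool" where
  "pp_action M T \<longleftrightarrow> prob_space M \<and> standard_measure M \<and> mp_action M T"

text \<open>The push-forward of counting measure on a countable index set \<open>I\<close> under \<open>p\<close> is the sum of
  the unit masses at the points \<open>p i\<close>; repeated points are counted with multiplicity.\<close>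

definition configurations :: "'a measure \<Rightarrow> 'a measure set" where
  "configurations M =
     {distr (count_space I) M p | (I :: nat set) p. p \<in> I \<rightarrow> space M}"

text \<open>The \<open>\<sigma>\<close>-algebra generated by the maps \<open>\<omega> \<mapsto> \<omega>(A)\<close>; the measure carried by this value
  is irrelevant.\<close>

definition configuration_algebra :: "'a measure \<Rightarrow> 'a measure measure" where
  "configuration_algebra M =
     (SUP A\<in>sets M. vimage_algebra (configurations M) (\<lambda>\<omega>. emeasure \<omega> A) borel)"

definition is_poisson_measure :: "'a measure \<Rightarrow> 'a measure measure \<Rightarrow> bool" where
  "is_poisson_measure M P \<longleftrightarrow>
     prob_space P \<and> sets P = sets (configuration_algebra M) \<and>
     (\<forall>A\<in>sets M. 0 < emeasure M A \<and> emeasure M A < \<infinity> \<longrightarrow>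
        (\<forall>k. measure P {\<omega>\<in>space P. emeasure \<omega> A = of_nat k} = pmf (poisson_pmf (measure M A)) k)) \<and>
     (\<forall>(I :: nat set) A. finite I \<and> disjoint_family_on A I \<and>
        (\<forall>i\<in>I. A i \<in> sets M \<and> 0 < emeasure M (A i) \<and> emeasure M (A i) < \<infinity>) \<longrightarrow>
        prob_space.indep_vars P (\<lambda>_. borel) (\<lambda>i \<omega>. emeasure \<omega> (A i)) I)"

definition suspend :: "'a measure \<Rightarrow> ('a \<Rightarrow> 'a) \<Rightarrow> 'a measure \<Rightarrow> 'a measure" where
  "suspend M R \<omega> = distr \<omega> M R"

text \<open>Taking the reals as carrier of the base is no restriction: modulo null sets every standard
  measure space is isomorphic to one carried by the reals. The same applies to \<open>bernoullian\<close>.\<close>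

definition poisson_action :: "'w measure \<Rightarrow> ('g::{topological_space,group_add} \<Rightarrow> 'w \<Rightarrow> 'w) \<Rightarrow> bool" where
  "poisson_action \<Omega> V \<longleftrightarrow>
     pp_action \<Omega> V \<and>
     (\<exists>(M :: real measure) T P \<phi>.
        standard_measure M \<and> non_atomic M \<and> emeasure M (space M) = \<infinity> \<and> mp_action M T \<and>
        is_poisson_measure M P \<and>
        iso_mod0 \<Omega> P \<phi> \<and> (\<forall>g. AE \<omega> in \<Omega>. \<phi> (V g \<omega>) = suspend M (T g) (\<phi> \<omega>)))"

definition bernoullian :: "'w measure \<Rightarrow> ('w \<Rightarrow> 'w) \<Rightarrow> bool" where
  "bernoullian \<Omega> f \<longleftrightarrow>
     (\<exists>(B :: real measure) \<phi>.
        prob_space B \<and> standard_measure B \<and>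
        iso_mod0 \<Omega> (PiM (UNIV :: int set) (\<lambda>_. B)) \<phi> \<and>
        (AE \<omega> in \<Omega>. \<phi> (f \<omega>) = (\<lambda>n. \<phi> \<omega> (n + 1))))"

text \<open>A finite measurable partition is encoded by a labelling \<open>\<xi>\<close> with finitely many values. The
  join of the preimages of the partition under the maps \<open>S i\<close>, \<open>i \<in> F\<close>, is the partition
  into level sets of \<open>\<omega> \<mapsto> (\<xi> (S i \<omega>))\<close>, and \<open>entropy (exp 1)\<close> is Shannon entropy in nats.\<close>

definition finite_partition :: "'a measure \<Rightarrow> ('a \<Rightarrow> nat) \<Rightarrow> bool" where
  "finite_partition M \<xi> \<longleftrightarrow> \<xi> \<in> measurable M (count_space UNIV) \<and> finite (\<xi> ` space M)"

definition join_partition :: "('a \<Rightarrow> nat) \<Rightarrow> ('i \<Rightarrow> 'a \<Rightarrow> 'a) \<Rightarrow> 'i set \<Rightarrow> 'a \<Rightarrow> 'i \<Rightarrow> nat" where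
  "join_partition \<xi> S F \<omega> = (\<lambda>i\<in>F. \<xi> (S i \<omega>))"

definition partition_entropy :: "'a measure \<Rightarrow> ('a \<Rightarrow> 'b) \<Rightarrow> real" where
  "partition_entropy M X = prob_space.entropy M (exp 1) (count_space (X ` space M)) X"

text \<open>For the two kinds of windows used below the limit exists by subadditivity; the upper limit
  just makes the expression total.\<close>

definition ks_entropy :: "'a measure \<Rightarrow> ('i \<Rightarrow> 'a \<Rightarrow> 'a) \<Rightarrow> (nat \<Rightarrow> 'i set) \<Rightarrow> ereal" where
  "ks_entropy M S F =
     (SUP \<xi>\<in>{\<xi>. finite_partition M \<xi>}.
        limsup (\<lambda>n. ereal (partition_entropy M (join_partition \<xi> S (F n)) / real (card (F n)))))"

definition transformation_entropy :: "'a measure \<Rightarrow> ('a \<Rightarrow> 'a) \<Rightarrow> ereal" where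
  "transformation_entropy M f = ks_entropy M (\<lambda>i::nat. f ^^ i) (\<lambda>n. {..<n})"

definition integer_box :: "nat \<Rightarrow> (int ^ 'd) set" where
  "integer_box n = {z. \<forall>i. 0 \<le> z $ i \<and> z $ i < int n}"

definition lattice_point :: "int ^ 'd \<Rightarrow> real ^ 'd" where
  "lattice_point z = (\<chi> i. of_int (z $ i))"

definition action_entropy :: "'a measure \<Rightarrow> (real ^ 'd \<Rightarrow> 'a \<Rightarrow> 'a) \<Rightarrow> ereal" where
  "action_entropy M V = ks_entropy M (\<lambda>z. V (lattice_point z)) integer_box"

end

theory Submission
  imports Defs
begin

text \<open>
  Let \<open>\<real>\<^sup>d\<close> act on the set of hyperplanes \<open>\<langle>z, u(y)\<rangle> = t\<close>, with \<open>u\<close> the moment curve on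
  \<open>[0, 1]\<close>, by \<open>g \<cdot> (y, t) = (y, t + \<langle>g, u(y)\<rangle>)\<close>; the measure \<open>dy dt\<close> is invariant, and \<open>V\<close> is the
  Poisson suspension of this action. For \<open>g \<noteq> 0\<close> the polynomial \<open>\<langle>g, u(y)\<rangle>\<close> has finitely many
  roots, so \<open>g\<close> acts dissipatively with wandering set \<open>0 \<le> t / \<langle>g, u(y)\<rangle> < 1\<close>; the restrictions of
  the Poisson process to its translates are independent, which exhibits \<open>V\<^sub>g\<close> as a Bernoulli shift
  whose base, a Poisson process over a non-atomic space, has infinite entropy. On the other hand,
  what happens in the box \<open>[0, n)\<^sup>d\<close> is determined, up to errors of small probability at each
  lattice point, by the hyperplanes meeting a strip of width \<open>O(n)\<close>, recorded on a grid of \<open>O(n\<^sup>2)\<close>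
  cells of measure \<open>O(1/n)\<close>. These counts have entropy \<open>O(n\<^sup>3\<^sup>/\<^sup>2) = o(n\<^sup>d)\<close> since \<open>d \<ge> 2\<close>.

  The Poisson process itself is handled through its Laplace functional, which determines the joint
  law of the counts because a power series is determined by its values on \<open>(0, 1)\<close>.
\<close>

section \<open>Coding sequences of reals by a single real\<close>

text \<open>The two demands pull apart: a single \<open>g\<close> has to generate infinite entropy,
  while the whole group may leave almost none per lattice point. Hyperplanes reconcile them: the
  mass of those that meet a box grows with its diameter and not with its volume, whereas a point
  moving along one \<open>g\<close> never crosses the same hyperplane twice. What the family of
  directions must provide is that no \<open>g \<noteq> 0\<close> is parallel to a set of hyperplanes
  of positive measure, and that directions can be rounded at a controlled cost; a curve with
  polynomial coordinates gives both. Order n hyperplanes could be described by about n log n nats.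
  The cruder exponent 3/2 comes from bounding - q ln q by 2 sqrt q, and it is still below 2. The
  definitions want base spaces carried by the reals, so the pair (y, t), and later the whole content
  of a slab, is packed into one real number. The isomorphisms are explicit: the points of a
  configuration are listed in increasing order, coded, and glued back together.\<close>

definition real_of_bits :: "(nat \<Rightarrow> bool) \<Rightarrow> real" where
  "real_of_bits b = (\<Sum>k. of_bool (b k) / 3 ^ Suc k)"

definition bit_of_real :: "real \<Rightarrow> nat \<Rightarrow> bool" where
  "bit_of_real z k \<longleftrightarrow> \<lfloor>3 ^ Suc k * z\<rfloor> mod 3 = 1"

lemma summable_bits: "summable (\<lambda>k. of_bool (b k) / 3 ^ Suc k :: real)"
proof (rule summable_comparison_test')
  show "summable (\<lambda>k. (1/3::real) ^ k)" by (rule summable_geometric) simp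
  show "norm (of_bool (b k) / 3 ^ Suc k :: real) \<le> (1/3) ^ k" for k
    by (simp add: power_divide field_simps)
qed

lemma real_of_bits_nonneg: "0 \<le> real_of_bits b"
  unfolding real_of_bits_def by (intro suminf_nonneg summable_bits) auto

text \<open>Base three with digits 0 and 1 keeps every tail at most 1/2, so the floor reads digits
  without ambiguity; in base two a tail of ones would reach 1 and carry.\<close>

lemma real_of_bits_less: "real_of_bits b < 1"
proof -
  have g: "(\<lambda>k. (1/3) * (1/3::real) ^ k) sums ((1/3) * (1 / (1 - 1/3)))"
    by (intro sums_mult geometric_sums) simp
  have "real_of_bits b \<le> (\<Sum>k. (1/3) * (1/3::real) ^ k)"
    unfolding real_of_bits_def
    by (intro suminf_le summable_bits sums_summable[OF g]) (auto simp: power_divide field_simps)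
  also have "\<dots> = 1/2" using sums_unique[OF g] by simp
  finally show ?thesis by simp
qed

lemma real_of_bits_rec: "3 * real_of_bits b = of_bool (b 0) + real_of_bits (\<lambda>k. b (Suc k))"
proof -
  have "real_of_bits b = of_bool (b 0) / 3 + (\<Sum>k. (1/3) * (of_bool (b (Suc k)) / 3 ^ Suc k))"
    unfolding real_of_bits_def using suminf_split_head[OF summable_bits, of b] by simp
  also have "(\<Sum>k. (1/3) * (of_bool (b (Suc k)) / 3 ^ Suc k)) = (1/3) * real_of_bits (\<lambda>k. b (Suc k))"
    unfolding real_of_bits_def by (intro suminf_mult summable_bits)
  finally show ?thesis by simp
qed

text \<open>Scaling turns the digits before \<open>k\<close> into a multiple of three, puts digit
  \<open>k\<close> in the units place and leaves a tail below 1; hence \<open>bit_of_real\<close>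
  can read digit \<open>k\<close> as a residue mod 3.\<close>

lemma real_of_bits_shift:
  "\<exists>m::int. 3 ^ Suc k * real_of_bits b = 3 * of_int m + of_bool (b k) + real_of_bits (\<lambda>i. b (i + Suc k))"
proof (induction k)
  case 0
  then show ?case using real_of_bits_rec[of b] by (intro exI[of _ 0]) simp
next
  case (Suc k)
  then obtain m :: int where
    m: "3 ^ Suc k * real_of_bits b = 3 * of_int m + of_bool (b k) + real_of_bits (\<lambda>i. b (i + Suc k))" ..
  have "3 ^ Suc (Suc k) * real_of_bits b = 3 * (3 ^ Suc k * real_of_bits b)" by simp
  also have "\<dots> = 3 * of_int (3 * m + of_bool (b k)) + of_bool (b (Suc k)) + real_of_bits (\<lambda>i. b (i + Suc (Suc k)))"
    unfolding m using real_of_bits_rec[of "\<lambda>i. b (i + Suc k)"] by (simp add: algebra_simps)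
  finally show ?case by blast
qed

lemma bit_of_real_of_bits [simp]: "bit_of_real (real_of_bits b) k = b k"
proof -
  obtain m :: int where
    m: "3 ^ Suc k * real_of_bits b = 3 * of_int m + of_bool (b k) + real_of_bits (\<lambda>i. b (i + Suc k))"
    using real_of_bits_shift by blast
  have "\<lfloor>3 ^ Suc k * real_of_bits b\<rfloor> = 3 * m + of_bool (b k)"
    unfolding m floor_eq_iff
    using real_of_bits_nonneg[of "\<lambda>i. b (i + Suc k)"] real_of_bits_less[of "\<lambda>i. b (i + Suc k)"] by simp
  then show ?thesis unfolding bit_of_real_def by auto
qed

lemma measurable_real_of_bits [measurable (raw)]:
  assumes "\<And>k. Measurable.pred M (\<lambda>x. b x k)"
  shows "(\<lambda>x. real_of_bits (b x)) \<in> borel_measurable M"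
  unfolding real_of_bits_def of_bool_def using assms by measurable

lemma pred_bit_of_real [measurable (raw)]:
  assumes [measurable]: "f \<in> borel_measurable M"
  shows "Measurable.pred M (\<lambda>x. bit_of_real (f x) k)"
  unfolding bit_of_real_def by measurable

definition rat_enum :: "nat \<Rightarrow> real" where
  "rat_enum i = of_rat (from_nat i)"

lemma rat_enum_dense:
  assumes "x < y" shows "\<exists>i. x < rat_enum i \<and> rat_enum i < y"
proof -
  obtain r :: rat where "x < of_rat r" "of_rat r < y" using of_rat_dense[OF assms] by blast
  then show ?thesis by (intro exI[of _ "to_nat r"]) (simp add: rat_enum_def)
qed

text \<open>Every term is stored as its lower Dedekind cut: bit \<open>(i, j)\<close> tells whether
  the \<open>j\<close>-th rational lies below \<open>f i\<close>. Each bit is a comparison, so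
  coding preserves measurability, and decoding is a countable supremum.\<close>

definition seq_enc :: "(nat \<Rightarrow> real) \<Rightarrow> real" where
  "seq_enc f = real_of_bits (\<lambda>k. rat_enum (snd (prod_decode k)) < f (fst (prod_decode k)))"

text \<open>The value -\<infinity> is neutral for the supremum; \<open>real_of_ereal\<close> makes
  the decoder total on reals that are no codes.\<close>

definition seq_dec :: "real \<Rightarrow> nat \<Rightarrow> real" where
  "seq_dec z i = real_of_ereal (SUP j. if bit_of_real z (prod_encode (i, j)) then ereal (rat_enum j) else -\<infinity>)"

lemma seq_dec_enc [simp]: "seq_dec (seq_enc f) = f"
proof
  fix i
  have "(SUP j. if rat_enum j < f i then ereal (rat_enum j) else -\<infinity>) = ereal (f i)"
  proof (rule antisym)
    show "(SUP j. if rat_enum j < f i then ereal (rat_enum j) else -\<infinity>) \<le> ereal (f i)"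
      by (intro SUP_least) auto
    show "ereal (f i) \<le> (SUP j. if rat_enum j < f i then ereal (rat_enum j) else -\<infinity>)"
    proof (rule dense_le)
      fix y assume "y < ereal (f i)"
      then obtain r :: real where r: "y < ereal r" "r < f i"
        using ereal_dense2[of y "ereal (f i)"] by auto
      then obtain j where j: "r < rat_enum j" "rat_enum j < f i" using rat_enum_dense by blast
      have "y \<le> (if rat_enum j < f i then ereal (rat_enum j) else -\<infinity>)"
        using r j by (auto intro: order.trans[OF order.strict_implies_order])
      also have "\<dots> \<le> (SUP j. if rat_enum j < f i then ereal (rat_enum j) else -\<infinity>)" by (rule SUP_upper) simp
      finally show "y \<le> \<dots>" .
    qed
  qed
  then show "seq_dec (seq_enc f) i = f i" by (simp add: seq_dec_def seq_enc_def)
qed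

lemma measurable_seq_enc [measurable (raw)]:
  assumes [measurable]: "\<And>i. (\<lambda>x. f x i) \<in> borel_measurable M"
  shows "(\<lambda>x. seq_enc (f x)) \<in> borel_measurable M"
  unfolding seq_enc_def by measurable

lemma measurable_seq_dec [measurable (raw)]:
  assumes [measurable]: "f \<in> borel_measurable M"
  shows "(\<lambda>x. seq_dec (f x) i) \<in> borel_measurable M"
  unfolding seq_dec_def by measurable

section \<open>Configurations\<close>

lemma configuration_cases:
  assumes "\<omega> \<in> configurations M"
  obtains I :: "nat set" and p where "\<omega> = distr (count_space I) M p" "p \<in> I \<rightarrow> space M"
  using assms unfolding configurations_def by auto

lemma sets_configuration [simp]: "\<omega> \<in> configurations M \<Longrightarrow> sets \<omega> = sets M"
  by (auto elim!: configuration_cases)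

lemma space_configuration [simp]: "\<omega> \<in> configurations M \<Longrightarrow> space \<omega> = space M"
  by (auto elim!: configuration_cases)

lemma emeasure_configuration:
  assumes "p \<in> I \<rightarrow> space M" "A \<in> sets M"
  shows "emeasure (distr (count_space I) M p) A = emeasure (count_space I) {i \<in> I. p i \<in> A}"
  using assms by (subst emeasure_distr) (auto intro!: arg_cong[where f = "emeasure (count_space I)"])

lemma emeasure_configuration_nat:
  assumes "\<omega> \<in> configurations M" "emeasure \<omega> A \<noteq> \<infinity>"
  obtains k :: nat where "emeasure \<omega> A = of_nat k"
proof (cases "A \<in> sets M")
  case True
  obtain I :: "nat set" and p where I: "\<omega> = distr (count_space I) M p" "p \<in> I \<rightarrow> space M"
    using assms(1) by (rule configuration_cases)
  have e: "emeasure \<omega> A = emeasure (count_space I) {i \<in> I. p i \<in> A}"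
    unfolding I(1) by (rule emeasure_configuration[OF I(2) True])
  show ?thesis
    using assms(2) that unfolding e
    by (cases "finite {i \<in> I. p i \<in> A}") (auto simp: emeasure_count_space_finite emeasure_count_space_infinite)
next
  case False
  then have "A \<notin> sets \<omega>" using assms(1) by simp
  then show ?thesis using that[of 0] by (simp add: emeasure_notin_sets)
qed

lemma space_configuration_algebra [simp]: "space (configuration_algebra M) = configurations M"
  unfolding configuration_algebra_def by (subst space_Sup_eq_UN) auto

lemma borel_measurable_emeasure_configuration [measurable (raw)]:
  assumes "f \<in> measurable N (configuration_algebra M)"
  shows "(\<lambda>x. emeasure (f x) A) \<in> borel_measurable N"
proof (cases "A \<in> sets M")
  case True
  have "(\<lambda>\<omega>. emeasure \<omega> A) \<in> borel_measurable (configuration_algebra M)"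
    unfolding configuration_algebra_def
    by (rule measurable_SUP1[OF True]) (auto intro: measurable_vimage_algebra1)
  from measurable_compose[OF assms this] show ?thesis .
next
  case False
  then have "emeasure (f x) A = 0" if "x \<in> space N" for x
    using measurable_space[OF assms that] by (intro emeasure_notin_sets) simp
  then show ?thesis by (subst measurable_cong[where g = "\<lambda>_. 0"]) auto
qed

text \<open>The target carries the coarsest sigma-algebra that makes all counts measurable, so it is
  enough to test the counts.\<close>

lemma measurable_configurationI:
  assumes "\<And>x. x \<in> space N \<Longrightarrow> f x \<in> configurations M"
    and "\<And>A. A \<in> sets M \<Longrightarrow> (\<lambda>x. emeasure (f x) A) \<in> borel_measurable N"
  shows "f \<in> measurable N (configuration_algebra M)"
  unfolding configuration_algebra_def
  by (rule measurable_SUP2) (auto intro!: measurable_vimage_algebra2 assms)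

lemma configuration_eqI:
  assumes "\<omega> \<in> configurations M" "\<omega>' \<in> configurations M"
    and "\<And>A. A \<in> sets M \<Longrightarrow> emeasure \<omega> A = emeasure \<omega>' A"
  shows "\<omega> = \<omega>'"
  using assms by (intro measure_eqI) auto

lemma suspend_configuration:
  assumes "R \<in> measurable M M" "\<omega> \<in> configurations M"
  shows "suspend M R \<omega> \<in> configurations M"
proof -
  obtain I :: "nat set" and p where I: "\<omega> = distr (count_space I) M p" "p \<in> I \<rightarrow> space M"
    using assms(2) by (rule configuration_cases)
  have "suspend M R \<omega> = distr (count_space I) M (R \<circ> p)"
    unfolding suspend_def I(1) by (rule distr_distr) (use assms(1) I in \<open>auto simp: Pi_iff dest: measurable_space\<close>)
  moreover have "R \<circ> p \<in> I \<rightarrow> space M" using I(2) measurable_space[OF assms(1)] by (auto simp: Pi_iff)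
  ultimately show ?thesis unfolding configurations_def by blast
qed

lemma emeasure_suspend:
  assumes "R \<in> measurable M M" "\<omega> \<in> configurations M" "A \<in> sets M"
  shows "emeasure (suspend M R \<omega>) A = emeasure \<omega> (R -` A \<inter> space M)"
  unfolding suspend_def
  by (subst emeasure_distr) (use assms in \<open>auto simp: measurable_cong_sets[OF sets_configuration[OF assms(2)] refl]\<close>)

lemma measurable_suspend [measurable]:
  assumes "R \<in> measurable M M"
  shows "suspend M R \<in> measurable (configuration_algebra M) (configuration_algebra M)"
proof (rule measurable_configurationI)
  fix A assume A: "A \<in> sets M"
  show "(\<lambda>\<omega>. emeasure (suspend M R \<omega>) A) \<in> borel_measurable (configuration_algebra M)"
    by (subst measurable_cong[OF emeasure_suspend[OF assms _ A]]) auto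
qed (use suspend_configuration[OF assms] in auto)

lemma suspend_suspend:
  assumes "R \<in> measurable M M" "R' \<in> measurable M M" "\<omega> \<in> configurations M"
  shows "suspend M R (suspend M R' \<omega>) = suspend M (R \<circ> R') \<omega>"
  unfolding suspend_def
  by (rule distr_distr) (use assms in \<open>auto simp: measurable_cong_sets[OF sets_configuration[OF assms(3)] refl]\<close>)

lemma suspend_id:
  assumes "\<omega> \<in> configurations M" "\<And>x. x \<in> space M \<Longrightarrow> R x = x"
  shows "suspend M R \<omega> = \<omega>"
  unfolding suspend_def using distr_cong[of \<omega> \<omega> M \<omega> R "\<lambda>x. x"] assms by (simp add: distr_id)


text \<open>Makes the Laplace functional of a random configuration a meaningful integral; the counts
  are the case of indicators.\<close>

lemma borel_measurable_nn_integral_configuration: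
  assumes "h \<in> borel_measurable M"
  shows "(\<lambda>\<omega>. \<integral>\<^sup>+x. h x \<partial>\<omega>) \<in> borel_measurable (configuration_algebra M)" (is "_ \<in> ?B")
  using assms
proof induct
  case (cong f g)
  then have "(\<lambda>\<omega>. \<integral>\<^sup>+x. f x \<partial>\<omega>) \<in> ?B \<longleftrightarrow> (\<lambda>\<omega>. \<integral>\<^sup>+x. g x \<partial>\<omega>) \<in> ?B"
    by (intro measurable_cong nn_integral_cong) auto
  with cong show ?case by simp
next
  case (set B)
  have "(\<lambda>\<omega>. \<integral>\<^sup>+x. indicator B x \<partial>\<omega>) \<in> ?B \<longleftrightarrow> (\<lambda>\<omega>. emeasure \<omega> B) \<in> ?B"
    using set by (intro measurable_cong nn_integral_indicator) auto
  then show ?case by simp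
next
  case (mult f c)
  have "(\<lambda>\<omega>. \<integral>\<^sup>+x. c * f x \<partial>\<omega>) \<in> ?B \<longleftrightarrow> (\<lambda>\<omega>. c * \<integral>\<^sup>+x. f x \<partial>\<omega>) \<in> ?B"
    using mult by (intro measurable_cong nn_integral_cmult)
      (auto simp: measurable_cong_sets[OF sets_configuration refl])
  with mult show ?case by simp
next
  case (add f g)
  have "(\<lambda>\<omega>. \<integral>\<^sup>+x. g x + f x \<partial>\<omega>) \<in> ?B \<longleftrightarrow> (\<lambda>\<omega>. (\<integral>\<^sup>+x. g x \<partial>\<omega>) + (\<integral>\<^sup>+x. f x \<partial>\<omega>)) \<in> ?B"
    using add by (intro measurable_cong nn_integral_add)
      (auto simp: measurable_cong_sets[OF sets_configuration refl])
  with add show ?case by simp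
next
  case (seq F)
  have "(\<lambda>\<omega>. \<integral>\<^sup>+x. (SUP i. F i) x \<partial>\<omega>) \<in> ?B \<longleftrightarrow> (\<lambda>\<omega>. SUP i. \<integral>\<^sup>+x. F i x \<partial>\<omega>) \<in> ?B"
    unfolding SUP_apply using seq
    by (intro measurable_cong nn_integral_monotone_convergence_SUP)
      (auto simp: measurable_cong_sets[OF sets_configuration refl])
  with seq show ?case by (simp add: ac_simps)
qed

text \<open>\<open>configurations\<close> indexes points by sets of naturals, while points arise
  here indexed by pairs, such as a piece and a rank; \<open>to_nat\<close> carries any countable
  index type over.\<close>

definition point_sum :: "'b measure \<Rightarrow> 'k::countable set \<Rightarrow> ('k \<Rightarrow> 'b) \<Rightarrow> 'b measure" where
  "point_sum M J p = distr (count_space (to_nat ` J)) M (p \<circ> from_nat)"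

lemma point_sum_configuration:
  assumes "p \<in> J \<rightarrow> space M" shows "point_sum M J p \<in> configurations M"
proof -
  have "p \<circ> from_nat \<in> to_nat ` J \<rightarrow> space M" using assms by auto
  then show ?thesis unfolding configurations_def point_sum_def by blast
qed

lemma nn_integral_point_sum:
  fixes J :: "'k::countable set"
  assumes p: "p \<in> J \<rightarrow> space M" and h: "h \<in> borel_measurable M"
  shows "(\<integral>\<^sup>+x. h x \<partial>point_sum M J p) = (\<integral>\<^sup>+k. indicator J k * h (p k) \<partial>count_space UNIV)"
proof -
  have b: "bij_betw (to_nat :: 'k \<Rightarrow> nat) J (to_nat ` J)" by (simp add: inj_on_imp_bij_betw)
  have "(\<integral>\<^sup>+x. h x \<partial>point_sum M J p) = (\<integral>\<^sup>+i. h ((p \<circ> from_nat) i) \<partial>count_space (to_nat ` J))"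
    unfolding point_sum_def by (rule nn_integral_distr) (use p h in auto)
  also have "\<dots> = (\<integral>\<^sup>+k. h ((p \<circ> from_nat) (to_nat k)) \<partial>count_space J)"
    by (rule nn_integral_bij_count_space[OF b, symmetric])
  also have "\<dots> = (\<integral>\<^sup>+k. h (p k) \<partial>count_space J)" by simp
  also have "\<dots> = (\<integral>\<^sup>+k. h (p k) \<partial>restrict_space (count_space UNIV) J)"
    by (simp add: restrict_count_space)
  also have "\<dots> = (\<integral>\<^sup>+k. h (p k) * indicator J k \<partial>count_space UNIV)"
    by (rule nn_integral_restrict_space) simp
  finally show ?thesis by (simp add: mult.commute)
qed

lemma emeasure_point_sum:
  fixes J :: "'k::countable set"
  assumes p: "p \<in> J \<rightarrow> space M" and A: "A \<in> sets M"
  shows "emeasure (point_sum M J p) A = emeasure (count_space UNIV) {k \<in> J. p k \<in> A}"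
proof -
  have "emeasure (point_sum M J p) A = (\<integral>\<^sup>+x. indicator A x \<partial>point_sum M J p)"
    using A point_sum_configuration[OF p] by simp
  also have "\<dots> = (\<integral>\<^sup>+k. indicator J k * indicator A (p k) \<partial>count_space UNIV)"
    by (rule nn_integral_point_sum[OF p]) (use A in measurable)
  also have "\<dots> = (\<integral>\<^sup>+k. indicator {k \<in> J. p k \<in> A} k \<partial>count_space UNIV)"
    by (intro nn_integral_cong) (auto simp: indicator_def)
  finally show ?thesis by simp
qed

lemma nn_integral_count_space_countable:
  fixes f :: "'k::countable \<Rightarrow> ennreal"
  shows "(\<integral>\<^sup>+k. f k \<partial>count_space UNIV) = (\<Sum>i. if i \<in> range (to_nat :: 'k \<Rightarrow> nat) then f (from_nat i) else 0)"
proof -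
  have b: "bij_betw (to_nat :: 'k \<Rightarrow> nat) UNIV (range (to_nat :: 'k \<Rightarrow> nat))" by (simp add: bij_betw_def)
  have "(\<integral>\<^sup>+k. f k \<partial>count_space UNIV) = (\<integral>\<^sup>+k. f (from_nat (to_nat (k :: 'k))) \<partial>count_space UNIV)" by simp
  also have "\<dots> = (\<integral>\<^sup>+i. f (from_nat i) \<partial>count_space (range (to_nat :: 'k \<Rightarrow> nat)))"
    by (rule nn_integral_bij_count_space[OF b])
  also have "\<dots> = (\<integral>\<^sup>+i. f (from_nat i) * indicator (range (to_nat :: 'k \<Rightarrow> nat)) i \<partial>count_space UNIV)"
    by (simp add: nn_integral_restrict_space[symmetric] restrict_count_space)
  also have "\<dots> = (\<Sum>i. f (from_nat i) * indicator (range (to_nat :: 'k \<Rightarrow> nat)) i)"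
    by (rule nn_integral_count_space_nat)
  finally show ?thesis by (simp add: indicator_def of_bool_def if_distrib cong: if_cong)
qed

text \<open>Both the index set and the points may vary with \<open>x\<close>; each count is still a
  countable sum of indicators of measurable events.\<close>

lemma measurable_point_sum:
  fixes J :: "'a \<Rightarrow> 'k::countable set"
  assumes [measurable]: "\<And>k. Measurable.pred N (\<lambda>x. k \<in> J x)" "\<And>k. (\<lambda>x. p x k) \<in> measurable N M"
  shows "(\<lambda>x. point_sum M (J x) (p x)) \<in> measurable N (configuration_algebra M)"
proof (rule measurable_configurationI)
  have sp: "p x \<in> J x \<rightarrow> space M" if "x \<in> space N" for x
    using measurable_space[OF assms(2) that] by auto
  show "point_sum M (J x) (p x) \<in> configurations M" if "x \<in> space N" for x
    by (rule point_sum_configuration[OF sp[OF that]])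
  fix A assume [measurable]: "A \<in> sets M"
  have "(\<lambda>x. emeasure (point_sum M (J x) (p x)) A) \<in> borel_measurable N \<longleftrightarrow>
     (\<lambda>x. \<Sum>i. if i \<in> range (to_nat :: 'k \<Rightarrow> nat)
        then (if from_nat i \<in> J x \<and> p x (from_nat i) \<in> A then 1 else 0) else 0 :: ennreal) \<in> borel_measurable N"
  proof (intro measurable_cong)
    fix x assume x: "x \<in> space N"
    have "emeasure (point_sum M (J x) (p x)) A =
        (\<integral>\<^sup>+k. indicator {k \<in> J x. p x k \<in> A} k \<partial>count_space UNIV)"
      by (simp add: emeasure_point_sum[OF sp[OF x]])
    also have "\<dots> = (\<Sum>i. if i \<in> range (to_nat :: 'k \<Rightarrow> nat)
        then indicator {k \<in> J x. p x k \<in> A} (from_nat i) else 0)"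
      by (rule nn_integral_count_space_countable)
    finally show "emeasure (point_sum M (J x) (p x)) A = (\<Sum>i. if i \<in> range (to_nat :: 'k \<Rightarrow> nat)
        then (if from_nat i \<in> J x \<and> p x (from_nat i) \<in> A then 1 else 0) else 0)"
      by (auto simp: indicator_def intro!: suminf_cong)
  qed
  moreover have "(\<lambda>x. \<Sum>i. if i \<in> range (to_nat :: 'k \<Rightarrow> nat)
        then (if from_nat i \<in> J x \<and> p x (from_nat i) \<in> A then 1 else 0) else 0 :: ennreal) \<in> borel_measurable N"
    by measurable
  ultimately show "(\<lambda>x. emeasure (point_sum M (J x) (p x)) A) \<in> borel_measurable N" by simp
qed

section \<open>Poisson random configurations\<close>

text \<open>This is exp(-x) on the extended half-line. The value 0 at infinity makes sums turn into
  products without exception, and lets the parameter \<infinity> turn a count into the indicator of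
  its vanishing.\<close>

definition laplace :: "ennreal \<Rightarrow> ennreal" where
  "laplace x = (if x = top then 0 else ennreal (exp (- enn2real x)))"

lemma laplace_0 [simp]: "laplace 0 = 1" and laplace_top [simp]: "laplace \<infinity> = 0" "laplace top = 0"
  by (auto simp: laplace_def)

lemma laplace_ennreal: "0 \<le> r \<Longrightarrow> laplace (ennreal r) = ennreal (exp (- r))"
  by (simp add: laplace_def)

lemma laplace_add: "laplace (x + y) = laplace x * laplace y"
  by (cases x; cases y)
    (auto simp: laplace_ennreal ennreal_plus[symmetric] exp_add exp_diff exp_minus ennreal_mult'[symmetric] field_simps
      simp del: ennreal_plus)

lemma laplace_sum: "laplace (\<Sum>i\<in>I. f i) = (\<Prod>i\<in>I. laplace (f i))"
  by (induction I rule: infinite_finite_induct) (auto simp: laplace_add)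

lemma laplace_le_1: "laplace x \<le> 1"
  by (cases x) (auto simp: laplace_ennreal)

lemma measurable_laplace [measurable (raw)]:
  assumes [measurable]: "f \<in> borel_measurable M"
  shows "(\<lambda>x. laplace (f x)) \<in> borel_measurable M"
  unfolding laplace_def by measurable

lemma laplace_antimono: "x \<le> y \<Longrightarrow> laplace y \<le> laplace x"
  by (cases x; cases y) (auto simp: laplace_ennreal ennreal_le_iff top_unique)

lemma tendsto_laplace:
  assumes "(X \<longlongrightarrow> L) F" shows "((\<lambda>i. laplace (X i)) \<longlongrightarrow> laplace L) F"
proof (cases L)
  case (real r)
  have "eventually (\<lambda>i. X i < top) F"
    using order_tendstoD(2)[OF assms, of top] real by simp
  then have ev: "eventually (\<lambda>i. ennreal (exp (- enn2real (X i))) = laplace (X i)) F"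
    by eventually_elim (auto simp: laplace_def)
  have "((\<lambda>i. enn2real (X i)) \<longlongrightarrow> r) F" using assms real by (intro tendsto_enn2real) auto
  then have "((\<lambda>i. ennreal (exp (- enn2real (X i)))) \<longlongrightarrow> ennreal (exp (- r))) F"
    by (intro tendsto_ennrealI tendsto_exp tendsto_minus)
  then have "((\<lambda>i. laplace (X i)) \<longlongrightarrow> ennreal (exp (- r))) F"
    using ev by (rule Lim_transform_eventually)
  then show ?thesis using real by (simp add: laplace_ennreal)
next
  case top
  show ?thesis
  proof (rule order_tendstoI)
    fix a assume "laplace L < a"
    then have "0 < a" using top by simp
    have "\<exists>e. 0 < e \<and> ennreal e < a"
    proof (cases a)
      case (real b)
      then show ?thesis using \<open>0 < a\<close> by (intro exI[of _ "b / 2"]) (auto simp: ennreal_less_iff)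
    qed (auto intro: exI[of _ 1])
    then obtain e where e: "0 < e" "ennreal e < a" by blast
    define r where "r = max 0 (- ln e)"
    have "eventually (\<lambda>i. ennreal r < X i) F"
      using order_tendstoD(1)[OF assms, of "ennreal r"] top by simp
    then show "eventually (\<lambda>i. laplace (X i) < a) F"
    proof eventually_elim
      case (elim i)
      have "laplace (X i) \<le> laplace (ennreal r)" using elim by (intro laplace_antimono) simp
      also have "\<dots> = ennreal (exp (- r))" by (rule laplace_ennreal) (simp add: r_def)
      also have "\<dots> \<le> ennreal e"
      proof (rule ennreal_leI)
        have "- r \<le> ln e" by (simp add: r_def)
        then have "exp (- r) \<le> exp (ln e)" by (simp only: exp_le_cancel_iff)
        then show "exp (- r) \<le> e" using e by simp
      qed
      finally show ?case using e by simp
    qed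
  qed (use top in simp)
qed

definition laplace_poisson :: "'a measure \<Rightarrow> 'a measure measure \<Rightarrow> bool" where
  "laplace_poisson M P \<longleftrightarrow> prob_space P \<and> sets P = sets (configuration_algebra M) \<and>
     (\<forall>h\<in>borel_measurable M. (\<integral>\<^sup>+\<omega>. laplace (\<integral>\<^sup>+x. h x \<partial>\<omega>) \<partial>P) = laplace (\<integral>\<^sup>+x. 1 - laplace (h x) \<partial>M))"

section \<open>Existence of the process: sampling piece by piece\<close>

lemma indep_vars_PiM_coordinate:
  assumes "\<And>i. prob_space (N i)"
  shows "prob_space.indep_vars (PiM UNIV N) N (\<lambda>i \<omega>. \<omega> i) UNIV"
proof -
  interpret product_prob_space N UNIV using assms by (rule product_prob_spaceI)
  have "distr (PiM UNIV N) (PiM UNIV N) (\<lambda>\<omega>. \<lambda>i\<in>UNIV. \<omega> i) = PiM UNIV N"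
    unfolding restrict_UNIV by (rule distr_id)
  moreover have "(\<lambda>i. distr (PiM UNIV N) (N i) (\<lambda>\<omega>. \<omega> i)) = N"
    by (rule ext) (rule PiM_component, rule UNIV_I)
  ultimately show ?thesis
    by (subst indep_vars_iff_distr_eq_PiM') simp_all
qed

lemma nn_integral_PiM_prod:
  assumes N: "\<And>i. prob_space (N i)" and "finite J"
    and f: "\<And>j. f j \<in> borel_measurable (N j)"
  shows "(\<integral>\<^sup>+\<omega>. (\<Prod>j\<in>J. f j (\<omega> j)) \<partial>PiM UNIV N) = (\<Prod>j\<in>J. \<integral>\<^sup>+x. f j x \<partial>N j)"
proof -
  interpret product_prob_space N UNIV using N by (rule product_prob_spaceI)
  have "indep_vars (\<lambda>_. borel) (\<lambda>j \<omega>. f j (\<omega> j)) J"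
    using indep_vars_compose2[OF indep_vars_subset[OF indep_vars_PiM_coordinate[OF N] subset_UNIV], of J f "\<lambda>_. borel"] f
    by simp
  then have "(\<integral>\<^sup>+\<omega>. (\<Prod>j\<in>J. f j (\<omega> j)) \<partial>PiM UNIV N) = (\<Prod>j\<in>J. \<integral>\<^sup>+\<omega>. f j (\<omega> j) \<partial>PiM UNIV N)"
    by (rule indep_vars_nn_integral[OF \<open>finite J\<close>]) simp
  moreover have "(\<integral>\<^sup>+\<omega>. f j (\<omega> j) \<partial>PiM UNIV N) = (\<integral>\<^sup>+x. f j x \<partial>N j)" for j
    using nn_integral_distr[of "\<lambda>\<omega>. \<omega> j" "PiM UNIV N" "N j" "f j"] f by (simp add: PiM_component)
  ultimately show ?thesis by simp
qed

text \<open>The generating function of the Poisson law, obtained from the exponential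
  series.\<close>

lemma nn_integral_poisson_pmf_power:
  assumes "0 \<le> a" "a \<le> 1" "0 < m"
  shows "(\<integral>\<^sup>+k. ennreal a ^ k \<partial>measure_pmf (poisson_pmf m)) = ennreal (exp (- (m * (1 - a))))"
proof -
  have s: "(\<lambda>k. exp (- m) * ((m * a) ^ k /\<^sub>R fact k)) sums (exp (- m) * exp (m * a))"
    using exp_converges by (rule sums_mult)
  have "(\<integral>\<^sup>+k. ennreal a ^ k \<partial>measure_pmf (poisson_pmf m)) = (\<Sum>k. ennreal (exp (- m) * ((m * a) ^ k /\<^sub>R fact k)))"
    unfolding nn_integral_measure_pmf nn_integral_count_space_nat
    using assms by (intro suminf_cong)
      (auto simp: pmf_poisson[OF assms(3)] ennreal_mult'[symmetric] ennreal_power power_mult_distrib field_simps)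
  also have "\<dots> = ennreal (exp (- m) * exp (m * a))"
    using s assms by (subst suminf_ennreal2) (auto simp: sums_iff)
  finally show ?thesis by (simp add: exp_add[symmetric] algebra_simps)
qed

lemma measurable_random_sum:
  assumes "h \<in> borel_measurable M"
  shows "(\<lambda>p. \<Sum>j<fst p. h (snd p j) :: ennreal) \<in> borel_measurable (count_space UNIV \<Otimes>\<^sub>M PiM (UNIV :: nat set) (\<lambda>_. M))"
proof (rule measurable_compose_countable[where f = "\<lambda>k p. \<Sum>j<k. h (snd p j)" and g = fst])
  have "(\<lambda>p. h (snd p j)) \<in> borel_measurable (count_space UNIV \<Otimes>\<^sub>M PiM (UNIV :: nat set) (\<lambda>_. M))" for j
    by (rule measurable_compose[OF _ assms], rule measurable_compose[OF measurable_snd measurable_component_singleton]) simp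
  then show "(\<lambda>p. \<Sum>j<k. h (snd p j)) \<in> borel_measurable (count_space UNIV \<Otimes>\<^sub>M PiM (UNIV :: nat set) (\<lambda>_. M))" for k :: nat
    by (intro borel_measurable_sum)
qed simp

text \<open>Mass 1 makes the restriction of \<open>M\<close> to a piece a probability: a Poisson
  number of parameter 1 of independent points drawn from it realises the process on that
  piece.\<close>

locale unit_pieces =
  fixes M :: "'a measure" and A :: "nat \<Rightarrow> 'a set"
  assumes piece [measurable]: "A n \<in> sets M"
    and pieces_disjoint: "disjoint_family A"
    and pieces_cover: "(\<Union>n. A n) = space M"
    and piece_1: "emeasure M (A n) = 1"
begin

lemma nn_integral_pieces:
  assumes [measurable]: "f \<in> borel_measurable M"
  shows "(\<Sum>n. \<integral>\<^sup>+x. f x \<partial>uniform_measure M (A n)) = (\<integral>\<^sup>+x. f x \<partial>M)"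
proof -
  have "(\<Sum>n. \<integral>\<^sup>+x. f x \<partial>uniform_measure M (A n)) = (\<Sum>n. \<integral>\<^sup>+x. f x * indicator (A n) x \<partial>M)"
    by (simp add: nn_integral_uniform_measure piece_1 divide_ennreal_def)
  also have "\<dots> = (\<integral>\<^sup>+x. (\<Sum>n. f x * indicator (A n) x) \<partial>M)"
    by (rule nn_integral_suminf[symmetric]) simp
  also have "\<dots> = (\<integral>\<^sup>+x. f x \<partial>M)"
  proof (intro nn_integral_cong)
    fix x assume "x \<in> space M"
    then have "x \<in> (\<Union>n. A n)" using pieces_cover by simp
    then have "(\<Sum>n. indicator (A n) x :: ennreal) = 1"
      using suminf_indicator[OF pieces_disjoint, of x] by simp
    then show "(\<Sum>n. f x * indicator (A n) x) = f x" by simp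
  qed
  finally show ?thesis .
qed

lemma piece_prob_space: "prob_space (uniform_measure M (A n))"
  by (intro prob_space_uniform_measure) (auto simp: piece_1)

text \<open>The first component is the number of points, the second an infinite supply of
  independent candidates, of which \<open>sample_points\<close> keeps that many.\<close>

definition sample_piece :: "nat \<Rightarrow> (nat \<times> (nat \<Rightarrow> 'a)) measure" where
  "sample_piece n = measure_pmf (poisson_pmf 1) \<Otimes>\<^sub>M PiM UNIV (\<lambda>_. uniform_measure M (A n))"

definition sample_points :: "(nat \<Rightarrow> nat \<times> (nat \<Rightarrow> 'a)) \<Rightarrow> 'a measure" where
  "sample_points \<theta> = point_sum M {(n, j). j < fst (\<theta> n)} (\<lambda>(n, j). snd (\<theta> n) j)"

lemma sample_piece_prob_space: "prob_space (sample_piece n)"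
  unfolding sample_piece_def
  by (intro prob_space_pair prob_space_PiM piece_prob_space measure_pmf.prob_space_axioms)

lemma sets_sample_piece [measurable_cong]:
  "sets (sample_piece n) = sets (count_space UNIV \<Otimes>\<^sub>M PiM UNIV (\<lambda>_. M))"
  unfolding sample_piece_def by (intro sets_pair_measure_cong sets_PiM_cong) auto

text \<open>Given \<open>k\<close> points, independence yields \<open>a ^ k\<close> with
  \<open>a\<close> the mean of \<open>laplace (h x)\<close>; averaging over \<open>k\<close> is the
  generating function of the Poisson law at \<open>a\<close>, namely exp(-(1 - a)).\<close>

lemma laplace_sample_piece:
  assumes [measurable]: "h \<in> borel_measurable M"
  shows "(\<integral>\<^sup>+p. laplace (\<Sum>j<fst p. h (snd p j)) \<partial>sample_piece n) =
         laplace (\<integral>\<^sup>+x. 1 - laplace (h x) \<partial>uniform_measure M (A n))"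
proof -
  let ?U = "uniform_measure M (A n)"
  interpret U: prob_space ?U by (rule piece_prob_space)
  interpret UU: prob_space "PiM UNIV (\<lambda>_::nat. ?U)" by (intro prob_space_PiM piece_prob_space)
  define a where "a = (\<integral>\<^sup>+x. laplace (h x) \<partial>?U)"
  have a1: "a \<le> 1"
    unfolding a_def using nn_integral_mono[of ?U "\<lambda>x. laplace (h x)" "\<lambda>_. 1"] laplace_le_1
    by (simp add: piece_1 divide_ennreal_def)
  then obtain r where r: "a = ennreal r" "0 \<le> r" "r \<le> 1"
    by (cases a) (auto simp: ennreal_le_1 top_unique)
  have [measurable]: "(\<lambda>p :: nat \<times> (nat \<Rightarrow> 'a). laplace (\<Sum>j<fst p. h (snd p j))) \<in> borel_measurable (count_space UNIV \<Otimes>\<^sub>M PiM UNIV (\<lambda>_. M))"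
    by (intro measurable_laplace measurable_random_sum assms)
  have m2: "(\<lambda>p. laplace (\<Sum>j<fst p. h (snd p j))) \<in>
      borel_measurable (measure_pmf (poisson_pmf 1) \<Otimes>\<^sub>M PiM UNIV (\<lambda>_. ?U))"
    using sets_sample_piece[unfolded sample_piece_def] by (subst measurable_cong_sets[OF _ refl]) auto
  have "(\<integral>\<^sup>+p. laplace (\<Sum>j<fst p. h (snd p j)) \<partial>sample_piece n) =
      (\<integral>\<^sup>+k. \<integral>\<^sup>+x. laplace (\<Sum>j<k. h (x j)) \<partial>PiM UNIV (\<lambda>_. ?U) \<partial>measure_pmf (poisson_pmf 1))"
    unfolding sample_piece_def using UU.nn_integral_fst[OF m2] by simp
  also have "\<dots> = (\<integral>\<^sup>+k. a ^ k \<partial>measure_pmf (poisson_pmf 1))"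
  proof (intro nn_integral_cong)
    fix k
    show "(\<integral>\<^sup>+x. laplace (\<Sum>j<k. h (x j)) \<partial>PiM UNIV (\<lambda>_. ?U)) = a ^ k"
      unfolding laplace_sum a_def
      using nn_integral_PiM_prod[of "\<lambda>_. ?U" "{..<k}" "\<lambda>_ x. laplace (h x)"] piece_prob_space by simp
  qed
  also have "\<dots> = ennreal (exp (- (1 - r)))"
    using nn_integral_poisson_pmf_power[of r 1] r by simp
  also have "\<dots> = laplace (1 - a)"
    using r by (simp add: laplace_ennreal ennreal_minus flip: ennreal_1)
  also have "1 - a = (\<integral>\<^sup>+x. 1 - laplace (h x) \<partial>?U)"
    unfolding a_def using a1[unfolded a_def]
    by (subst nn_integral_diff) (auto simp: piece_1 divide_ennreal_def laplace_le_1 top_unique)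
  finally show ?thesis .
qed

lemma measurable_sample_points:
  "sample_points \<in> measurable (PiM UNIV sample_piece) (configuration_algebra M)"
  unfolding sample_points_def[abs_def] by (rule measurable_point_sum) (auto simp: case_prod_beta)

definition sampled :: "'a measure measure" where
  "sampled = distr (PiM UNIV sample_piece) (configuration_algebra M) sample_points"

lemma nn_integral_sample_points:
  assumes \<theta>: "\<theta> \<in> space (PiM UNIV sample_piece)" and [measurable]: "h \<in> borel_measurable M"
  shows "(\<integral>\<^sup>+x. h x \<partial>sample_points \<theta>) = (\<Sum>n. \<Sum>j<fst (\<theta> n). h (snd (\<theta> n) j))"
proof -
  have sp: "snd (\<theta> n) j \<in> space M" for n j
    using \<theta> by (auto simp: space_PiM sample_piece_def space_pair_measure PiE_iff Pi_iff dest!: spec[of _ n])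
  have "(\<integral>\<^sup>+x. h x \<partial>sample_points \<theta>) =
     (\<integral>\<^sup>+k. indicator {(n, j). j < fst (\<theta> n)} k * h ((\<lambda>(n, j). snd (\<theta> n) j) k) \<partial>count_space UNIV)"
    unfolding sample_points_def by (rule nn_integral_point_sum) (use sp in auto)
  also have "\<dots> = (\<integral>\<^sup>+n. \<integral>\<^sup>+j. indicator {(n, j). j < fst (\<theta> n)} (n, j) * h ((\<lambda>(n, j). snd (\<theta> n) j) (n, j)) \<partial>count_space UNIV \<partial>count_space UNIV)"
    by (rule nn_integral_fst_count_space[symmetric])
  also have "\<dots> = (\<Sum>n. \<Sum>j. indicator {(n, j). j < fst (\<theta> n)} (n, j) * h (snd (\<theta> n) j))"
    by (simp add: nn_integral_count_space_nat)
  also have "\<dots> = (\<Sum>n. \<Sum>j<fst (\<theta> n). h (snd (\<theta> n) j))"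
  proof (intro suminf_cong)
    fix n
    show "(\<Sum>j. indicator {(n, j). j < fst (\<theta> n)} (n, j) * h (snd (\<theta> n) j)) = (\<Sum>j<fst (\<theta> n). h (snd (\<theta> n) j))"
      by (subst suminf_finite[of "{..<fst (\<theta> n)}"]) auto
  qed
  finally show ?thesis .
qed

text \<open>The pieces are independent, so for finitely many of them the functional is a product.
  All pieces are reached by a limit: dominated convergence with bound 1 on one side, continuity of
  \<open>laplace\<close> on the other.\<close>

lemma laplace_poisson_sampled: "laplace_poisson M sampled"
  unfolding laplace_poisson_def
proof (intro conjI ballI)
  interpret S: prob_space "PiM UNIV sample_piece" by (intro prob_space_PiM sample_piece_prob_space)
  show "prob_space sampled" unfolding sampled_def by (rule S.prob_space_distr[OF measurable_sample_points])
  show "sets sampled = sets (configuration_algebra M)" by (simp add: sampled_def)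
  fix h :: "'a \<Rightarrow> ennreal" assume h [measurable]: "h \<in> borel_measurable M"
  define Z where "Z n p = (\<Sum>j<fst p. h (snd p j))" for n :: nat and p :: "nat \<times> (nat \<Rightarrow> 'a)"
  have Z [measurable]: "Z n \<in> borel_measurable (sample_piece n)" for n
    unfolding Z_def measurable_cong_sets[OF sets_sample_piece refl] by (rule measurable_random_sum[OF h])
  have mt: "(\<lambda>m. laplace (\<Sum>n<m. Z n (\<theta> n))) \<longlonglongrightarrow> laplace (\<Sum>n. Z n (\<theta> n))" for \<theta>
    by (intro tendsto_laplace summable_LIMSEQ) simp
  have "(\<integral>\<^sup>+\<omega>. laplace (\<integral>\<^sup>+x. h x \<partial>\<omega>) \<partial>sampled) =
      (\<integral>\<^sup>+\<theta>. laplace (\<integral>\<^sup>+x. h x \<partial>sample_points \<theta>) \<partial>PiM UNIV sample_piece)"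
    unfolding sampled_def
    using borel_measurable_nn_integral_configuration[OF h]
    by (intro nn_integral_distr measurable_sample_points) simp
  also have "\<dots> = (\<integral>\<^sup>+\<theta>. laplace (\<Sum>n. Z n (\<theta> n)) \<partial>PiM UNIV sample_piece)"
    by (intro nn_integral_cong) (simp add: nn_integral_sample_points Z_def)
  finally have L: "(\<integral>\<^sup>+\<omega>. laplace (\<integral>\<^sup>+x. h x \<partial>\<omega>) \<partial>sampled) = \<dots>" .
  have lim1: "(\<lambda>m. \<integral>\<^sup>+\<theta>. laplace (\<Sum>n<m. Z n (\<theta> n)) \<partial>PiM UNIV sample_piece) \<longlonglongrightarrow>
      (\<integral>\<^sup>+\<theta>. laplace (\<Sum>n. Z n (\<theta> n)) \<partial>PiM UNIV sample_piece)"
    by (rule nn_integral_dominated_convergence[where w = "\<lambda>_. 1"])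
       (auto simp: laplace_le_1 S.emeasure_space_1 mt)
  have "(\<integral>\<^sup>+\<theta>. laplace (\<Sum>n<m. Z n (\<theta> n)) \<partial>PiM UNIV sample_piece) =
      laplace (\<Sum>n<m. \<integral>\<^sup>+x. 1 - laplace (h x) \<partial>uniform_measure M (A n))" for m
    unfolding laplace_sum
    by (subst nn_integral_PiM_prod[OF sample_piece_prob_space])
       (auto simp: Z_def laplace_sample_piece laplace_sum[symmetric])
  moreover have "(\<lambda>m. laplace (\<Sum>n<m. \<integral>\<^sup>+x. 1 - laplace (h x) \<partial>uniform_measure M (A n))) \<longlonglongrightarrow>
      laplace (\<Sum>n. \<integral>\<^sup>+x. 1 - laplace (h x) \<partial>uniform_measure M (A n))"
    by (intro tendsto_laplace summable_LIMSEQ) simp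
  moreover have "(\<Sum>n. \<integral>\<^sup>+x. 1 - laplace (h x) \<partial>uniform_measure M (A n)) = (\<integral>\<^sup>+x. 1 - laplace (h x) \<partial>M)"
    by (rule nn_integral_pieces) measurable
  ultimately show "(\<integral>\<^sup>+\<omega>. laplace (\<integral>\<^sup>+x. h x \<partial>\<omega>) \<partial>sampled) = laplace (\<integral>\<^sup>+x. 1 - laplace (h x) \<partial>M)"
    unfolding L by (auto intro: LIMSEQ_unique[OF lim1])
qed

end

section \<open>Uniqueness: laws of counts from Laplace transforms\<close>

lemma power_series_eq_0:
  fixes c :: "nat \<Rightarrow> real"
  assumes s: "\<And>s. 0 < s \<Longrightarrow> s < 1 \<Longrightarrow> (\<lambda>k. c k * s ^ k) sums 0"
  shows "c k = 0"
proof (induction k rule: less_induct)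
  case (less k)
  \<comment> \<open>With the earlier coefficients known to vanish, the series divided by
    \<open>s ^ k\<close> still sums to 0 on (0, 1), and its right limit at 0 is the constant term
    \<open>c k\<close>.\<close>
  define f where "f x = (\<Sum>j. c (j + k) * x ^ j)" for x
  have sums: "(\<lambda>j. c (j + k) * s ^ j) sums 0" if "0 < s" "s < 1" for s
  proof -
    have "(\<lambda>j. c (j + k) * s ^ (j + k)) sums (0 - (\<Sum>i<k. c i * s ^ i))"
      by (rule sums_split_initial_segment[OF assms[OF that]])
    then have "(\<lambda>j. (c (j + k) * s ^ (j + k)) / s ^ k) sums (0 / s ^ k)"
      using less by (intro sums_divide) simp
    then show ?thesis using that by (simp add: power_add)
  qed
  have summ: "summable (\<lambda>j. c (j + k) * x ^ j)" if "norm x < 1/2" for x :: real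
    using powser_inside[of "\<lambda>j. c (j + k)" "1/2" x] sums_summable[OF sums[of "1/2"]] that by simp
  have "(f \<longlongrightarrow> c (0 + k)) (at 0)"
    by (rule powser_limit_0[of "1/2" "\<lambda>j. c (j + k)"]) (auto simp: f_def intro!: summable_sums summ)
  then have lim: "(f \<longlongrightarrow> c k) (at_right 0)" by (simp add: filterlim_at_split)
  have "eventually (\<lambda>x. f x = 0) (at_right (0::real))"
    unfolding eventually_at_right_field
    by (intro exI[of _ 1]) (auto simp: f_def sums_iff dest: sums)
  then have "(f \<longlongrightarrow> 0) (at_right 0)" by (simp add: tendsto_eventually)
  from tendsto_unique[OF _ lim this] show ?case by simp
qed

lemma laplace_mult_of_nat: "laplace (ennreal t * of_nat k) = ennreal (exp (- t)) ^ k" if "0 < t"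
proof -
  have "ennreal t * of_nat k = ennreal (t * real k)"
    using that by (simp add: ennreal_mult ennreal_of_nat_eq_real_of_nat)
  then show ?thesis using that
    by (simp add: laplace_ennreal ennreal_power exp_of_nat_mult[symmetric] mult.commute)
qed

text \<open>Where \<open>N\<close> is infinite both integrands vanish, because
  \<open>laplace\<close> is 0 there; elsewhere exactly one term of the series survives.\<close>

lemma nn_integral_laplace_expand:
  assumes [measurable]: "Y \<in> borel_measurable P" "N \<in> borel_measurable P"
    and vals: "\<And>x. x \<in> space P \<Longrightarrow> N x = \<infinity> \<or> (\<exists>k::nat. N x = of_nat k)" and "0 < t"
  shows "(\<integral>\<^sup>+x. Y x * laplace (ennreal t * N x) \<partial>P) =
    (\<Sum>k. (\<integral>\<^sup>+x. Y x * indicator {of_nat k} (N x) \<partial>P) * ennreal (exp (- t)) ^ k)"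
proof -
  have "(\<integral>\<^sup>+x. Y x * laplace (ennreal t * N x) \<partial>P) =
      (\<integral>\<^sup>+x. (\<Sum>k. Y x * indicator {of_nat k} (N x) * ennreal (exp (- t)) ^ k) \<partial>P)"
  proof (intro nn_integral_cong)
    fix x assume x: "x \<in> space P"
    show "Y x * laplace (ennreal t * N x) = (\<Sum>k. Y x * indicator {of_nat k} (N x) * ennreal (exp (- t)) ^ k)"
    proof (cases "N x = \<infinity>")
      case True
      then show ?thesis using \<open>0 < t\<close> by (simp add: ennreal_mult_top)
    next
      case False
      then obtain k :: nat where k: "N x = of_nat k" using vals[OF x] by auto
      have "(\<Sum>j. Y x * indicator {of_nat j} (N x) * ennreal (exp (- t)) ^ j) =
          (\<Sum>j\<in>{k}. Y x * indicator {of_nat j} (N x) * ennreal (exp (- t)) ^ j)"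
        by (rule suminf_finite) (auto simp: k)
      then show ?thesis using \<open>0 < t\<close> by (simp add: k laplace_mult_of_nat)
    qed
  qed
  also have "\<dots> = (\<Sum>k. \<integral>\<^sup>+x. Y x * indicator {of_nat k} (N x) * ennreal (exp (- t)) ^ k \<partial>P)"
    by (rule nn_integral_suminf) simp
  also have "\<dots> = (\<Sum>k. (\<integral>\<^sup>+x. Y x * indicator {of_nat k} (N x) \<partial>P) * ennreal (exp (- t)) ^ k)"
    by (intro suminf_cong nn_integral_multc) measurable
  finally show ?thesis .
qed

text \<open>In the variable exp(-t) the two transforms are power series on (0, 1) whose coefficients
  are the weighted masses of \<open>N = k\<close>, and such coefficients are determined. The weight
  \<open>Y\<close> lets further coordinates ride along.\<close>

lemma laplace_determines_masses:
  assumes P: "prob_space P" "prob_space Q"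
    and [measurable]: "Y \<in> borel_measurable P" "N \<in> borel_measurable P" "Y' \<in> borel_measurable Q" "N' \<in> borel_measurable Q"
    and Y: "\<And>x. Y x \<le> 1" "\<And>x. Y' x \<le> 1"
    and vals: "\<And>x. x \<in> space P \<Longrightarrow> N x = \<infinity> \<or> (\<exists>k::nat. N x = of_nat k)"
      "\<And>x. x \<in> space Q \<Longrightarrow> N' x = \<infinity> \<or> (\<exists>k::nat. N' x = of_nat k)"
    and eq: "\<And>t::real. 0 < t \<Longrightarrow> (\<integral>\<^sup>+x. Y x * laplace (ennreal t * N x) \<partial>P) = (\<integral>\<^sup>+x. Y' x * laplace (ennreal t * N' x) \<partial>Q)"
  shows "(\<integral>\<^sup>+x. Y x * indicator {of_nat k} (N x) \<partial>P) = (\<integral>\<^sup>+x. Y' x * indicator {of_nat k} (N' x) \<partial>Q)"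
proof -
  interpret P: prob_space P by fact
  interpret Q: prob_space Q by fact
  define a where "a k = (\<integral>\<^sup>+x. Y x * indicator {of_nat k} (N x) \<partial>P)" for k :: nat
  define b where "b k = (\<integral>\<^sup>+x. Y' x * indicator {of_nat k} (N' x) \<partial>Q)" for k :: nat
  have a: "a k \<le> 1" for k
  proof -
    have "a k \<le> (\<integral>\<^sup>+x. 1 \<partial>P)" unfolding a_def by (intro nn_integral_mono) (auto simp: Y indicator_def)
    then show ?thesis by (simp add: P.emeasure_space_1)
  qed
  have b: "b k \<le> 1" for k
  proof -
    have "b k \<le> (\<integral>\<^sup>+x. 1 \<partial>Q)" unfolding b_def by (intro nn_integral_mono) (auto simp: Y indicator_def)
    then show ?thesis by (simp add: Q.emeasure_space_1)
  qed
  have ar: "a k = ennreal (enn2real (a k))" "enn2real (a k) \<le> 1" for k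
    using a[of k] by (cases "a k"; simp add: ennreal_le_1 top_unique)+
  have br: "b k = ennreal (enn2real (b k))" "enn2real (b k) \<le> 1" for k
    using b[of k] by (cases "b k"; simp add: ennreal_le_1 top_unique)+
  have summ: "summable (\<lambda>k. f k * s ^ k)" if "\<And>k. 0 \<le> f k" "\<And>k. f k \<le> 1" "0 < s" "s < 1" for f :: "nat \<Rightarrow> real" and s
    by (rule summable_comparison_test'[OF summable_geometric[of s]])
       (use that in \<open>auto intro!: mult_left_le_one_le simp: abs_mult power_abs\<close>)
  have "enn2real (a k) - enn2real (b k) = 0"
  proof (rule power_series_eq_0)
    fix s :: real assume s: "0 < s" "s < 1"
    define t where "t = - ln s"
    have t: "0 < t" "exp (- t) = s" using s by (auto simp: t_def)
    have conv: "(\<Sum>k. f k * ennreal s ^ k) = ennreal (\<Sum>k. enn2real (f k) * s ^ k)"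
      if "\<And>k. f k = ennreal (enn2real (f k))" "\<And>k. enn2real (f k) \<le> 1" for f
    proof -
      have "(\<Sum>k. f k * ennreal s ^ k) = (\<Sum>k. ennreal (enn2real (f k) * s ^ k))"
        using s that(1) by (intro suminf_cong) (metis ennreal_mult' ennreal_power enn2real_nonneg less_imp_le)
      also have "\<dots> = ennreal (\<Sum>k. enn2real (f k) * s ^ k)"
        using s by (intro suminf_ennreal2 summ that) auto
      finally show ?thesis .
    qed
    have "(\<integral>\<^sup>+x. Y x * laplace (ennreal t * N x) \<partial>P) = (\<Sum>k. a k * ennreal s ^ k)"
      unfolding a_def t(2)[symmetric] by (rule nn_integral_laplace_expand[OF _ _ vals(1) t(1)]) auto
    moreover have "(\<integral>\<^sup>+x. Y' x * laplace (ennreal t * N' x) \<partial>Q) = (\<Sum>k. b k * ennreal s ^ k)"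
      unfolding b_def t(2)[symmetric] by (rule nn_integral_laplace_expand[OF _ _ vals(2) t(1)]) auto
    ultimately have "(\<Sum>k. a k * ennreal s ^ k) = (\<Sum>k. b k * ennreal s ^ k)"
      using eq[OF t(1)] by simp
    then have "(\<Sum>k. enn2real (a k) * s ^ k) = (\<Sum>k. enn2real (b k) * s ^ k)"
      unfolding conv[OF ar] conv[OF br]
      using s by (subst (asm) ennreal_inj) (auto intro!: suminf_nonneg summ ar br)
    then show "(\<lambda>k. (enn2real (a k) - enn2real (b k)) * s ^ k) sums 0"
      using sums_diff[OF summable_sums summable_sums, OF summ summ, of "\<lambda>k. enn2real (a k)" s "\<lambda>k. enn2real (b k)" s] ar br s
      by (simp add: left_diff_distrib)
  qed
  then have "a k = b k" using ar(1)[of k] br(1)[of k] by simp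
  then show ?thesis by (simp add: a_def b_def)
qed

text \<open>Coordinates are converted one at a time from Laplace factors into indicators; those
  already converted and those still waiting form the weight \<open>Y\<close> of
  \<open>laplace_determines_masses\<close>.\<close>

lemma joint_law_unique:
  fixes N :: "'i \<Rightarrow> 'a \<Rightarrow> ennreal" and N' :: "'i \<Rightarrow> 'b \<Rightarrow> ennreal" and k :: "'i \<Rightarrow> nat"
  assumes P: "prob_space P" "prob_space Q" and I: "finite I"
    and m: "\<And>i. N i \<in> borel_measurable P" "\<And>i. N' i \<in> borel_measurable Q"
    and vals: "\<And>i x. x \<in> space P \<Longrightarrow> N i x = \<infinity> \<or> (\<exists>k::nat. N i x = of_nat k)"
      "\<And>i x. x \<in> space Q \<Longrightarrow> N' i x = \<infinity> \<or> (\<exists>k::nat. N' i x = of_nat k)"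
    and eq: "\<And>\<theta> :: 'i \<Rightarrow> real. (\<And>i. 0 < \<theta> i) \<Longrightarrow>
      (\<integral>\<^sup>+x. (\<Prod>i\<in>I. laplace (ennreal (\<theta> i) * N i x)) \<partial>P) = (\<integral>\<^sup>+x. (\<Prod>i\<in>I. laplace (ennreal (\<theta> i) * N' i x)) \<partial>Q)"
  shows "emeasure P {x \<in> space P. \<forall>i\<in>I. N i x = of_nat (k i)} = emeasure Q {x \<in> space Q. \<forall>i\<in>I. N' i x = of_nat (k i)}"
proof -
  note [measurable] = m
  have step: "(\<integral>\<^sup>+x. (\<Prod>i\<in>J. indicator {of_nat (k i)} (N i x)) * (\<Prod>i\<in>I - J. laplace (ennreal (\<theta> i) * N i x)) \<partial>P) =
      (\<integral>\<^sup>+x. (\<Prod>i\<in>J. indicator {of_nat (k i)} (N' i x)) * (\<Prod>i\<in>I - J. laplace (ennreal (\<theta> i) * N' i x)) \<partial>Q)"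
    if "finite J" "J \<subseteq> I" "\<And>i. 0 < \<theta> i" for J and \<theta> :: "'i \<Rightarrow> real"
    using that
  proof (induction J arbitrary: \<theta> rule: finite_induct)
    case empty
    then show ?case using eq[of \<theta>] by simp
  next
    case (insert j J)
    define Y where "Y x = (\<Prod>i\<in>J. indicator {of_nat (k i)} (N i x)) * (\<Prod>i\<in>I - insert j J. laplace (ennreal (\<theta> i) * N i x))" for x
    define Y' where "Y' x = (\<Prod>i\<in>J. indicator {of_nat (k i)} (N' i x)) * (\<Prod>i\<in>I - insert j J. laplace (ennreal (\<theta> i) * N' i x))" for x
    have [measurable]: "Y \<in> borel_measurable P" "Y' \<in> borel_measurable Q" unfolding Y_def Y'_def by measurable
    have "(\<Prod>i\<in>J. f i) * (\<Prod>i\<in>K. g i) \<le> 1" if "\<And>i. f i \<le> 1" "\<And>i. g i \<le> 1" for f g :: "'i \<Rightarrow> ennreal" and K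
      using mult_mono[of "\<Prod>i\<in>J. f i" 1 "\<Prod>i\<in>K. g i" 1] that by (simp add: prod_le_1)
    then have le: "Y x \<le> 1" "Y' y \<le> 1" for x y
      unfolding Y_def Y'_def by (auto simp: laplace_le_1 indicator_def)
    have "(\<integral>\<^sup>+x. Y x * indicator {of_nat (k j)} (N j x) \<partial>P) = (\<integral>\<^sup>+x. Y' x * indicator {of_nat (k j)} (N' j x) \<partial>Q)"
    proof (rule laplace_determines_masses[OF P _ _ _ _ le vals])
      fix t :: real assume t: "0 < t"
      \<comment> \<open>The induction hypothesis holds for all parameters, so the one of
        \<open>j\<close> may be varied freely as \<open>t\<close> while the weight stays
        fixed.\<close>
      have *: "I - J = insert j (I - insert j J)" using insert by auto
      have "(\<Prod>i\<in>I - J. laplace (ennreal ((\<theta>(j := t)) i) * N i x)) =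
        laplace (ennreal t * N j x) * (\<Prod>i\<in>I - insert j J. laplace (ennreal (\<theta> i) * N i x))" for x
        unfolding * using I by (subst prod.insert) (auto intro!: prod.cong arg_cong2[where f = "(*)"])
      moreover have "(\<Prod>i\<in>I - J. laplace (ennreal ((\<theta>(j := t)) i) * N' i x)) =
        laplace (ennreal t * N' j x) * (\<Prod>i\<in>I - insert j J. laplace (ennreal (\<theta> i) * N' i x))" for x
        unfolding * using I by (subst prod.insert) (auto intro!: prod.cong arg_cong2[where f = "(*)"])
      ultimately show "(\<integral>\<^sup>+x. Y x * laplace (ennreal t * N j x) \<partial>P) = (\<integral>\<^sup>+x. Y' x * laplace (ennreal t * N' j x) \<partial>Q)"
        using insert.IH[of "\<theta>(j := t)"] insert.prems t unfolding Y_def Y'_def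
        by (simp add: mult_ac)
    qed auto
    then show ?case unfolding Y_def Y'_def using insert.hyps by (simp add: mult_ac)
  qed
  have *: "(\<Prod>i\<in>I. indicator {of_nat (k i)} (g i)) = (indicator {g. \<forall>i\<in>I. g i = of_nat (k i)} g :: ennreal)" for g :: "'i \<Rightarrow> ennreal"
    using I by (induction I rule: finite_induct) (auto simp: indicator_def)
  have "(\<integral>\<^sup>+x. indicator {x \<in> space P. \<forall>i\<in>I. N i x = of_nat (k i)} x \<partial>P) =
      (\<integral>\<^sup>+x. indicator {x \<in> space Q. \<forall>i\<in>I. N' i x = of_nat (k i)} x \<partial>Q)"
    using step[of I "\<lambda>_. 1"] I unfolding *
    by (simp add: indicator_def conj_commute cong: nn_integral_cong_simp)
  moreover have "{x \<in> space P. \<forall>i\<in>I. N i x = of_nat (k i)} \<in> sets P" "{x \<in> space Q. \<forall>i\<in>I. N' i x = of_nat (k i)} \<in> sets Q"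
    using I by measurable
  ultimately show ?thesis by simp
qed


section \<open>Events that prescribe finitely many counts\<close>

lemma borel_measurable_cmult_indicator:
  assumes [measurable]: "A \<in> sets N"
  shows "(\<lambda>x. c * indicator A x :: ennreal) \<in> borel_measurable N"
  by measurable

text \<open>These events form a pi-system that determines the law. Confining the sets to a window
  \<open>W\<close> gives the information carried by the points in \<open>W\<close>, which is the
  form in which independence is stated.\<close>

definition count_events :: "'a measure \<Rightarrow> 'a set \<Rightarrow> 'a measure set set" where
  "count_events M W = {{\<omega> \<in> configurations M. \<forall>(A, k)\<in>F. emeasure \<omega> A = of_nat k} | F :: ('a set \<times> nat) set.
     finite F \<and> (\<forall>(A, k)\<in>F. A \<in> sets M \<and> A \<subseteq> W \<and> emeasure M A < \<infinity>)}"

definition count_algebra :: "'a measure \<Rightarrow> 'a set \<Rightarrow> 'a measure measure" where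
  "count_algebra M W = sigma (configurations M) (count_events M W)"

lemma count_events_Pow: "count_events M W \<subseteq> Pow (configurations M)"
  by (auto simp: count_events_def)

lemma space_count_algebra [simp]: "space (count_algebra M W) = configurations M"
  unfolding count_algebra_def by (rule space_measure_of[OF count_events_Pow])

lemma sets_count_algebra: "sets (count_algebra M W) = sigma_sets (configurations M) (count_events M W)"
  unfolding count_algebra_def by (rule sets_measure_of[OF count_events_Pow])

lemma Int_stable_count_events: "Int_stable (count_events M W)"
proof (rule Int_stableI)
  fix a b assume "a \<in> count_events M W" "b \<in> count_events M W"
  then obtain F G :: "('a set \<times> nat) set" where
    F: "a = {\<omega> \<in> configurations M. \<forall>(A, k)\<in>F. emeasure \<omega> A = of_nat k}" "finite F"
      "\<forall>(A, k)\<in>F. A \<in> sets M \<and> A \<subseteq> W \<and> emeasure M A < \<infinity>" and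
    G: "b = {\<omega> \<in> configurations M. \<forall>(A, k)\<in>G. emeasure \<omega> A = of_nat k}" "finite G"
      "\<forall>(A, k)\<in>G. A \<in> sets M \<and> A \<subseteq> W \<and> emeasure M A < \<infinity>"
    unfolding count_events_def by blast
  have "a \<inter> b = {\<omega> \<in> configurations M. \<forall>(A, k)\<in>F \<union> G. emeasure \<omega> A = of_nat k}"
    unfolding F(1) G(1) by auto
  then show "a \<inter> b \<in> count_events M W"
    unfolding count_events_def using F G by (intro CollectI exI[of _ "F \<union> G"]) auto
qed

text \<open>Infinity is the one value that the hypothesis \<open>k\<close> does not cover; its
  preimage is the complement of those of the countably many others.\<close>

lemma measurable_nat_valued:
  fixes f :: "'a \<Rightarrow> ennreal"
  assumes vals: "\<And>x. x \<in> space N \<Longrightarrow> f x = \<infinity> \<or> (\<exists>k::nat. f x = of_nat k)"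
    and k: "\<And>k::nat. {x \<in> space N. f x = of_nat k} \<in> sets N"
  shows "f \<in> borel_measurable N"
proof (rule measurableI)
  fix S :: "ennreal set" assume "S \<in> sets borel"
  have "f -` S \<inter> space N = (\<Union>k\<in>{k. of_nat k \<in> S}. {x \<in> space N. f x = of_nat k}) \<union>
      (if \<infinity> \<in> S then space N - (\<Union>k. {x \<in> space N. f x = of_nat k}) else {})"
  proof (intro set_eqI iffI)
    fix x assume x: "x \<in> f -` S \<inter> space N"
    then consider "f x = \<infinity>" "\<forall>k::nat. f x \<noteq> of_nat k" | k :: nat where "f x = of_nat k" using vals[of x] by fastforce
    then show "x \<in> (\<Union>k\<in>{k. of_nat k \<in> S}. {x \<in> space N. f x = of_nat k}) \<union>
      (if \<infinity> \<in> S then space N - (\<Union>k. {x \<in> space N. f x = of_nat k}) else {})"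
      using x by cases auto
  next
    fix x assume "x \<in> (\<Union>k\<in>{k. of_nat k \<in> S}. {x \<in> space N. f x = of_nat k}) \<union>
      (if \<infinity> \<in> S then space N - (\<Union>k. {x \<in> space N. f x = of_nat k}) else {})"
    then show "x \<in> f -` S \<inter> space N" using vals[of x] by (auto split: if_splits)
  qed
  also have "\<dots> \<in> sets N" using k by (auto intro!: sets.Un sets.Diff sets.countable_UN'')
  finally show "f -` S \<inter> space N \<in> sets N" .
qed simp

lemma configuration_vals:
  "\<omega> \<in> configurations M \<Longrightarrow> emeasure \<omega> A = \<infinity> \<or> (\<exists>k::nat. emeasure \<omega> A = of_nat k)"
  using emeasure_configuration_nat by blast

lemma configuration_top:
  "\<omega> \<in> configurations M \<Longrightarrow> \<forall>k::nat. emeasure \<omega> A \<noteq> of_nat k \<Longrightarrow> emeasure \<omega> A = top"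
  using configuration_vals[of \<omega> M A] by auto

lemma measurable_count_algebra:
  assumes "A \<in> sets M" "A \<subseteq> W" "emeasure M A < \<infinity>"
  shows "(\<lambda>\<omega>. emeasure \<omega> A) \<in> borel_measurable (count_algebra M W)"
proof (rule measurable_nat_valued)
  fix k :: nat
  have "{\<omega> \<in> configurations M. emeasure \<omega> A = of_nat k} \<in> count_events M W"
    unfolding count_events_def using assms by (intro CollectI exI[of _ "{(A, k)}"]) auto
  then show "{x \<in> space (count_algebra M W). emeasure x A = of_nat k} \<in> sets (count_algebra M W)"
    unfolding sets_count_algebra by (auto intro: sigma_sets.Basic)
qed (use configuration_vals in auto)

lemma count_events_sets: "count_events M W \<subseteq> sets (configuration_algebra M)"
proof
  fix E assume "E \<in> count_events M W"
  then obtain F :: "('a set \<times> nat) set" where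
    F: "E = {\<omega> \<in> configurations M. \<forall>(A, k)\<in>F. emeasure \<omega> A = of_nat k}" "finite F"
    unfolding count_events_def by blast
  have "{\<omega> \<in> space (configuration_algebra M). \<forall>q\<in>F. emeasure \<omega> (fst q) = of_nat (snd q)} \<in> sets (configuration_algebra M)"
    using F(2) by measurable
  then show "E \<in> sets (configuration_algebra M)" unfolding F(1) by (simp add: case_prod_beta)
qed

lemma sets_count_algebra_subset: "sets (count_algebra M W) \<subseteq> sets (configuration_algebra M)"
  unfolding sets_count_algebra
  using sets.sigma_sets_subset[OF count_events_sets[of M W]] by simp

text \<open>The generators only mention sets of finite mass; any other count is a countable sum over
  a disjoint partition of the space into sets of finite mass.\<close>

lemma sets_configuration_algebra_eq:
  assumes "sigma_finite_measure M"
  shows "sets (configuration_algebra M) = sigma_sets (configurations M) (count_events M UNIV)"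
proof
  interpret sigma_finite_measure M by fact
  obtain A :: "nat \<Rightarrow> 'a set" where A: "range A \<subseteq> sets M" "(\<Union>i. A i) = space M"
    "\<And>i. emeasure M (A i) \<noteq> \<infinity>" "disjoint_family A"
    using sigma_finite_disjoint by blast
  have "(\<lambda>\<omega>. \<omega>) \<in> measurable (count_algebra M UNIV) (configuration_algebra M)"
  proof (rule measurable_configurationI)
    fix B assume B: "B \<in> sets M"
    have "emeasure M (A i \<inter> B) < \<infinity>" for i
      using A(3)[of i] emeasure_mono[of "A i \<inter> B" "A i" M] A(1) by (auto simp: less_top top_unique)
    then have m: "(\<lambda>\<omega>. emeasure \<omega> (A i \<inter> B)) \<in> borel_measurable (count_algebra M UNIV)" for i
      using A(1) B by (intro measurable_count_algebra) auto
    have "emeasure \<omega> B = (\<Sum>i. emeasure \<omega> (A i \<inter> B))" if "\<omega> \<in> configurations M" for \<omega>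
    proof -
      have "(\<Sum>i. emeasure \<omega> (A i \<inter> B)) = emeasure \<omega> (\<Union>i. A i \<inter> B)"
        using A B that by (intro suminf_emeasure) (auto simp: disjoint_family_on_def, blast)
      also have "(\<Union>i. A i \<inter> B) = B" using A(2) sets.sets_into_space[OF B] by auto
      finally show ?thesis by simp
    qed
    then show "(\<lambda>\<omega>. emeasure \<omega> B) \<in> borel_measurable (count_algebra M UNIV)"
      using m by (subst measurable_cong[where g = "\<lambda>\<omega>. \<Sum>i. emeasure \<omega> (A i \<inter> B)"]) auto
  qed auto
  then show "sets (configuration_algebra M) \<subseteq> sigma_sets (configurations M) (count_events M UNIV)"
    unfolding sets_count_algebra[symmetric]
    using measurable_sets[of "\<lambda>\<omega>. \<omega>" "count_algebra M UNIV" "configuration_algebra M"]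
    by (auto dest: sets.sets_into_space simp: Int_absorb2 vimage_def) (metis (no_types, lifting) Int_absorb2 inf_commute sets.sets_into_space space_configuration_algebra)
qed (use sets_count_algebra_subset in \<open>auto simp: sets_count_algebra\<close>)

section \<open>Consequences of the Laplace functional: counts, invariance, independence\<close>

locale poisson_law =
  fixes M :: "'a measure" and P :: "'a measure measure"
  assumes laplace_poisson: "laplace_poisson M P" and base_sigma_finite: "sigma_finite_measure M"
begin

sublocale prob_space P using laplace_poisson by (simp add: laplace_poisson_def)

lemma sets_P [simp, measurable_cong]: "sets P = sets (configuration_algebra M)"
  using laplace_poisson by (simp add: laplace_poisson_def)

lemma space_P [simp]: "space P = configurations M"
  using sets_eq_imp_space_eq[OF sets_P] by simp

lemma measurable_emeasure_P [measurable]: "(\<lambda>\<omega>. emeasure \<omega> A) \<in> borel_measurable P"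
  by measurable

lemma count_event [measurable]: "{\<omega> \<in> configurations M. emeasure \<omega> A = c} \<in> sets P"
  using measurable_sets[OF measurable_emeasure_P borel_closed[OF closed_singleton], of A c]
  by (simp add: vimage_def Int_def conj_commute)

lemma count_event_not [measurable]: "{\<omega> \<in> configurations M. emeasure \<omega> A \<noteq> c} \<in> sets P"
proof -
  have "{\<omega> \<in> configurations M. emeasure \<omega> A \<noteq> c} = space P - {\<omega> \<in> configurations M. emeasure \<omega> A = c}" by auto
  then show ?thesis using count_event by (simp only: sets.compl_sets)
qed

lemma laplace_functional:
  "h \<in> borel_measurable M \<Longrightarrow> (\<integral>\<^sup>+\<omega>. laplace (\<integral>\<^sup>+x. h x \<partial>\<omega>) \<partial>P) = laplace (\<integral>\<^sup>+x. 1 - laplace (h x) \<partial>M)"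
  using laplace_poisson by (simp add: laplace_poisson_def)

lemma nn_integral_simple_configuration:
  assumes "\<omega> \<in> configurations M" "finite I" "\<And>i. i \<in> I \<Longrightarrow> A i \<in> sets M"
  shows "(\<integral>\<^sup>+x. (\<Sum>i\<in>I. c i * indicator (A i) x) \<partial>\<omega>) = (\<Sum>i\<in>I. c i * emeasure \<omega> (A i))"
  proof -
  have [simp]: "sets \<omega> = sets M" using assms(1) by simp
  have "(\<integral>\<^sup>+x. (\<Sum>i\<in>I. c i * indicator (A i) x) \<partial>\<omega>) = (\<Sum>i\<in>I. \<integral>\<^sup>+x. c i * indicator (A i) x \<partial>\<omega>)"
    using assms(3) by (intro nn_integral_sum borel_measurable_cmult_indicator) simp
  also have "\<dots> = (\<Sum>i\<in>I. c i * emeasure \<omega> (A i))"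
    using assms(3) by (intro sum.cong refl nn_integral_cmult_indicator) simp
  finally show ?thesis .
qed

lemma laplace_counts:
  assumes "finite I" "\<And>i. i \<in> I \<Longrightarrow> A i \<in> sets M"
  shows "(\<integral>\<^sup>+\<omega>. (\<Prod>i\<in>I. laplace (c i * emeasure \<omega> (A i))) \<partial>P) =
    laplace (\<integral>\<^sup>+x. 1 - laplace (\<Sum>i\<in>I. c i * indicator (A i) x) \<partial>M)"
proof -
  have "(\<integral>\<^sup>+\<omega>. (\<Prod>i\<in>I. laplace (c i * emeasure \<omega> (A i))) \<partial>P) =
      (\<integral>\<^sup>+\<omega>. laplace (\<integral>\<^sup>+x. (\<Sum>i\<in>I. c i * indicator (A i) x) \<partial>\<omega>) \<partial>P)"
    using assms by (intro nn_integral_cong) (simp only: space_P nn_integral_simple_configuration laplace_sum)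
  also have "\<dots> = laplace (\<integral>\<^sup>+x. 1 - laplace (\<Sum>i\<in>I. c i * indicator (A i) x) \<partial>M)"
    using assms(2)
    by (intro laplace_functional borel_measurable_sum borel_measurable_cmult_indicator)
  finally show ?thesis .
qed

lemma laplace_count:
  assumes "A \<in> sets M"
  shows "(\<integral>\<^sup>+\<omega>. laplace (c * emeasure \<omega> A) \<partial>P) = laplace ((1 - laplace c) * emeasure M A)"
proof -
  have "(\<integral>\<^sup>+\<omega>. laplace (c * emeasure \<omega> A) \<partial>P) = laplace (\<integral>\<^sup>+x. 1 - laplace (c * indicator A x) \<partial>M)"
    using laplace_counts[of "{()}" "\<lambda>_. A" "\<lambda>_. c"] assms by simp
  also have "(\<integral>\<^sup>+x. 1 - laplace (c * indicator A x) \<partial>M) = (\<integral>\<^sup>+x. (1 - laplace c) * indicator A x \<partial>M)"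
    by (intro nn_integral_cong) (auto simp: indicator_def)
  also have "\<dots> = (1 - laplace c) * emeasure M A" using assms by (rule nn_integral_cmult_indicator)
  finally show ?thesis .
qed

text \<open>This is \<open>laplace_count\<close> at the parameter \<infinity>, because
  \<open>laplace (\<infinity> * N)\<close> is the indicator of \<open>N = 0\<close>.\<close>

lemma emeasure_void:
  assumes "A \<in> sets M"
  shows "emeasure P {\<omega> \<in> space P. emeasure \<omega> A = 0} = laplace (emeasure M A)"
proof -
  have "emeasure P {\<omega> \<in> space P. emeasure \<omega> A = 0} = (\<integral>\<^sup>+\<omega>. indicator {\<omega> \<in> space P. emeasure \<omega> A = 0} \<omega> \<partial>P)"
    by (rule nn_integral_indicator[symmetric]) (simp add: count_event[unfolded sets_P])
  also have "\<dots> = (\<integral>\<^sup>+\<omega>. laplace (\<infinity> * emeasure \<omega> A) \<partial>P)"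
    by (intro nn_integral_cong) (auto simp: indicator_def ennreal_top_mult)
  finally show ?thesis using laplace_count[OF assms, of "\<infinity>"] by simp
qed

text \<open>From 1 - exp(-r) \<le> r. This is how smallness in the base becomes smallness for the
  process in the later approximations.\<close>

lemma emeasure_hit_le:
  assumes A: "A \<in> sets M"
  shows "emeasure P {\<omega> \<in> space P. emeasure \<omega> A \<noteq> 0} \<le> emeasure M A"
proof (cases "emeasure M A")
  case (real r)
  have "emeasure P {\<omega> \<in> space P. emeasure \<omega> A \<noteq> 0} = emeasure P (space P - {\<omega> \<in> space P. emeasure \<omega> A = 0})"
    by (rule arg_cong[where f = "emeasure P"]) auto
  also have "\<dots> = emeasure P (space P) - emeasure P {\<omega> \<in> space P. emeasure \<omega> A = 0}"
    by (rule emeasure_compl) (use count_event in auto)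
  also have "\<dots> = 1 - ennreal (exp (- r))"
    using real by (subst emeasure_void[OF A], subst emeasure_space_1) (simp add: laplace_ennreal)
  also have "\<dots> = ennreal (1 - exp (- r))" using real by (simp add: ennreal_minus flip: ennreal_1)
  also have "\<dots> \<le> ennreal r" using exp_ge_add_one_self[of "- r"] by (intro ennreal_leI) simp
  finally show ?thesis using real by simp
qed simp

lemma AE_count_0:
  assumes "A \<in> sets M" "emeasure M A = 0"
  shows "AE \<omega> in P. emeasure \<omega> A = 0"
proof (rule AE_I)
  show "emeasure P {\<omega> \<in> space P. emeasure \<omega> A \<noteq> 0} = 0"
    using emeasure_hit_le[OF assms(1)] assms(2) by simp
qed (use count_event_not in auto)

text \<open>Let the parameter \<open>c\<close> tend to 0 from above: \<open>laplace (c * N)\<close>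
  stays below the indicator of \<open>N < \<infinity>\<close>, while its mean tends to 1.\<close>

lemma AE_count_finite:
  assumes A: "A \<in> sets M" "emeasure M A < \<infinity>"
  shows "AE \<omega> in P. emeasure \<omega> A < \<infinity>"
proof -
  obtain m where m: "emeasure M A = ennreal m" "0 \<le> m" using A by (cases "emeasure M A") auto
  have ev [measurable]: "{\<omega> \<in> space P. emeasure \<omega> A < \<infinity>} \<in> sets P" by measurable
  have le: "laplace ((1 - laplace (ennreal (1 / real (Suc n)))) * emeasure M A) \<le> emeasure P {\<omega> \<in> space P. emeasure \<omega> A < \<infinity>}" for n
  proof -
    have "laplace ((1 - laplace (ennreal (1 / real (Suc n)))) * emeasure M A) = (\<integral>\<^sup>+\<omega>. laplace (ennreal (1 / real (Suc n)) * emeasure \<omega> A) \<partial>P)"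
      by (rule laplace_count[OF A(1), symmetric])
    also have "\<dots> \<le> (\<integral>\<^sup>+\<omega>. indicator {\<omega> \<in> space P. emeasure \<omega> A < \<infinity>} \<omega> \<partial>P)"
    proof (intro nn_integral_mono)
      fix \<omega> assume "\<omega> \<in> space P"
      then show "laplace (ennreal (1 / real (Suc n)) * emeasure \<omega> A) \<le> indicator {\<omega> \<in> space P. emeasure \<omega> A < \<infinity>} \<omega>"
        by (cases "emeasure \<omega> A = \<infinity>") (auto simp: laplace_le_1 ennreal_mult_top less_top)
    qed
    also have "\<dots> = emeasure P {\<omega> \<in> space P. emeasure \<omega> A < \<infinity>}" by (rule nn_integral_indicator) fact
    finally show ?thesis .
  qed
  have "(\<lambda>n. ennreal (exp (- ((1 - exp (- (1 / real (Suc n)))) * m)))) \<longlonglongrightarrow> ennreal (exp (- ((1 - exp (- 0)) * m)))"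
    by (intro tendsto_intros LIMSEQ_inverse_real_of_nat[unfolded inverse_eq_divide])
  moreover have "laplace ((1 - laplace (ennreal (1 / real (Suc n)))) * emeasure M A) = ennreal (exp (- ((1 - exp (- (1 / real (Suc n)))) * m)))" for n
    using m by (simp add: laplace_ennreal ennreal_minus ennreal_mult[symmetric] flip: ennreal_1)
  ultimately have "1 \<le> emeasure P {\<omega> \<in> space P. emeasure \<omega> A < \<infinity>}"
    using le by (intro LIMSEQ_le_const2[of "\<lambda>n. ennreal (exp (- ((1 - exp (- (1 / real (Suc n)))) * m)))" 1]) auto
  then have "prob {\<omega> \<in> space P. emeasure \<omega> A < \<infinity>} = 1"
    by (simp add: emeasure_eq_measure measure_ge_1_iff)
  then show ?thesis by (simp only: prob_Collect_eq_1[OF ev])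
qed

text \<open>The transform of the count agrees with that of the Poisson law on the naturals, so
  \<open>joint_law_unique\<close> applies with a single index.\<close>

lemma prob_count:
  assumes A: "A \<in> sets M" "0 < emeasure M A" "emeasure M A < \<infinity>"
  shows "prob {\<omega> \<in> space P. emeasure \<omega> A = of_nat k} = pmf (poisson_pmf (measure M A)) k"
proof -
  define m where "m = measure M A"
  have em: "emeasure M A = ennreal m" using A by (simp add: m_def emeasure_eq_ennreal_measure less_top)
  then have m: "0 < m" using A by simp
  have "emeasure P {\<omega> \<in> space P. \<forall>i\<in>{()}. (\<lambda>_ \<omega>. emeasure \<omega> A) i \<omega> = of_nat ((\<lambda>_. k) i)} =
     emeasure (measure_pmf (poisson_pmf m)) {j \<in> space (measure_pmf (poisson_pmf m)). \<forall>i\<in>{()}. (\<lambda>_ j. of_nat j) i j = (of_nat ((\<lambda>_. k) i) :: ennreal)}"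
  proof (rule joint_law_unique)
    fix \<theta> :: "unit \<Rightarrow> real" assume \<theta>: "\<And>i. 0 < \<theta> i"
    let ?t = "\<theta> ()"
    have "(\<integral>\<^sup>+x. (\<Prod>i\<in>{()}. laplace (ennreal (\<theta> i) * emeasure x A)) \<partial>P) = laplace ((1 - laplace (ennreal ?t)) * emeasure M A)"
      using laplace_count[OF A(1), of "ennreal ?t"] by simp
    also have "\<dots> = ennreal (exp (- (m * (1 - exp (- ?t)))))"
      using \<theta>[of "()"] m by (simp add: em laplace_ennreal ennreal_minus ennreal_mult[symmetric] mult.commute flip: ennreal_1)
    also have "\<dots> = (\<integral>\<^sup>+j. ennreal (exp (- ?t)) ^ j \<partial>measure_pmf (poisson_pmf m))"
      using \<theta>[of "()"] m by (subst nn_integral_poisson_pmf_power) auto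
    finally show "(\<integral>\<^sup>+x. (\<Prod>i\<in>{()}. laplace (ennreal (\<theta> i) * emeasure x A)) \<partial>P) =
      (\<integral>\<^sup>+x. (\<Prod>i\<in>{()}. laplace (ennreal (\<theta> i) * of_nat x)) \<partial>measure_pmf (poisson_pmf m))"
      using \<theta>[of "()"] by (simp add: laplace_mult_of_nat)
  qed (auto simp: configuration_top prob_space_axioms measure_pmf.prob_space_axioms)
  then have "emeasure P {\<omega> \<in> space P. emeasure \<omega> A = of_nat k} = emeasure (measure_pmf (poisson_pmf m)) {k}"
    by (simp add: singleton_conv)
  then show ?thesis
    by (simp add: emeasure_eq_measure measure_pmf.emeasure_eq_measure measure_pmf_single m_def)
qed

text \<open>In the Laplace functional, invariance is a mere change of variables in the integral over
  \<open>M\<close>.\<close>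

lemma emeasure_count_events_eq:
  assumes T: "T \<in> measurable M M" "distr M M T = M"
    and F: "finite F" "\<And>A k. (A, k) \<in> F \<Longrightarrow> A \<in> sets M"
  shows "emeasure P {\<omega> \<in> space P. \<forall>q\<in>F. emeasure \<omega> (T -` fst q \<inter> space M) = of_nat (snd q :: nat)} =
     emeasure P {\<omega> \<in> space P. \<forall>q\<in>F. emeasure \<omega> (fst q) = of_nat (snd q)}"
proof (rule joint_law_unique)
  fix \<theta> :: "'a set \<times> nat \<Rightarrow> real"
  let ?h = "\<lambda>x. \<Sum>q\<in>F. ennreal (\<theta> q) * indicator (fst q) x"
  have F': "q \<in> F \<Longrightarrow> fst q \<in> sets M" for q using F(2)[of "fst q" "snd q"] by simp
  have "(\<integral>\<^sup>+\<omega>. (\<Prod>q\<in>F. laplace (ennreal (\<theta> q) * emeasure \<omega> (T -` fst q \<inter> space M))) \<partial>P) =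
    laplace (\<integral>\<^sup>+x. 1 - laplace (\<Sum>q\<in>F. ennreal (\<theta> q) * indicator (T -` fst q \<inter> space M) x) \<partial>M)"
    using F F' T(1) by (intro laplace_counts) auto
  also have "(\<integral>\<^sup>+x. 1 - laplace (\<Sum>q\<in>F. ennreal (\<theta> q) * indicator (T -` fst q \<inter> space M) x) \<partial>M) = (\<integral>\<^sup>+x. 1 - laplace (?h (T x)) \<partial>M)"
    by (intro nn_integral_cong arg_cong[where f = "\<lambda>x. 1 - laplace x"] sum.cong) (auto simp: indicator_def)
  also have "\<dots> = (\<integral>\<^sup>+x. 1 - laplace (?h x) \<partial>distr M M T)"
    using F' by (intro nn_integral_distr[symmetric] T) auto
  also have "laplace \<dots> = (\<integral>\<^sup>+\<omega>. (\<Prod>q\<in>F. laplace (ennreal (\<theta> q) * emeasure \<omega> (fst q))) \<partial>P)"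
    unfolding T(2) using F F' by (intro laplace_counts[symmetric]) auto
  finally show "(\<integral>\<^sup>+\<omega>. (\<Prod>q\<in>F. laplace (ennreal (\<theta> q) * emeasure \<omega> (T -` fst q \<inter> space M))) \<partial>P) =
    (\<integral>\<^sup>+\<omega>. (\<Prod>q\<in>F. laplace (ennreal (\<theta> q) * emeasure \<omega> (fst q))) \<partial>P)" .
qed (use F in \<open>auto simp: configuration_top prob_space_axioms\<close>)

lemma distr_suspend:
  assumes T: "T \<in> measurable M M" "distr M M T = M"
  shows "distr P P (suspend M T) = P"
proof -
  have [measurable]: "suspend M T \<in> measurable P P"
    using measurable_suspend[OF T(1)] by (simp cong: measurable_cong_sets)
  show ?thesis
  proof (rule measure_eqI_generator_eq[OF Int_stable_count_events[of M UNIV], where \<Omega> = "configurations M" and A = "\<lambda>_. configurations M"])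
    fix X assume X: "X \<in> count_events M UNIV"
    then obtain F :: "('a set \<times> nat) set" where
      F: "X = {\<omega> \<in> configurations M. \<forall>(A, k)\<in>F. emeasure \<omega> A = of_nat k}" "finite F"
        "\<forall>(A, k)\<in>F. A \<in> sets M \<and> A \<subseteq> UNIV \<and> emeasure M A < \<infinity>"
      unfolding count_events_def by blast
    have XP: "X \<in> sets P" using X count_events_sets by auto
    have "emeasure (distr P P (suspend M T)) X = emeasure P (suspend M T -` X \<inter> space P)"
      by (rule emeasure_distr) (use XP in auto)
    also have "suspend M T -` X \<inter> space P = {\<omega> \<in> space P. \<forall>q\<in>F. emeasure \<omega> (T -` fst q \<inter> space M) = of_nat (snd q :: nat)}"
      using F(3) suspend_configuration[OF T(1)] emeasure_suspend[OF T(1)] by (fastforce simp: F(1))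
    also have "emeasure P \<dots> = emeasure P {\<omega> \<in> space P. \<forall>q\<in>F. emeasure \<omega> (fst q) = of_nat (snd q)}"
      by (rule emeasure_count_events_eq[OF T F(2)]) (use F(3) in auto)
    also have "{\<omega> \<in> space P. \<forall>q\<in>F. emeasure \<omega> (fst q) = of_nat (snd q)} = X"
      unfolding F(1) by (simp add: case_prod_beta)
    finally show "emeasure (distr P P (suspend M T)) X = emeasure P X" .
  next
    show "range (\<lambda>_. configurations M) \<subseteq> count_events M UNIV"
      unfolding count_events_def by (auto intro!: exI[of _ "{}"])
    show "emeasure (distr P P (suspend M T)) (configurations M) \<noteq> \<infinity>"
      using prob_space_distr[of "suspend M T" P] by (metis (no_types) \<open>suspend M T \<in> measurable P P\<close> infinity_ennreal_def prob_space.emeasure_space_1 space_P space_distr ennreal_one_neq_top)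
  qed (use sets_configuration_algebra_eq[OF base_sigma_finite] in \<open>auto dest: subsetD[OF count_events_Pow]\<close>)
qed

text \<open>The counts are compared with those of a product of copies of \<open>P\<close>, one copy
  for each window. For disjoint windows at most one of the functions \<open>h j\<close> is nonzero
  at a given point, so 1 - laplace of their sum is the sum of the terms 1 - laplace, and the
  transform factorises just as it does for the product.\<close>

theorem indep_sets_count_algebra:
  assumes W: "disjoint_family_on W J"
  shows "indep_sets (\<lambda>n. sets (count_algebra M (W n))) J"
proof -
  have "indep_sets (\<lambda>n. count_events M (W n)) J"
  proof (rule indep_setsI)
    show "count_events M (W i) \<subseteq> events" for i using count_events_sets by simp
    fix E :: "'b \<Rightarrow> 'a measure set" and K
    assume K: "K \<noteq> {}" "K \<subseteq> J" "finite K" "\<forall>j\<in>K. E j \<in> count_events M (W j)"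
    have "\<forall>j\<in>K. \<exists>F :: ('a set \<times> nat) set. E j = {\<omega> \<in> configurations M. \<forall>(A, k)\<in>F. emeasure \<omega> A = of_nat k} \<and> finite F \<and>
       (\<forall>(A, k)\<in>F. A \<in> sets M \<and> A \<subseteq> W j \<and> emeasure M A < \<infinity>)"
      using K(4) unfolding count_events_def by blast
    then obtain F :: "'b \<Rightarrow> ('a set \<times> nat) set" where F0:
      "\<forall>j\<in>K. E j = {\<omega> \<in> configurations M. \<forall>(A, k)\<in>F j. emeasure \<omega> A = of_nat k} \<and> finite (F j) \<and>
       (\<forall>(A, k)\<in>F j. A \<in> sets M \<and> A \<subseteq> W j \<and> emeasure M A < \<infinity>)"
      by (rule bchoice[THEN exE])
    then have F: "\<And>j. j \<in> K \<Longrightarrow> E j = {\<omega> \<in> configurations M. \<forall>(A, k)\<in>F j. emeasure \<omega> A = of_nat k}"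
       "\<And>j. j \<in> K \<Longrightarrow> finite (F j)" "\<And>j A k. j \<in> K \<Longrightarrow> (A, k) \<in> F j \<Longrightarrow> A \<in> sets M \<and> A \<subseteq> W j"
      by (auto, fastforce)
    have FW: "fst q \<in> sets M" "fst q \<subseteq> W j" if "j \<in> K" "q \<in> F j" for j q
      using F(3)[of j "fst q" "snd q"] that by auto
    define Q where "Q = PiM (UNIV :: 'b set) (\<lambda>_. P)"
    have Q: "prob_space Q" unfolding Q_def by (intro prob_space_PiM prob_space_axioms)
    define I where "I = Sigma K F"
    have I: "finite I" unfolding I_def using K(3) F(2) by auto
    have Em: "E j \<in> sets P" if "j \<in> K" for j using K(4) that count_events_sets by auto
    have comp: "(\<lambda>w. w j) \<in> measurable Q P" for j unfolding Q_def by (rule measurable_component_singleton) simp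
    have "emeasure P {\<omega> \<in> space P. \<forall>i\<in>I. (\<lambda>(j, A, k) \<omega>. emeasure \<omega> A) i \<omega> = of_nat ((\<lambda>(j, A, k). k) i)} =
       emeasure Q {w \<in> space Q. \<forall>i\<in>I. (\<lambda>(j, A, k) w. emeasure (w j) A) i w = of_nat ((\<lambda>(j, A, k). k) i)}"
    proof (rule joint_law_unique)
      fix \<theta> :: "'b \<times> 'a set \<times> nat \<Rightarrow> real"
      define h where "h j x = (\<Sum>q\<in>F j. ennreal (\<theta> (j, q)) * indicator (fst q) x)" for j x
      have h [measurable]: "h j \<in> borel_measurable M" if "j \<in> K" for j
        unfolding h_def using FW(1)[OF that] by (intro borel_measurable_sum borel_measurable_times) auto
      have IM: "fst (snd i) \<in> sets M" if "i \<in> I" for i using FW(1) that by (auto simp: I_def)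
      have h0: "h j x = 0" if "j \<in> K" "x \<notin> W j" for j x
        unfolding h_def using FW(2)[OF that(1)] that(2) by (intro sum.neutral) (auto simp: indicator_def)
      have "(\<integral>\<^sup>+\<omega>. (\<Prod>i\<in>I. laplace (ennreal (\<theta> i) * (\<lambda>(j, A, k) \<omega>. emeasure \<omega> A) i \<omega>)) \<partial>P) =
         laplace (\<integral>\<^sup>+x. 1 - laplace (\<Sum>i\<in>I. ennreal (\<theta> i) * indicator (fst (snd i)) x) \<partial>M)"
        using laplace_counts[of I "\<lambda>i. fst (snd i)" "\<lambda>i. ennreal (\<theta> i)", OF I IM]
        by (simp add: case_prod_beta)
      also have "(\<integral>\<^sup>+x. 1 - laplace (\<Sum>i\<in>I. ennreal (\<theta> i) * indicator (fst (snd i)) x) \<partial>M) = (\<integral>\<^sup>+x. (\<Sum>j\<in>K. 1 - laplace (h j x)) \<partial>M)"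
      proof (intro nn_integral_cong)
        fix x
        have "(\<Sum>i\<in>I. ennreal (\<theta> i) * indicator (fst (snd i)) x) = (\<Sum>j\<in>K. h j x)"
          unfolding I_def h_def using F(2)
          by (subst sum.Sigma[OF K(3), of F "\<lambda>j q. ennreal (\<theta> (j, q)) * indicator (fst q) x"]) (auto simp: case_prod_beta)
        moreover have "1 - laplace (\<Sum>j\<in>K. h j x) = (\<Sum>j\<in>K. 1 - laplace (h j x))"
        proof (cases "\<exists>j\<in>K. x \<in> W j")
          case True
          then obtain j where j: "j \<in> K" "x \<in> W j" by blast
          have "h i x = 0" if "i \<in> K" "i \<noteq> j" for i
            using W K(2) j that h0[of i x] unfolding disjoint_family_on_def by blast
          then have "(\<Sum>j\<in>K. h j x) = (\<Sum>j\<in>{j}. h j x)" "(\<Sum>j\<in>K. 1 - laplace (h j x)) = (\<Sum>j\<in>{j}. 1 - laplace (h j x))"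
            by (simp_all add: sum.remove[OF K(3) j(1)])
          then show ?thesis by simp
        next
          case False
          then show ?thesis using h0[of _ x] by simp
        qed
        ultimately show "1 - laplace (\<Sum>i\<in>I. ennreal (\<theta> i) * indicator (fst (snd i)) x) = (\<Sum>j\<in>K. 1 - laplace (h j x))" by simp
      qed
      also have "\<dots> = (\<Sum>j\<in>K. \<integral>\<^sup>+x. 1 - laplace (h j x) \<partial>M)" by (rule nn_integral_sum) measurable
      also have "laplace \<dots> = (\<Prod>j\<in>K. laplace (\<integral>\<^sup>+x. 1 - laplace (h j x) \<partial>M))" by (rule laplace_sum)
      also have "\<dots> = (\<Prod>j\<in>K. \<integral>\<^sup>+\<omega>. (\<Prod>q\<in>F j. laplace (ennreal (\<theta> (j, q)) * emeasure \<omega> (fst q))) \<partial>P)"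
        using F(2) FW(1) by (intro prod.cong refl) (simp add: h_def laplace_counts)
      also have "\<dots> = (\<integral>\<^sup>+w. (\<Prod>j\<in>K. \<Prod>q\<in>F j. laplace (ennreal (\<theta> (j, q)) * emeasure (w j) (fst q))) \<partial>Q)"
        unfolding Q_def by (intro nn_integral_PiM_prod[symmetric] prob_space_axioms K(3)) measurable
      also have "\<dots> = (\<integral>\<^sup>+w. (\<Prod>i\<in>I. laplace (ennreal (\<theta> i) * (\<lambda>(j, A, k) w. emeasure (w j) A) i w)) \<partial>Q)"
        unfolding I_def using F(2)
        by (subst prod.Sigma[OF K(3)]) (auto simp: case_prod_beta)
      finally show "(\<integral>\<^sup>+\<omega>. (\<Prod>i\<in>I. laplace (ennreal (\<theta> i) * (\<lambda>(j, A, k) \<omega>. emeasure \<omega> A) i \<omega>)) \<partial>P) =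
         (\<integral>\<^sup>+w. (\<Prod>i\<in>I. laplace (ennreal (\<theta> i) * (\<lambda>(j, A, k) w. emeasure (w j) A) i w)) \<partial>Q)" .
    next
      fix i w assume "w \<in> space Q"
      then have "w j \<in> configurations M" for j using measurable_space[OF comp] by simp
      then show "(case i of (j, A, k) \<Rightarrow> \<lambda>w. emeasure (w j) A) w = \<infinity> \<or> (\<exists>k::nat. (case i of (j, A, k) \<Rightarrow> \<lambda>w. emeasure (w j) A) w = of_nat k)"
        using configuration_vals by (auto split: prod.split)
    next
      show "(case i of (j, A, k) \<Rightarrow> \<lambda>w. emeasure (w j) A) \<in> borel_measurable Q" for i
        using measurable_compose[OF comp measurable_emeasure_P] by (auto split: prod.split)
    qed (auto simp: configuration_top prob_space_axioms Q I split: prod.split)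
    also have "{w \<in> space Q. \<forall>i\<in>I. (\<lambda>(j, A, k) w. emeasure (w j) A) i w = of_nat ((\<lambda>(j, A, k). k) i)} = {w \<in> space Q. \<forall>j\<in>K. w j \<in> E j}"
      using measurable_space[OF comp] by (auto simp: I_def F(1))
    also have "emeasure Q \<dots> = (\<integral>\<^sup>+w. (\<Prod>j\<in>K. indicator (E j) (w j)) \<partial>Q)"
    proof -
      have "(\<integral>\<^sup>+w. (\<Prod>j\<in>K. indicator (E j) (w j)) \<partial>Q) = (\<integral>\<^sup>+w. indicator {w \<in> space Q. \<forall>j\<in>K. w j \<in> E j} w \<partial>Q)"
        using K(3) by (intro nn_integral_cong) (auto simp: indicator_def prod_zero_iff)
      also have "\<dots> = emeasure Q {w \<in> space Q. \<forall>j\<in>K. w j \<in> E j}"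
        using K(3) measurable_sets[OF comp Em]
        by (intro nn_integral_indicator sets.sets_Collect_finite_All) (auto simp: vimage_def Int_def conj_commute)
      finally show ?thesis by simp
    qed
    also have "\<dots> = (\<integral>\<^sup>+w. (\<Prod>j\<in>K. (if j \<in> K then indicator (E j) else (\<lambda>_. 1)) (w j)) \<partial>Q)" by simp
    also have "\<dots> = (\<Prod>j\<in>K. \<integral>\<^sup>+\<omega>. (if j \<in> K then indicator (E j) else (\<lambda>_. 1)) \<omega> \<partial>P)"
      unfolding Q_def by (intro nn_integral_PiM_prod prob_space_axioms K(3)) (use Em in auto)
    also have "\<dots> = (\<Prod>j\<in>K. emeasure P (E j))" using Em by (intro prod.cong) auto
    also have "{\<omega> \<in> space P. \<forall>i\<in>I. (\<lambda>(j, A, k) \<omega>. emeasure \<omega> A) i \<omega> = of_nat ((\<lambda>(j, A, k). k) i)} = (\<Inter>j\<in>K. E j)"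
      using K(1) by (auto simp: I_def F(1))
    finally have "emeasure P (\<Inter>j\<in>K. E j) = (\<Prod>j\<in>K. emeasure P (E j))" .
    then show "prob (\<Inter>j\<in>K. E j) = (\<Prod>j\<in>K. prob (E j))"
      by (simp add: emeasure_eq_measure prod_ennreal prod_nonneg)
  qed
  then show ?thesis
    using indep_sets_sigma[of "\<lambda>n. count_events M (W n)" J, OF _ Int_stable_count_events]
    by (simp add: sets_count_algebra)
qed

lemma is_poisson_measure: "is_poisson_measure M P"
  unfolding is_poisson_measure_def
proof (intro conjI allI ballI impI)
  fix I :: "nat set" and A assume *: "finite I \<and> disjoint_family_on A I \<and>
    (\<forall>i\<in>I. A i \<in> sets M \<and> 0 < emeasure M (A i) \<and> emeasure M (A i) < \<infinity>)"
  have "{(\<lambda>\<omega>. emeasure \<omega> (A i)) -` B \<inter> space P |B. B \<in> sets borel} \<subseteq> sets (count_algebra M (A i))" if "i \<in> I" for i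
    using measurable_sets[OF measurable_count_algebra[of "A i" M "A i"]] * that by auto
  then show "indep_vars (\<lambda>_. borel) (\<lambda>i \<omega>. emeasure \<omega> (A i)) I"
    unfolding indep_vars_def2 using indep_sets_count_algebra[of A I] *
    by (auto intro: indep_sets_mono_sets)
qed (use prob_count in \<open>auto simp: prob_space_axioms\<close>)

end

section \<open>Enumerating the points of a configuration\<close>

text \<open>The \<open>j\<close>-th point in increasing order, as a quantile: the least level up to
  which \<open>W\<close> contains more than \<open>j\<close> points, approached through rationals.
  It is built from counts alone, hence measurable; beyond the last point the infimum is \<infinity>
  and the value defaults to 0.\<close>

definition config_point :: "real set \<Rightarrow> real measure \<Rightarrow> nat \<Rightarrow> real" where
  "config_point W \<omega> j = real_of_ereal
     (INF i. if of_nat j < emeasure \<omega> (W \<inter> {..rat_enum i}) then ereal (rat_enum i) else \<infinity>)"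

text \<open>Entry 0 is the number of points, so the \<open>j\<close>-th point sits in entry
  \<open>Suc j\<close>. All entries are real so that \<open>seq_enc\<close> can pack the code into a
  single number.\<close>

definition config_code :: "real set \<Rightarrow> real measure \<Rightarrow> nat \<Rightarrow> real" where
  "config_code W \<omega> = case_nat (enn2real (emeasure \<omega> W)) (config_point W \<omega>)"

lemma measurable_config_code:
  assumes "\<And>q. (\<lambda>x. emeasure (f x) (W \<inter> {..q})) \<in> borel_measurable N"
    and [measurable]: "(\<lambda>x. emeasure (f x) W) \<in> borel_measurable N"
  shows "(\<lambda>x. config_code W (f x) j) \<in> borel_measurable N"
proof (cases j)
  case 0
  then show ?thesis by (simp add: config_code_def)
next
  case (Suc j)
  note [measurable] = assms(1)
  show ?thesis unfolding Suc config_code_def config_point_def nat.case by measurable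
qed

lemma INF_rat_enum: "(INF i. if x \<le> rat_enum i then ereal (rat_enum i) else \<infinity>) = ereal x"
proof (rule antisym)
  show "ereal x \<le> (INF i. if x \<le> rat_enum i then ereal (rat_enum i) else \<infinity>)"
    by (intro INF_greatest) auto
  show "(INF i. if x \<le> rat_enum i then ereal (rat_enum i) else \<infinity>) \<le> ereal x"
  proof (rule dense_ge)
    fix y assume "ereal x < y"
    then obtain r :: real where r: "ereal r < y" "x < r"
      using ereal_dense2[of "ereal x" y] by auto
    then obtain j where j: "x < rat_enum j" "rat_enum j < r" using rat_enum_dense by blast
    have "(INF i. if x \<le> rat_enum i then ereal (rat_enum i) else \<infinity>) \<le> (if x \<le> rat_enum j then ereal (rat_enum j) else \<infinity>)"
      by (rule INF_lower) simp
    also have "\<dots> \<le> y" using j r by (auto intro!: less_imp_le intro: less_trans[of _ "ereal r"])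
    finally show "(INF i. if x \<le> rat_enum i then ereal (rat_enum i) else \<infinity>) \<le> y" .
  qed
qed

lemma sorted_card_le_iff:
  fixes xs :: "real list"
  assumes "sorted xs" "j < length xs"
  shows "j < card {l. l < length xs \<and> xs ! l \<le> r} \<longleftrightarrow> xs ! j \<le> r"
proof
  assume *: "xs ! j \<le> r"
  have "{..j} \<subseteq> {l. l < length xs \<and> xs ! l \<le> r}"
    using assms * sorted_nth_mono[OF assms(1), of _ j] by fastforce
  then have "card {..j} \<le> card {l. l < length xs \<and> xs ! l \<le> r}" by (intro card_mono) auto
  then show "j < card {l. l < length xs \<and> xs ! l \<le> r}" by simp
next
  assume *: "j < card {l. l < length xs \<and> xs ! l \<le> r}"
  show "xs ! j \<le> r"
  proof (rule ccontr)
    assume "\<not> xs ! j \<le> r"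
    then have "{l. l < length xs \<and> xs ! l \<le> r} \<subseteq> {..<j}"
      using sorted_nth_mono[OF assms(1), of j] by (auto simp: not_less[symmetric]) fastforce
    then have "card {l. l < length xs \<and> xs ! l \<le> r} \<le> card {..<j}" by (intro card_mono) auto
    with * show False by simp
  qed
qed

text \<open>A list keeps multiplicities, and sorting it matches the rank that
  \<open>config_point\<close> uses.\<close>

lemma sorted_enumeration:
  fixes M :: "real measure"
  assumes \<omega>: "\<omega> \<in> configurations M" and M: "sets M = sets borel" and W: "W \<in> sets borel" "emeasure \<omega> W < \<infinity>"
  obtains xs where "sorted xs" "\<And>B. B \<in> sets borel \<Longrightarrow> emeasure \<omega> (W \<inter> B) = of_nat (card {j. j < length xs \<and> xs ! j \<in> B})"
proof -
  obtain I :: "nat set" and p where I: "\<omega> = distr (count_space I) M p" "p \<in> I \<rightarrow> space M"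
    using \<omega> by (rule configuration_cases)
  define F where "F = {i \<in> I. p i \<in> W}"
  have e: "emeasure \<omega> (W \<inter> B) = emeasure (count_space I) {i \<in> F. p i \<in> B}" if "B \<in> sets borel" for B
    unfolding I(1) by (subst emeasure_configuration[OF I(2)]) (use that W M in \<open>auto simp: F_def intro!: arg_cong[where f = "emeasure (count_space I)"]\<close>)
  have "finite F"
    using e[of UNIV] W(2) by (cases "finite F") (auto simp: emeasure_count_space_infinite F_def)
  define ys where "ys = map p (sorted_list_of_set F)"
  define xs where "xs = sort ys"
  have "emeasure \<omega> (W \<inter> B) = of_nat (card {j. j < length xs \<and> xs ! j \<in> B})" if B: "B \<in> sets borel" for B
  proof -
    have "card {j. j < length xs \<and> xs ! j \<in> B} = length (filter (\<lambda>x. x \<in> B) xs)"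
      by (simp add: length_filter_conv_card)
    also have "\<dots> = length (filter (\<lambda>x. x \<in> B) ys)"
      unfolding xs_def filter_sort by simp
    also have "\<dots> = length (filter (\<lambda>i. p i \<in> B) (sorted_list_of_set F))"
      unfolding ys_def by (simp add: filter_map comp_def)
    also have "\<dots> = card (set (filter (\<lambda>i. p i \<in> B) (sorted_list_of_set F)))"
      by (subst distinct_card) auto
    also have "set (filter (\<lambda>i. p i \<in> B) (sorted_list_of_set F)) = {i \<in> F. p i \<in> B}"
      using \<open>finite F\<close> by auto
    finally have c: "card {j. j < length xs \<and> xs ! j \<in> B} = card {i \<in> F. p i \<in> B}" .
    show ?thesis
      unfolding e[OF B] c
      by (rule emeasure_count_space_finite) (simp_all add: \<open>finite F\<close>, simp add: F_def)
  qed
  then show ?thesis using that[of xs] by (simp add: xs_def)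
qed

lemma config_code_spec:
  fixes M :: "real measure"
  assumes \<omega>: "\<omega> \<in> configurations M" and M: "sets M = sets borel" and W: "W \<in> sets borel" "emeasure \<omega> W < \<infinity>" and B: "B \<in> sets borel"
  shows "emeasure \<omega> (W \<inter> B) = of_nat (card {j. real j < config_code W \<omega> 0 \<and> config_code W \<omega> (Suc j) \<in> B})"
    "finite {j. real j < config_code W \<omega> 0}"
proof -
  obtain xs where xs: "sorted xs" "\<And>B. B \<in> sets borel \<Longrightarrow> emeasure \<omega> (W \<inter> B) = of_nat (card {j. j < length xs \<and> xs ! j \<in> B})"
    using sorted_enumeration[OF \<omega> M W] by blast
  have 0: "config_code W \<omega> 0 = real (length xs)"
    using xs(2)[of UNIV] by (simp add: config_code_def)
  have "config_code W \<omega> (Suc j) = xs ! j" if j: "j < length xs" for j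
  proof -
    have "of_nat j < emeasure \<omega> (W \<inter> {..r}) \<longleftrightarrow> xs ! j \<le> r" for r
      using sorted_card_le_iff[OF xs(1) j, of r] by (subst xs(2)) (auto simp del: of_nat_less_iff simp: of_nat_less_iff[where 'a = ennreal])
    then show ?thesis by (simp only: config_code_def config_point_def nat.case INF_rat_enum real_of_ereal.simps)
  qed
  then have "{j. real j < config_code W \<omega> 0 \<and> config_code W \<omega> (Suc j) \<in> B} = {j. j < length xs \<and> xs ! j \<in> B}"
    using 0 by auto
  then show "emeasure \<omega> (W \<inter> B) = of_nat (card {j. real j < config_code W \<omega> 0 \<and> config_code W \<omega> (Suc j) \<in> B})"
    using xs(2)[OF B] by simp
  show "finite {j. real j < config_code W \<omega> 0}" by (simp add: 0)
qed

text \<open>Inverts the coding of a configuration cut into windows: the points decoded from the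
  \<open>n\<close>-th code are moved to their place by \<open>R n\<close>. Standardness uses many
  windows and no motion, the Bernoulli isomorphism one window and its translates.\<close>

definition glue :: "'a measure \<Rightarrow> ('i::countable \<Rightarrow> real \<Rightarrow> 'a) \<Rightarrow> ('i \<Rightarrow> nat \<Rightarrow> real) \<Rightarrow> 'a measure" where
  "glue M R z = point_sum M {(n, j). real j < z n 0} (\<lambda>(n, j). R n (z n (Suc j)))"

lemma measurable_glue:
  fixes R :: "'i::countable \<Rightarrow> real \<Rightarrow> 'a"
  assumes [measurable]: "\<And>n j. (\<lambda>x. z x n j) \<in> borel_measurable N" "\<And>n. R n \<in> measurable borel M"
  shows "(\<lambda>x. glue M R (z x)) \<in> measurable N (configuration_algebra M)"
  unfolding glue_def by (rule measurable_point_sum) (auto simp: case_prod_beta)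

lemma glue_config_code:
  fixes M :: "real measure" and R :: "'i::countable \<Rightarrow> real \<Rightarrow> real"
  assumes M: "sets M = sets borel" and R: "\<And>n. R n \<in> borel_measurable borel"
    and W: "\<And>n. W n \<in> sets borel"
    and \<omega>: "\<omega> \<in> configurations M" "\<And>n. \<nu> n \<in> configurations M" "\<And>n. emeasure (\<nu> n) (W n) < \<infinity>"
    and split: "\<And>B. B \<in> sets borel \<Longrightarrow> emeasure \<omega> B = (\<integral>\<^sup>+n. emeasure (\<nu> n) (W n \<inter> R n -` B) \<partial>count_space UNIV)"
  shows "glue M R (\<lambda>n. config_code (W n) (\<nu> n)) = \<omega>"
proof (rule configuration_eqI)
  have sp: "space M = UNIV" using sets_eq_imp_space_eq[OF M] by simp
  have Pi: "(\<lambda>(n, j). R n (config_code (W n) (\<nu> n) (Suc j))) \<in> {(n, j). real j < config_code (W n) (\<nu> n) 0} \<rightarrow> space M"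
    by (auto simp: sp)
  show "glue M R (\<lambda>n. config_code (W n) (\<nu> n)) \<in> configurations M"
    unfolding glue_def by (rule point_sum_configuration[OF Pi])
  show "\<omega> \<in> configurations M" by fact
  fix B assume "B \<in> sets M"
  then have B: "B \<in> sets borel" using M by simp
  have "emeasure (glue M R (\<lambda>n. config_code (W n) (\<nu> n))) B =
      emeasure (count_space UNIV) {k \<in> {(n, j). real j < config_code (W n) (\<nu> n) 0}. (\<lambda>(n, j). R n (config_code (W n) (\<nu> n) (Suc j))) k \<in> B}"
    unfolding glue_def by (rule emeasure_point_sum[OF Pi]) fact
  also have "\<dots> = (\<integral>\<^sup>+k. indicator {k \<in> {(n, j). real j < config_code (W n) (\<nu> n) 0}. (\<lambda>(n, j). R n (config_code (W n) (\<nu> n) (Suc j))) k \<in> B} k \<partial>count_space UNIV)"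
    by simp
  also have "\<dots> = (\<integral>\<^sup>+n. \<integral>\<^sup>+j. indicator {k \<in> {(n, j). real j < config_code (W n) (\<nu> n) 0}. (\<lambda>(n, j). R n (config_code (W n) (\<nu> n) (Suc j))) k \<in> B} (n, j) \<partial>count_space UNIV \<partial>count_space UNIV)"
    by (rule nn_integral_fst_count_space[symmetric])
  also have "\<dots> = (\<integral>\<^sup>+n. emeasure (\<nu> n) (W n \<inter> R n -` B) \<partial>count_space UNIV)"
  proof (intro nn_integral_cong)
    fix n
    have RB: "R n -` B \<in> sets borel" using measurable_sets[OF R B] by simp
    have "(\<integral>\<^sup>+j. indicator {k \<in> {(n, j). real j < config_code (W n) (\<nu> n) 0}. (\<lambda>(n, j). R n (config_code (W n) (\<nu> n) (Suc j))) k \<in> B} (n, j) \<partial>count_space UNIV)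
      = (\<integral>\<^sup>+j. indicator {j. real j < config_code (W n) (\<nu> n) 0 \<and> config_code (W n) (\<nu> n) (Suc j) \<in> R n -` B} j \<partial>count_space UNIV)"
      by (intro nn_integral_cong) (auto simp: indicator_def)
    also have "\<dots> = emeasure (count_space UNIV) {j. real j < config_code (W n) (\<nu> n) 0 \<and> config_code (W n) (\<nu> n) (Suc j) \<in> R n -` B}"
      by simp
    also have "\<dots> = of_nat (card {j. real j < config_code (W n) (\<nu> n) 0 \<and> config_code (W n) (\<nu> n) (Suc j) \<in> R n -` B})"
      by (intro emeasure_count_space_finite finite_subset[OF _ config_code_spec(2)[OF \<omega>(2) M W \<omega>(3) RB]]) auto
    also have "\<dots> = emeasure (\<nu> n) (W n \<inter> R n -` B)"
      by (rule config_code_spec(1)[OF \<omega>(2) M W \<omega>(3) RB, symmetric])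
    finally show "(\<integral>\<^sup>+j. indicator {k \<in> {(n, j). real j < config_code (W n) (\<nu> n) 0}. (\<lambda>(n, j). R n (config_code (W n) (\<nu> n) (Suc j))) k \<in> B} (n, j) \<partial>count_space UNIV)
      = emeasure (\<nu> n) (W n \<inter> R n -` B)" .
  qed
  also have "\<dots> = emeasure \<omega> B" by (rule split[OF B, symmetric])
  finally show "emeasure (glue M R (\<lambda>n. config_code (W n) (\<nu> n))) B = emeasure \<omega> B" .
qed

section \<open>Standardness\<close>

text \<open>The topology of the closed set \<open>C\<close> is pulled back along
  \<open>\<phi>\<close>. Within \<open>S\<close> a measurable set \<open>A\<close> is the
  \<open>\<phi>\<close>-preimage of the \<open>\<psi>\<close>-preimage of \<open>A\<close>, so the
  pulled back Borel sets are all measurable sets.\<close>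

lemma standard_borel_closed_image:
  fixes \<phi> :: "'a \<Rightarrow> 'b::{complete_space, second_countable_topology}"
  assumes \<phi>: "\<phi> \<in> measurable P borel" and \<psi>: "\<psi> \<in> measurable borel P"
    and S: "S \<in> sets P" and C: "closed C" "\<phi> ` S = C" and inv: "\<And>x. x \<in> S \<Longrightarrow> \<psi> (\<phi> x) = x"
  shows "standard_borel (restrict_space P S)"
proof -
  define \<tau> where "\<tau> = pullback_topology S \<phi> euclidean"
  have op: "openin \<tau> U \<longleftrightarrow> (\<exists>V. open V \<and> U = \<phi> -` V \<inter> S)" for U
    unfolding \<tau>_def openin_pullback_topology by simp
  have ts: "topspace \<tau> = S" by (simp add: \<tau>_def topspace_pullback_topology)
  have inj: "inj_on \<phi> S" using inv by (auto intro: inj_on_inverseI)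
  have "homeomorphic_map \<tau> (top_of_set C) \<phi>"
  proof (rule bijective_open_imp_homeomorphic_map)
    show "continuous_map \<tau> (top_of_set C) \<phi>"
      unfolding continuous_map_in_subtopology \<tau>_def
      using continuous_map_pullback[of euclidean euclidean id S \<phi>] C(2)
      by (auto simp: topspace_pullback_topology)
    show "open_map \<tau> (top_of_set C) \<phi>"
      unfolding open_map_def op openin_open using C(2) by auto
    show "\<phi> ` topspace \<tau> = topspace (top_of_set C)" using C by (simp add: ts)
    show "inj_on \<phi> (topspace \<tau>)" by (simp add: ts inj)
  qed
  then have h: "\<tau> homeomorphic_space (top_of_set C)" using homeomorphic_map_imp_homeomorphic_space by blast
  have "completely_metrizable_space \<tau>"
    unfolding homeomorphic_completely_metrizable_space[OF h]
    using C(1) by (intro completely_metrizable_space_closedin completely_metrizable_space_euclidean) simp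
  moreover have "second_countable \<tau>"
  proof -
    obtain B :: "'b set set" where B: "countable B" "topological_basis B" using ex_countable_basis by blast
    show ?thesis
      unfolding second_countable_def
    proof (intro exI[of _ "(\<lambda>V. \<phi> -` V \<inter> S) ` B"] conjI ballI allI impI)
      fix U x assume "openin \<tau> U \<and> x \<in> U"
      then obtain V where V: "open V" "U = \<phi> -` V \<inter> S" "x \<in> U" using op by auto
      then obtain V' where "V' \<in> B" "\<phi> x \<in> V'" "V' \<subseteq> V" using topological_basisE[OF B(2), of V "\<phi> x"] by auto
      then show "\<exists>Ua\<in>(\<lambda>V. \<phi> -` V \<inter> S) ` B. x \<in> Ua \<and> Ua \<subseteq> U" using V by auto
    next
      fix V assume "V \<in> (\<lambda>V. \<phi> -` V \<inter> S) ` B"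
      then show "openin \<tau> V" using op topological_basis_open[OF B(2)] by blast
    qed (use B in auto)
  qed
  moreover have "sets (restrict_space P S) = sigma_sets (space (restrict_space P S)) {U. openin \<tau> U}"
  proof -
    have sp: "space (restrict_space P S) = S" using S by (simp add: space_restrict_space2)
    have Pow: "{U. openin \<tau> U} \<subseteq> Pow S" using openin_subset ts by blast
    have "\<phi> \<in> borel_measurable (sigma S {U. openin \<tau> U})"
      by (rule borel_measurableI) (use Pow in \<open>auto simp: op\<close>)
    note m = measurable_sets[OF this]
    have "A \<inter> S \<in> sigma_sets S {U. openin \<tau> U}" if "A \<in> sets P" for A
    proof -
      have "\<phi> -` (\<psi> -` A \<inter> space borel) \<inter> S \<in> sigma_sets S {U. openin \<tau> U}"
        using m[OF measurable_sets[OF \<psi> that]] Pow by simp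
      moreover have "\<phi> -` (\<psi> -` A \<inter> space borel) \<inter> S = A \<inter> S" using inv by auto
      ultimately show ?thesis by simp
    qed
    moreover have "sigma_sets S {U. openin \<tau> U} \<subseteq> sets (restrict_space P S)"
    proof -
      have "{U. openin \<tau> U} \<subseteq> sets (restrict_space P S)"
      proof
        fix U assume "U \<in> {U. openin \<tau> U}"
        then obtain V where V: "open V" "U = \<phi> -` V \<inter> S" using op by auto
        have "\<phi> -` V \<inter> space P \<in> sets P" using measurable_sets[OF \<phi>] V(1) by simp
        moreover have "U = S \<inter> (\<phi> -` V \<inter> space P)" using V(2) sets.sets_into_space[OF S] by auto
        ultimately show "U \<in> sets (restrict_space P S)" unfolding sets_restrict_space by blast
      qed
      from sets.sigma_sets_subset[OF this] show ?thesis by (simp add: sp)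
    qed
    ultimately show ?thesis unfolding sp by (auto simp: sets_restrict_space Int_commute)
  qed
  moreover have "topspace \<tau> = space (restrict_space P S)"
    using S by (simp add: ts space_restrict_space2)
  ultimately show ?thesis unfolding standard_borel_def by blast
qed

text \<open>Inner regularity lets each step remove a closed set with at least half of the remaining
  mass; the removed sets are disjoint and the rest shrinks geometrically to mass 0.\<close>

lemma closed_exhaustion:
  fixes \<nu> :: "'b::polish_space measure"
  assumes \<nu>: "sets \<nu> = sets borel" "finite_measure \<nu>" and D: "D \<in> sets borel"
  obtains K :: "nat \<Rightarrow> 'b set" where "\<And>n. closed (K n)" "disjoint_family K" "\<And>n. K n \<subseteq> D" "emeasure \<nu> (D - (\<Union>n. K n)) = 0"
proof -
  interpret finite_measure \<nu> by fact
  have ex: "\<exists>K. closed K \<and> K \<subseteq> X \<and> measure \<nu> (X - K) \<le> measure \<nu> X / 2" if X: "X \<in> sets borel" for X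
  proof (cases "measure \<nu> X = 0")
    case True
    then show ?thesis by (intro exI[of _ "{}"]) auto
  next
    case False
    then have pos: "0 < measure \<nu> X" using measure_nonneg[of \<nu> X] by linarith
    have "emeasure \<nu> X = (SUP K \<in> {K. K \<subseteq> X \<and> compact K}. emeasure \<nu> K)"
      by (rule inner_regular[OF \<nu>(1) _ X]) simp
    moreover have "ennreal (measure \<nu> X / 2) < emeasure \<nu> X"
      using pos by (simp add: emeasure_eq_measure ennreal_less_iff)
    ultimately obtain K where K: "K \<subseteq> X" "compact K" "ennreal (measure \<nu> X / 2) < emeasure \<nu> K"
      by (auto simp: less_SUP_iff)
    then have Ks: "K \<in> sets \<nu>" using \<nu>(1) by (simp add: borel_compact)
    have "measure \<nu> (X - K) = measure \<nu> X - measure \<nu> K"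
      using X K Ks \<nu>(1) by (intro finite_measure_Diff) auto
    moreover have "measure \<nu> X / 2 < measure \<nu> K"
      using K(3) by (simp add: emeasure_eq_measure ennreal_less_iff)
    ultimately show ?thesis using K by (intro exI[of _ K]) (auto simp: compact_imp_closed)
  qed
  define k where "k X = (SOME K. closed K \<and> K \<subseteq> X \<and> measure \<nu> (X - K) \<le> measure \<nu> X / 2)" for X
  have k: "closed (k X)" "k X \<subseteq> X" "measure \<nu> (X - k X) \<le> measure \<nu> X / 2" if "X \<in> sets borel" for X
    using someI_ex[OF ex[OF that]] unfolding k_def by auto
  define X where "X n = ((\<lambda>X. X - k X) ^^ n) D" for n
  have XS: "X (Suc n) = X n - k (X n)" for n by (simp add: X_def)
  have X: "X n \<in> sets borel" for n
  proof (induction n)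
    case (Suc n)
    then show ?case unfolding XS by (intro sets.Diff borel_closed[OF k(1)])
  qed (simp add: X_def D)
  have anti: "X (n + m) \<subseteq> X n" for n m by (induction m) (auto simp: XS)
  have XD: "X n \<subseteq> D" for n using anti[of 0 n] by (simp add: X_def)
  have bound: "measure \<nu> (X n) \<le> measure \<nu> D * (1/2) ^ n" for n
  proof (induction n)
    case (Suc n)
    have "measure \<nu> (X (Suc n)) \<le> measure \<nu> (X n) / 2" unfolding XS by (rule k(3)[OF X])
    then show ?case using Suc by simp
  qed (simp add: X_def)
  show ?thesis
  proof (rule that[of "\<lambda>n. k (X n)"])
    show "closed (k (X n))" for n by (rule k(1)[OF X])
    show "k (X n) \<subseteq> D" for n using k(2)[OF X] XD by blast
    have *: "k (X m) \<inter> k (X n) = {}" if "m < n" for m n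
    proof -
      have "k (X n) \<subseteq> X n" by (rule k(2)[OF X])
      also have "X n \<subseteq> X (Suc m)" using anti[of "Suc m" "n - Suc m"] that by simp
      finally show ?thesis by (auto simp: XS)
    qed
    show "disjoint_family (\<lambda>n. k (X n))"
      unfolding disjoint_family_on_def using * by (metis Int_commute linorder_neqE_nat)
    define E where "E = D - (\<Union>n. k (X n))"
    have E: "E \<in> sets \<nu>" unfolding E_def \<nu>(1) using D k(1)[OF X] by (intro sets.Diff sets.countable_UN) auto
    have "E \<subseteq> X n" for n by (induction n) (auto simp: XS E_def X_def)
    then have "measure \<nu> E \<le> measure \<nu> D * (1/2) ^ n" for n
      using finite_measure_mono[of E "X n"] X \<nu>(1) bound[of n] by (simp add: order.trans)
    moreover have "(\<lambda>n. measure \<nu> D * (1/2) ^ n) \<longlonglongrightarrow> measure \<nu> D * 0"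
      by (intro tendsto_intros LIMSEQ_power_zero) simp
    ultimately have "measure \<nu> E \<le> 0"
      using LIMSEQ_le_const[of "\<lambda>n. measure \<nu> D * (1/2) ^ n" 0 "measure \<nu> E"] by auto
    then have "measure \<nu> E = 0" using measure_nonneg[of \<nu> E] by linarith
    then show "emeasure \<nu> (D - (\<Union>n. k (X n))) = 0" by (simp add: emeasure_eq_measure E_def)
  qed
qed

text \<open>Along a convergent sequence the integer tags are eventually constant, so the limit stays
  in one closed sheet. The tag is what keeps the countable union closed.\<close>

lemma closed_tagged_Union:
  fixes K :: "nat \<Rightarrow> 'b::polish_space set"
  assumes "\<And>n. closed (K n)"
  shows "closed {(x, z). \<exists>n. x = real n \<and> z \<in> K n}"
  unfolding closed_sequential_limits
proof (intro allI impI, elim conjE)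
  fix s :: "nat \<Rightarrow> real \<times> 'b" and l assume s: "\<forall>i. s i \<in> {(x, z). \<exists>n. x = real n \<and> z \<in> K n}" and l: "s \<longlonglongrightarrow> l"
  obtain n where n: "\<And>i. fst (s i) = real (n i)" "\<And>i. snd (s i) \<in> K (n i)" using s by (fastforce simp: choice_iff split_beta)
  have f: "(\<lambda>i. real (n i)) \<longlonglongrightarrow> fst l" using tendsto_fst[OF l] by (simp add: n)
  have "fst l \<in> \<nat>" by (rule closed_sequentially[OF closed_Nats _ f]) auto
  then obtain m where m: "fst l = real m" by (auto simp: Nats_def)
  have "eventually (\<lambda>i. dist (real (n i)) (fst l) < 1) sequentially" using f tendstoD[of _ _ _ 1] by auto
  then have ev: "eventually (\<lambda>i. n i = m) sequentially"
    by eventually_elim (auto simp: m dist_real_def)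
  have "snd l \<in> K m"
    by (rule Lim_in_closed_set[OF assms _ _ tendsto_snd[OF l]]) (use ev n(2) in \<open>auto elim: eventually_mono\<close>)
  then show "l \<in> {(x, z). \<exists>n. x = real n \<and> z \<in> K n}" using m by (cases l) auto
qed

text \<open>The set of codes is merely Borel. Up to a null set it is a disjoint union of closed
  sets, and recording the number of the sheet in an extra coordinate makes it closed, as
  \<open>standard_borel_closed_image\<close> requires.\<close>

lemma standard_measure_polish_code:
  fixes \<phi> :: "'a \<Rightarrow> 'b::polish_space"
  assumes P: "finite_measure P" and \<phi>: "\<phi> \<in> measurable P borel" and \<psi>: "\<psi> \<in> measurable borel P"
    and S: "S \<in> sets P" "AE x in P. x \<in> S" and inv: "\<And>x. x \<in> S \<Longrightarrow> \<psi> (\<phi> x) = x"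
  shows "standard_measure P"
proof -
  interpret finite_measure P by fact
  define \<nu> where "\<nu> = distr P borel \<phi>"
  have f\<nu>: "finite_measure \<nu>" unfolding \<nu>_def by (rule finite_measure_distr[OF \<phi>])
  have s\<nu>: "sets \<nu> = sets borel" by (simp add: \<nu>_def)
  \<comment> \<open>As \<open>\<psi>\<close> inverts \<open>\<phi>\<close> on \<open>S\<close>, this
    is the image of \<open>S\<close> under \<open>\<phi>\<close>, in a form that shows it to be
    Borel.\<close>
  define D where "D = {z. \<phi> (\<psi> z) = z \<and> \<psi> z \<in> S}"
  have [measurable]: "\<phi> \<in> borel_measurable P" "\<psi> \<in> measurable borel P" "S \<in> sets P" by fact+
  have "(\<lambda>z. \<phi> (\<psi> z)) \<in> borel_measurable borel" by (rule measurable_compose[OF \<psi> \<phi>])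
  then have d: "{z \<in> space borel. \<phi> (\<psi> z) = z} \<in> sets borel" by (rule measurable_equality_set) simp
  have "\<psi> -` S \<inter> space borel \<in> sets borel" by (rule measurable_sets[OF \<psi> S(1)])
  moreover have "D = {z \<in> space borel. \<phi> (\<psi> z) = z} \<inter> (\<psi> -` S \<inter> space borel)" by (auto simp: D_def)
  ultimately have D: "D \<in> sets borel" using d by (simp only: sets.Int)
  obtain K :: "nat \<Rightarrow> 'b set" where K: "\<And>n. closed (K n)" "disjoint_family K" "\<And>n. K n \<subseteq> D" "emeasure \<nu> (D - (\<Union>n. K n)) = 0"
    using closed_exhaustion[OF s\<nu> f\<nu> D] by blast
  have [measurable]: "K n \<in> sets borel" for n using K(1) by simp
  define S' where "S' = {x \<in> S. \<exists>n. \<phi> x \<in> K n}"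
  have "S' = S \<inter> (\<phi> -` (\<Union>n. K n) \<inter> space P)" using sets.sets_into_space[OF S(1)] by (auto simp: S'_def)
  also have "\<dots> \<in> sets P" using S(1) by (intro sets.Int measurable_sets[OF \<phi>] sets.countable_UN) auto
  finally have S': "S' \<in> sets P" .
  have "\<phi> -` (D - (\<Union>n. K n)) \<inter> space P \<in> null_sets P"
    using K(4) D by (auto simp: \<nu>_def emeasure_distr intro!: null_setsI)
  then have "AE x in P. x \<notin> \<phi> -` (D - (\<Union>n. K n)) \<inter> space P" by (rule AE_not_in)
  then have AE: "AE x in P. x \<in> S'"
    using S(2) AE_space
  proof eventually_elim
    case (elim x)
    then have "\<phi> x \<in> D" using inv by (simp add: D_def)
    with elim show ?case by (auto simp: S'_def)
  qed
  define idx where "idx z = real (LEAST n. z \<in> K n)" for z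
  have idx: "idx z = real n" if "z \<in> K n" for z n
  proof -
    have "(LEAST n. z \<in> K n) = n"
    proof (rule Least_equality)
      fix m assume "z \<in> K m"
      then show "n \<le> m" using K(2) that unfolding disjoint_family_on_def by (cases "m = n") auto
    qed fact
    then show ?thesis by (simp add: idx_def)
  qed
  have idxm: "idx \<in> borel_measurable borel"
  proof -
    have [measurable]: "Measurable.pred borel (\<lambda>z. z \<in> K n)" for n by measurable
    show ?thesis unfolding idx_def by measurable
  qed
  have "standard_borel (restrict_space P S')"
  proof (rule standard_borel_closed_image[where \<phi> = "\<lambda>x. (idx (\<phi> x), \<phi> x)" and \<psi> = "\<lambda>p. \<psi> (snd p)" and C = "{(x, z). \<exists>n. x = real n \<and> z \<in> K n}"])
    show "(\<lambda>x. (idx (\<phi> x), \<phi> x)) \<in> borel_measurable P"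
      by (intro borel_measurable_Pair measurable_compose[OF \<phi> idxm] \<phi>)
    have "snd \<in> borel_measurable (borel :: (real \<times> 'b) measure)" by (intro borel_measurable_continuous_onI continuous_on_snd continuous_on_id)
    then show "(\<lambda>p. \<psi> (snd p)) \<in> measurable (borel :: (real \<times> 'b) measure) P" by (rule measurable_compose[OF _ \<psi>])
    show "closed {(x, z). \<exists>n. x = real n \<and> z \<in> K n}" by (rule closed_tagged_Union[OF K(1)])
    show "(\<lambda>x. (idx (\<phi> x), \<phi> x)) ` S' = {(x, z). \<exists>n. x = real n \<and> z \<in> K n}"
    proof (intro set_eqI iffI)
      fix p assume "p \<in> {(x, z). \<exists>n. x = real n \<and> z \<in> K n}"
      then obtain n z where n: "p = (real n, z)" "z \<in> K n" by auto
      then have "z \<in> D" using K(3) by auto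
      then have "\<psi> z \<in> S'" "\<phi> (\<psi> z) = z" using n(2) by (auto simp: D_def S'_def)
      then show "p \<in> (\<lambda>x. (idx (\<phi> x), \<phi> x)) ` S'" using idx[OF n(2)] n(1) by (auto intro!: image_eqI[of _ _ "\<psi> z"])
    qed (auto simp: S'_def idx)
  qed (use S' inv in \<open>auto simp: S'_def\<close>)
  then show ?thesis
    unfolding standard_measure_def using S' AE sigma_finite_measure_axioms by blast
qed

lemma standard_measure_borel:
  fixes M :: "'b::polish_space measure"
  assumes "sets M = sets borel" "sigma_finite_measure M"
  shows "standard_measure M"
proof -
  have sp: "space M = UNIV" using sets_eq_imp_space_eq[OF assms(1)] by simp
  have "standard_borel (restrict_space M UNIV)"
    by (rule standard_borel_closed_image[where \<phi> = "\<lambda>x. x" and \<psi> = "\<lambda>x. x" and C = UNIV])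
      (auto simp: measurable_cong_sets[OF assms(1) refl] measurable_cong_sets[OF refl assms(1)] assms(1))
  then show ?thesis unfolding standard_measure_def using assms sp by (intro conjI bexI[of _ UNIV]) auto
qed



text \<open>A configuration with finite counts on all pieces is recovered from its codes on them.
  The codes are indexed by pairs, so that together they are a point of the Polish space of maps from
  \<open>nat \<times> nat\<close> to the reals.\<close>

lemma standard_measure_poisson_law:
  fixes M :: "real measure"
  assumes P: "poisson_law M P" and M: "sets M = sets borel"
    and A: "\<And>n::nat. A n \<in> sets borel" "disjoint_family A" "(\<Union>n. A n) = UNIV" "\<And>n. emeasure M (A n) < \<infinity>"
  shows "standard_measure P"
proof -
  interpret poisson_law M P by fact
  let ?\<phi> = "\<lambda>\<omega> p. config_code (A (fst p)) \<omega> (snd p)" and ?\<psi> = "\<lambda>z. glue M (\<lambda>_ x. x) (\<lambda>(n::nat) j. z (n, j))"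
  have meas: "(\<lambda>\<omega>. ?\<phi> \<omega> p) \<in> borel_measurable P" for p
    by (rule measurable_config_code) measurable
  show ?thesis
  proof (rule standard_measure_polish_code[where S = "{\<omega> \<in> space P. \<forall>n. emeasure \<omega> (A n) < \<infinity>}"])
    show "finite_measure P" by unfold_locales
    have "?\<phi> \<in> measurable P (PiM UNIV (\<lambda>_. borel))"
      using meas by (intro measurable_PiM_single') auto
    then show "?\<phi> \<in> borel_measurable P"
      by (simp only: measurable_cong_sets[OF refl sets_PiM_equal_borel])
    have "(\<lambda>z. z p) \<in> borel_measurable (borel :: (nat \<times> nat \<Rightarrow> real) measure)" for p
      using measurable_component_singleton[of p UNIV "\<lambda>_. borel :: real measure"]
      by (simp add: measurable_cong_sets[OF sets_PiM_equal_borel refl])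
    then have "?\<psi> \<in> measurable (borel :: (nat \<times> nat \<Rightarrow> real) measure) (configuration_algebra M)"
      by (intro measurable_glue) (auto simp: measurable_cong_sets[OF refl M])
    then show "?\<psi> \<in> measurable (borel :: (nat \<times> nat \<Rightarrow> real) measure) P"
      by (simp only: measurable_cong_sets[OF refl sets_P])
    show "{\<omega> \<in> space P. \<forall>n. emeasure \<omega> (A n) < \<infinity>} \<in> sets P" by measurable
    have "AE \<omega> in P. \<forall>n. emeasure \<omega> (A n) < \<infinity>"
      unfolding AE_all_countable by (intro allI AE_count_finite) (use A M in auto)
    then show "AE \<omega> in P. \<omega> \<in> {\<omega> \<in> space P. \<forall>n. emeasure \<omega> (A n) < \<infinity>}"
      using AE_space by eventually_elim auto
    fix \<omega> assume "\<omega> \<in> {\<omega> \<in> space P. \<forall>n. emeasure \<omega> (A n) < \<infinity>}"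
    then have \<omega>: "\<omega> \<in> configurations M" "\<And>n. emeasure \<omega> (A n) < \<infinity>" by auto
    have "glue M (\<lambda>_ x. x) (\<lambda>n. config_code (A n) \<omega>) = \<omega>"
    proof (rule glue_config_code[OF M])
      fix B :: "real set" assume B: "B \<in> sets borel"
      have "(\<integral>\<^sup>+n. emeasure \<omega> (A n \<inter> (\<lambda>x. x) -` B) \<partial>count_space UNIV) = (\<Sum>n. emeasure \<omega> (A n \<inter> B))"
        by (simp add: nn_integral_count_space_nat)
      also have "\<dots> = emeasure \<omega> (\<Union>n. A n \<inter> B)"
      proof (rule suminf_emeasure)
        show "range (\<lambda>n. A n \<inter> B) \<subseteq> sets \<omega>" using A(1) B \<omega> M by auto
        show "disjoint_family (\<lambda>n. A n \<inter> B)" using A(2) unfolding disjoint_family_on_def by blast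
      qed
      also have "(\<Union>n. A n \<inter> B) = B" using A(3) by auto
      finally show "emeasure \<omega> B = (\<integral>\<^sup>+n. emeasure \<omega> (A n \<inter> (\<lambda>x. x) -` B) \<partial>count_space UNIV)" by simp
    qed (use \<omega> A in auto)
    then show "?\<psi> (?\<phi> \<omega>) = \<omega>" by simp
  qed
qed

section \<open>Shannon entropy of finite-valued random variables\<close>

context prob_space
begin

lemma partition_entropy_eq:
  assumes "simple_function M X"
  shows "partition_entropy M X = - (\<Sum>x\<in>X ` space M. prob (X -` {x} \<inter> space M) * ln (prob (X -` {x} \<inter> space M)))"
proof -
  interpret information_space M "exp 1" by unfold_locales simp
  show ?thesis
    unfolding partition_entropy_def
    by (subst entropy_simple_distributed[OF simple_distributedI[OF assms measure_nonneg refl]])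
      (simp add: log_def)
qed

lemma partition_entropy_compose:
  assumes "simple_function M X"
  shows "partition_entropy M (\<lambda>\<omega>. f (X \<omega>)) \<le> partition_entropy M X"
proof -
  interpret information_space M "exp 1" by unfold_locales simp
  show ?thesis
    using entropy_data_processing[OF assms, of f] by (simp add: partition_entropy_def comp_def)
qed

lemma partition_entropy_Pair:
  assumes "simple_function M X" "simple_function M Y"
  shows "partition_entropy M (\<lambda>\<omega>. (X \<omega>, Y \<omega>)) \<le> partition_entropy M X + partition_entropy M Y"
proof -
  interpret information_space M "exp 1" by unfold_locales simp
  show ?thesis
    using entropy_chain_rule[OF assms] conditional_entropy_less_eq_entropy[OF assms(2,1)]
    by (simp add: partition_entropy_def)
qed

lemma mult_ln_nonpos: "0 \<le> q \<Longrightarrow> q \<le> 1 \<Longrightarrow> q * ln q \<le> 0" for q :: real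
  by (cases "q = 0") (auto intro: mult_nonneg_nonpos)

lemma partition_entropy_nonneg:
  assumes "simple_function M X"
  shows "0 \<le> partition_entropy M X"
  unfolding partition_entropy_eq[OF assms] by (auto intro!: sum_nonpos mult_ln_nonpos)

lemma simple_function_restrict:
  assumes "finite I" "\<And>i. i \<in> I \<Longrightarrow> simple_function M (X i)"
  shows "simple_function M (\<lambda>\<omega>. \<lambda>i\<in>I. X i \<omega>)"
  using assms
proof (induction I rule: finite_induct)
  case (insert j I)
  have "simple_function M (\<lambda>\<omega>. \<lambda>i\<in>I. X i \<omega>)" by (rule insert.IH) (rule insert.prems, rule insertI2)
  then have "simple_function M (\<lambda>\<omega>. (X j \<omega>, \<lambda>i\<in>I. X i \<omega>))"
    by (intro simple_function_Pair insert.prems insertI1)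
  from simple_function_compose1[OF this, of "\<lambda>(a, h). h(j := a)"]
  have s: "simple_function M (\<lambda>\<omega>. (\<lambda>i\<in>I. X i \<omega>)(j := X j \<omega>))" by simp
  have eq: "(\<lambda>\<omega>. \<lambda>i\<in>insert j I. X i \<omega>) = (\<lambda>\<omega>. (\<lambda>i\<in>I. X i \<omega>)(j := X j \<omega>))"
    by (intro ext) (simp add: restrict_def)
  show ?case unfolding eq by (rule s)
qed (simp add: restrict_def)

lemma partition_entropy_const: "partition_entropy M (\<lambda>_. c) = 0"
proof -
  have "(\<lambda>_. c) ` space M = {c}" "(\<lambda>_. c) -` {c} \<inter> space M = space M" using not_empty by auto
  then show ?thesis by (subst partition_entropy_eq[OF simple_function_const]) (simp only: sum.insert sum.empty, simp add: prob_space)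
qed

lemma partition_entropy_family:
  assumes "finite I" "\<And>i. i \<in> I \<Longrightarrow> simple_function M (X i)"
  shows "partition_entropy M (\<lambda>\<omega>. \<lambda>i\<in>I. X i \<omega>) \<le> (\<Sum>i\<in>I. partition_entropy M (X i))"
  using assms
proof (induction I rule: finite_induct)
  case empty
  then show ?case by (simp add: restrict_def partition_entropy_const)
next
  case (insert j I)
  have s: "simple_function M (\<lambda>\<omega>. \<lambda>i\<in>I. X i \<omega>)" using insert.hyps(1) insert.prems by (intro simple_function_restrict) simp_all
  have sj: "simple_function M (X j)" using insert.prems by simp
  have eq: "(\<lambda>\<omega>. \<lambda>i\<in>insert j I. X i \<omega>) = (\<lambda>\<omega>. case (X j \<omega>, \<lambda>i\<in>I. X i \<omega>) of (a, h) \<Rightarrow> h(j := a))"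
    by (intro ext) (simp add: restrict_def)
  have "partition_entropy M (\<lambda>\<omega>. \<lambda>i\<in>insert j I. X i \<omega>) \<le> partition_entropy M (\<lambda>\<omega>. (X j \<omega>, \<lambda>i\<in>I. X i \<omega>))"
    unfolding eq by (rule partition_entropy_compose[OF simple_function_Pair[OF sj s]])
  also have "\<dots> \<le> partition_entropy M (X j) + partition_entropy M (\<lambda>\<omega>. \<lambda>i\<in>I. X i \<omega>)"
    by (rule partition_entropy_Pair[OF sj s])
  also have "\<dots> \<le> partition_entropy M (X j) + (\<Sum>i\<in>I. partition_entropy M (X i))"
    by (intro add_left_mono insert.IH) (rule insert.prems, rule insertI2)
  finally show ?case by (simp only: sum.insert[OF insert.hyps])
qed

text \<open>From ln x \<le> x - 1 at x = 1 / sqrt q. With of order n^2 cells of probability of order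
  1/n, the square root is what produces the exponent 3/2 in the zero entropy bound.\<close>

lemma neg_mult_ln_le_sqrt:
  fixes q :: real assumes "0 \<le> q" shows "- (q * ln q) \<le> 2 * sqrt q"
proof (cases "q = 0")
  case False
  then have q: "0 < q" using assms by simp
  have "ln (1 / sqrt q) \<le> 1 / sqrt q - 1" using q by (intro ln_le_minus_one) simp
  then have "- (ln q / 2) \<le> 1 / sqrt q" using q by (simp add: ln_div ln_sqrt)
  then have "- ln q \<le> 2 / sqrt q" by simp
  then have "q * (- ln q) \<le> q * (2 / sqrt q)" using q by (intro mult_left_mono) auto
  also have "\<dots> = 2 * sqrt q" using q by (simp add: field_simps real_sqrt_mult_self)
  finally show ?thesis by simp
qed simp

lemma neg_mult_ln_le:
  fixes q :: real assumes "0 \<le> q" "q \<le> 1" shows "- (q * ln q) \<le> 1 - q"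
proof (cases "q = 0")
  case False
  then have q: "0 < q" using assms by simp
  have "ln (1 / q) \<le> 1 / q - 1" using q by (intro ln_le_minus_one) simp
  then have "q * (- ln q) \<le> q * (1 / q - 1)" using q by (intro mult_left_mono) (simp_all add: ln_div)
  also have "\<dots> = 1 - q" using q by (simp add: right_diff_distrib)
  finally show ?thesis by simp
qed simp

text \<open>The dominant value contributes at most 1 - q, where q is its probability; every other
  value has probability at most \<open>p\<close> and is bounded by the square root.\<close>

lemma partition_entropy_small:
  assumes X: "simple_function M X" and k: "card (X ` space M) \<le> k" and p: "prob {\<omega> \<in> space M. X \<omega> \<noteq> x0} \<le> p"
  shows "partition_entropy M X \<le> 2 * real k * sqrt p"
proof -
  define P where "P x = prob (X -` {x} \<inter> space M)" for x
  have ev: "X -` {x} \<inter> space M \<in> events" for x by (rule simple_functionD(2)[OF X])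
  have ne: "{\<omega> \<in> space M. X \<omega> \<noteq> x0} = space M - (X -` {x0} \<inter> space M)" by auto
  have p0: "0 \<le> p" using p measure_nonneg order.trans by blast
  have le: "- (P x * ln (P x)) \<le> 2 * sqrt p" for x
  proof (cases "x = x0")
    case True
    have "1 - P x0 \<le> p" using p unfolding ne P_def by (simp add: prob_compl[OF ev])
    moreover have "P x0 \<le> 1" "0 \<le> P x0" by (simp_all add: P_def)
    ultimately have "1 - P x0 \<le> sqrt p"
      \<comment> \<open>A number between 0 and 1 is at least its square, so
        \<open>1 - P x0 \<le> p\<close> also bounds the square of \<open>1 - P x0\<close> by
        \<open>p\<close>.\<close>
      using mult_left_le_one_le[of "1 - P x0" "1 - P x0"] by (intro real_le_rsqrt) (unfold power2_eq_square, linarith)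
    then show ?thesis
      using neg_mult_ln_le[of "P x0"] real_sqrt_ge_zero[OF p0] True \<open>P x0 \<le> 1\<close> \<open>0 \<le> P x0\<close> by simp
  next
    case False
    have "P x \<le> prob {\<omega> \<in> space M. X \<omega> \<noteq> x0}"
      unfolding P_def ne using False ev by (intro finite_measure_mono) auto
    then have "P x \<le> p" using p by simp
    then have "sqrt (P x) \<le> sqrt p" by simp
    moreover have "0 \<le> P x" by (simp add: P_def)
    ultimately show ?thesis using neg_mult_ln_le_sqrt[of "P x"] by linarith
  qed
  have "partition_entropy M X = (\<Sum>x\<in>X ` space M. - (P x * ln (P x)))"
    unfolding partition_entropy_eq[OF X] P_def by (simp add: sum_negf)
  also have "\<dots> \<le> (\<Sum>x\<in>X ` space M. 2 * sqrt p)" by (intro sum_mono le)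
  also have "\<dots> = real (card (X ` space M)) * (2 * sqrt p)" by simp
  also have "\<dots> \<le> real k * (2 * sqrt p)" using k p0 by (intro mult_right_mono) auto
  finally show ?thesis by (simp add: mult_ac)
qed

text \<open>Recording the sites where \<open>Y\<close> fails to predict \<open>X\<close>, together with the correct value there,
  recovers \<open>X\<close> from \<open>Y\<close>; each such error variable is mostly \<open>0\<close> and hence has small entropy.\<close>

lemma partition_entropy_approx:
  fixes X Y :: "'i \<Rightarrow> 'a \<Rightarrow> nat"
  assumes I: "finite I" and X: "\<And>i. i \<in> I \<Longrightarrow> simple_function M (X i)" and Y: "\<And>i. i \<in> I \<Longrightarrow> simple_function M (Y i)"
    and k: "\<And>i \<omega>. i \<in> I \<Longrightarrow> \<omega> \<in> space M \<Longrightarrow> X i \<omega> < k"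
    and e: "\<And>i. i \<in> I \<Longrightarrow> prob {\<omega> \<in> space M. X i \<omega> \<noteq> Y i \<omega>} \<le> e"
  shows "partition_entropy M (\<lambda>\<omega>. \<lambda>i\<in>I. X i \<omega>) \<le> partition_entropy M (\<lambda>\<omega>. \<lambda>i\<in>I. Y i \<omega>) + real (card I) * (2 * real (Suc k) * sqrt e)"
proof -
  define E where "E i \<omega> = (if X i \<omega> = Y i \<omega> then 0 else Suc (X i \<omega>))" for i \<omega>
  have E: "simple_function M (E i)" if "i \<in> I" for i
    unfolding E_def
    using simple_function_compose1[OF simple_function_Pair[OF X[OF that] Y[OF that]], of "\<lambda>(x, y). if x = y then 0 else Suc x"]
    by simp
  have "(\<lambda>\<omega>. \<lambda>i\<in>I. X i \<omega>) = (\<lambda>\<omega>. (\<lambda>(y, z). \<lambda>i\<in>I. if z i = 0 then y i else z i - 1) (\<lambda>i\<in>I. Y i \<omega>, \<lambda>i\<in>I. E i \<omega>))"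
    by (auto simp: fun_eq_iff restrict_def E_def)
  then have "partition_entropy M (\<lambda>\<omega>. \<lambda>i\<in>I. X i \<omega>) \<le> partition_entropy M (\<lambda>\<omega>. (\<lambda>i\<in>I. Y i \<omega>, \<lambda>i\<in>I. E i \<omega>))"
    by (simp only:, intro partition_entropy_compose simple_function_Pair simple_function_restrict I Y E)
  also have "\<dots> \<le> partition_entropy M (\<lambda>\<omega>. \<lambda>i\<in>I. Y i \<omega>) + partition_entropy M (\<lambda>\<omega>. \<lambda>i\<in>I. E i \<omega>)"
    by (intro partition_entropy_Pair simple_function_restrict I Y E)
  also have "partition_entropy M (\<lambda>\<omega>. \<lambda>i\<in>I. E i \<omega>) \<le> (\<Sum>i\<in>I. partition_entropy M (E i))"
    by (intro partition_entropy_family I E)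
  also have "\<dots> \<le> (\<Sum>i\<in>I. 2 * real (Suc k) * sqrt e)"
  proof (intro sum_mono partition_entropy_small E)
    fix i assume i: "i \<in> I"
    have "E i ` space M \<subseteq> {..k}" using k[OF i] by (auto simp: E_def Suc_le_eq)
    then have "card (E i ` space M) \<le> card {..k}" by (intro card_mono) auto
    then show "card (E i ` space M) \<le> Suc k" by simp
    have "{\<omega> \<in> space M. E i \<omega> \<noteq> 0} = {\<omega> \<in> space M. X i \<omega> \<noteq> Y i \<omega>}" by (auto simp: E_def)
    then show "prob {\<omega> \<in> space M. E i \<omega> \<noteq> 0} \<le> e" using e[OF i] by simp
  qed
  finally show ?thesis by (simp only: sum_constant)
qed

lemma expectation_simple:
  fixes g :: "'b \<Rightarrow> real"
  assumes X: "simple_function M X"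
  shows "integrable M (\<lambda>\<omega>. g (X \<omega>))" "expectation (\<lambda>\<omega>. g (X \<omega>)) = (\<Sum>x\<in>X ` space M. prob (X -` {x} \<inter> space M) * g x)"
proof -
  have ev: "X -` {x} \<inter> space M \<in> events" for x by (rule simple_functionD(2)[OF X])
  have fin: "finite (X ` space M)" by (rule simple_functionD(1)[OF X])
  define E where "E x = X -` {x} \<inter> space M" for x
  have E: "E x \<in> events" for x unfolding E_def by (rule ev)
  have eq: "g (X \<omega>) = (\<Sum>x\<in>X ` space M. g x * indicator (E x) \<omega>)" if "\<omega> \<in> space M" for \<omega>
  proof -
    have "(\<Sum>x\<in>X ` space M. g x * indicator (E x) \<omega>) = (\<Sum>x\<in>X ` space M. if x = X \<omega> then g x else 0)"
    proof (rule sum.cong[OF refl])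
      fix x show "g x * indicator (E x) \<omega> = (if x = X \<omega> then g x else 0)"
        using that by (cases "x = X \<omega>") (auto simp: E_def)
    qed
    also have "\<dots> = g (X \<omega>)" using that fin by (subst sum.delta) auto
    finally show ?thesis by (rule sym)
  qed
  have intE: "integrable M (\<lambda>\<omega>. g x * indicator (E x) \<omega>)" for x
    by (rule integrable_mult_right) (rule integrable_real_indicator[OF E], simp add: emeasure_eq_measure)
  have "integrable M (\<lambda>\<omega>. g (X \<omega>)) \<longleftrightarrow> integrable M (\<lambda>\<omega>. \<Sum>x\<in>X ` space M. g x * indicator (E x) \<omega>)"
    by (rule Bochner_Integration.integrable_cong[OF refl eq])
  then show "integrable M (\<lambda>\<omega>. g (X \<omega>))"
    by (rule iffD2) (rule Bochner_Integration.integrable_sum, rule intE)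
  have "expectation (\<lambda>\<omega>. g (X \<omega>)) = expectation (\<lambda>\<omega>. \<Sum>x\<in>X ` space M. g x * indicator (E x) \<omega>)"
    by (rule Bochner_Integration.integral_cong[OF refl eq])
  also have "\<dots> = (\<Sum>x\<in>X ` space M. expectation (\<lambda>\<omega>. g x * indicator (E x) \<omega>))"
    by (rule Bochner_Integration.integral_sum) (rule intE)
  also have "\<dots> = (\<Sum>x\<in>X ` space M. prob (X -` {x} \<inter> space M) * g x)"
  proof (rule sum.cong[OF refl])
    fix x show "expectation (\<lambda>\<omega>. g x * indicator (E x) \<omega>) = prob (X -` {x} \<inter> space M) * g x"
      unfolding E_def[symmetric] using E[of x] by simp
  qed
  finally show "expectation (\<lambda>\<omega>. g (X \<omega>)) = (\<Sum>x\<in>X ` space M. prob (X -` {x} \<inter> space M) * g x)" .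
qed

lemma partition_entropy_expectation:
  assumes X: "simple_function M X"
  shows "partition_entropy M X = expectation (\<lambda>\<omega>. - ln (prob (X -` {X \<omega>} \<inter> space M)))"
  using expectation_simple(2)[OF X, of "\<lambda>x. - ln (prob (X -` {x} \<inter> space M))"]
  by (simp add: partition_entropy_eq[OF X] sum_negf)

text \<open>Entropy is the mean of the information function, minus the logarithm of the probability
  of the cell, and this function is additive over independent variables; positivity of the cells
  lets the logarithm of the product split.\<close>

lemma partition_entropy_indep:
  assumes I: "finite I" and X: "\<And>i. i \<in> I \<Longrightarrow> simple_function M (X i)"
    and pos: "\<And>i x. i \<in> I \<Longrightarrow> x \<in> X i ` space M \<Longrightarrow> 0 < prob (X i -` {x} \<inter> space M)"
    and indep: "\<And>x. prob {\<omega> \<in> space M. \<forall>i\<in>I. X i \<omega> = x i} = (\<Prod>i\<in>I. prob (X i -` {x i} \<inter> space M))"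
  shows "partition_entropy M (\<lambda>\<omega>. \<lambda>i\<in>I. X i \<omega>) = (\<Sum>i\<in>I. partition_entropy M (X i))"
proof -
  have s: "simple_function M (\<lambda>\<omega>. \<lambda>i\<in>I. X i \<omega>)" by (intro simple_function_restrict I X)
  have "- ln (prob ((\<lambda>\<omega>. \<lambda>i\<in>I. X i \<omega>) -` {\<lambda>i\<in>I. X i \<omega>} \<inter> space M)) = (\<Sum>i\<in>I. - ln (prob (X i -` {X i \<omega>} \<inter> space M)))"
    if \<omega>: "\<omega> \<in> space M" for \<omega>
  proof -
    have "(\<lambda>\<omega>. \<lambda>i\<in>I. X i \<omega>) -` {\<lambda>i\<in>I. X i \<omega>} \<inter> space M = {\<omega>' \<in> space M. \<forall>i\<in>I. X i \<omega>' = X i \<omega>}"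
      by (auto simp: restrict_def fun_eq_iff) metis
    then have "prob ((\<lambda>\<omega>. \<lambda>i\<in>I. X i \<omega>) -` {\<lambda>i\<in>I. X i \<omega>} \<inter> space M) = (\<Prod>i\<in>I. prob (X i -` {X i \<omega>} \<inter> space M))"
      using indep[of "\<lambda>i. X i \<omega>"] by simp
    moreover have "ln (\<Prod>i\<in>I. prob (X i -` {X i \<omega>} \<inter> space M)) = (\<Sum>i\<in>I. ln (prob (X i -` {X i \<omega>} \<inter> space M)))"
      using pos[THEN less_imp_neq, THEN not_sym] \<omega> by (intro ln_prod I) blast
    ultimately show ?thesis by (simp add: sum_negf)
  qed
  then have "partition_entropy M (\<lambda>\<omega>. \<lambda>i\<in>I. X i \<omega>) = expectation (\<lambda>\<omega>. \<Sum>i\<in>I. - ln (prob (X i -` {X i \<omega>} \<inter> space M)))"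
    unfolding partition_entropy_expectation[OF s] by (intro Bochner_Integration.integral_cong) auto
  also have "\<dots> = (\<Sum>i\<in>I. expectation (\<lambda>\<omega>. - ln (prob (X i -` {X i \<omega>} \<inter> space M))))"
    by (intro Bochner_Integration.integral_sum expectation_simple(1)[OF X])
  also have "\<dots> = (\<Sum>i\<in>I. partition_entropy M (X i))"
    by (intro sum.cong refl) (simp add: partition_entropy_expectation[OF X])
  finally show ?thesis .
qed

section \<open>Criteria for Kolmogorov-Sinai entropy\<close>

lemma simple_function_finite_partition:
  assumes "finite_partition M \<xi>" "S \<in> measurable M M"
  shows "simple_function M (\<lambda>\<omega>. \<xi> (S \<omega>))"
proof -
  have "finite ((\<lambda>\<omega>. \<xi> (S \<omega>)) ` space M)"
    using assms measurable_space[OF assms(2)] unfolding finite_partition_def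
    by (auto intro: finite_subset[of _ "\<xi> ` space M"])
  moreover have "(\<lambda>\<omega>. \<xi> (S \<omega>)) \<in> measurable M (count_space UNIV)"
    using assms unfolding finite_partition_def by (auto intro: measurable_compose)
  ultimately show ?thesis
    unfolding simple_function_def by (auto intro: measurable_sets)
qed

lemma finite_partition_const: "finite_partition M (\<lambda>_. 0)"
  unfolding finite_partition_def by (auto simp: image_constant_conv)

lemma ks_entropy_eq_0I:
  assumes S: "\<And>i. S i \<in> measurable M M" and F: "\<And>n. finite (F n)"
    and small: "\<And>\<xi> e. finite_partition M \<xi> \<Longrightarrow> 0 < e \<Longrightarrow>
      eventually (\<lambda>n. partition_entropy M (join_partition \<xi> S (F n)) / real (card (F n)) \<le> e) sequentially"
  shows "ks_entropy M S F = 0"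
proof -
  have "limsup (\<lambda>n. ereal (partition_entropy M (join_partition \<xi> S (F n)) / real (card (F n)))) = 0" if \<xi>: "finite_partition M \<xi>" for \<xi>
  proof (rule antisym)
    show "limsup (\<lambda>n. ereal (partition_entropy M (join_partition \<xi> S (F n)) / real (card (F n)))) \<le> 0"
    proof (rule dense_ge)
      fix z :: ereal assume z: "0 < z"
      show "limsup (\<lambda>n. ereal (partition_entropy M (join_partition \<xi> S (F n)) / real (card (F n)))) \<le> z"
      proof (cases z)
        case (real e)
        then have "eventually (\<lambda>n. ereal (partition_entropy M (join_partition \<xi> S (F n)) / real (card (F n))) \<le> z) sequentially"
          using small[OF \<xi>, of e] z by simp
        then show ?thesis by (rule Limsup_bounded)
      qed (use z in auto)
    qed
    have "0 \<le> partition_entropy M (join_partition \<xi> S (F n)) / real (card (F n))" for n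
      unfolding join_partition_def[abs_def]
      by (intro divide_nonneg_nonneg partition_entropy_nonneg simple_function_restrict F simple_function_finite_partition \<xi> S) auto
    then show "0 \<le> limsup (\<lambda>n. ereal (partition_entropy M (join_partition \<xi> S (F n)) / real (card (F n))))"
      by (intro le_Limsup) auto
  qed
  moreover have "{\<xi>. finite_partition M \<xi>} \<noteq> {}" using finite_partition_const by blast
  ultimately show ?thesis unfolding ks_entropy_def by (intro SUP_eq_const) auto
qed

lemma ks_entropy_eq_topI:
  assumes large: "\<And>B::real. \<exists>\<xi>. finite_partition M \<xi> \<and>
      eventually (\<lambda>n. B \<le> partition_entropy M (join_partition \<xi> S (F n)) / real (card (F n))) sequentially"
  shows "ks_entropy M S F = \<infinity>"
proof (rule ereal_top)
  fix B :: real
  obtain \<xi> where \<xi>: "finite_partition M \<xi>" "eventually (\<lambda>n. B \<le> partition_entropy M (join_partition \<xi> S (F n)) / real (card (F n))) sequentially"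
    using large by blast
  have "ereal B \<le> limsup (\<lambda>n. ereal (partition_entropy M (join_partition \<xi> S (F n)) / real (card (F n))))"
    using \<xi>(2) by (intro le_Limsup) auto
  also have "\<dots> \<le> ks_entropy M S F" unfolding ks_entropy_def using \<xi>(1) by (intro SUP_upper) auto
  finally show "ereal B \<le> ks_entropy M S F" .
qed

end

section \<open>The space of lines\<close>

text \<open>The base of a Poisson action has to be carried by the reals, so the direction parameter
  \<open>y\<close> and the offset \<open>t\<close> are packed into one real.\<close>

definition line :: "real \<Rightarrow> real \<Rightarrow> real" where
  "line y t = seq_enc (\<lambda>i. if i = 0 then y else t)"

definition direction :: "real \<Rightarrow> real" where "direction x = seq_dec x 0"

definition offset :: "real \<Rightarrow> real" where "offset x = seq_dec x 1"

definition is_line :: "real \<Rightarrow> bool" where "is_line x \<longleftrightarrow> line (direction x) (offset x) = x"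

lemma direction_line [simp]: "direction (line y t) = y"
  and offset_line [simp]: "offset (line y t) = t"
  and is_line_line [simp]: "is_line (line y t)"
  by (simp_all add: direction_def offset_def is_line_def line_def)

lemma measurable_direction [measurable]: "direction \<in> borel_measurable borel"
  and measurable_offset [measurable]: "offset \<in> borel_measurable borel"
  unfolding direction_def[abs_def] offset_def[abs_def] by measurable

lemma measurable_line [measurable (raw)]:
  assumes [measurable]: "f \<in> borel_measurable N" "g \<in> borel_measurable N"
  shows "(\<lambda>x. line (f x) (g x)) \<in> borel_measurable N"
  unfolding line_def by measurable

lemma pred_is_line [measurable]: "Measurable.pred borel is_line"
  unfolding is_line_def[abs_def] by measurable

definition unit_uniform :: "real measure" where "unit_uniform = uniform_measure lborel {0..1}"

lemma sets_unit_uniform [simp, measurable_cong]: "sets unit_uniform = sets borel"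
  and space_unit_uniform [simp]: "space unit_uniform = UNIV"
  by (simp_all add: unit_uniform_def)

lemma prob_space_unit_uniform: "prob_space unit_uniform"
  unfolding unit_uniform_def by (rule prob_space_uniform_measure) simp_all

lemma AE_unit_uniform: "AE y in unit_uniform. 0 \<le> y \<and> y \<le> 1"
  unfolding unit_uniform_def by (rule AE_uniform_measureI) auto

definition line_measure :: "real measure" where
  "line_measure = distr (unit_uniform \<Otimes>\<^sub>M lborel) borel (\<lambda>(y, t). line y t)"

lemma sets_line_measure [simp, measurable_cong]: "sets line_measure = sets borel"
  and space_line_measure [simp]: "space line_measure = UNIV"
  by (simp_all add: line_measure_def)

lemma nn_integral_line_measure:
  assumes [measurable]: "f \<in> borel_measurable borel"
  shows "(\<integral>\<^sup>+x. f x \<partial>line_measure) = (\<integral>\<^sup>+y. \<integral>\<^sup>+t. f (line y t) \<partial>lborel \<partial>unit_uniform)"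
proof -
  have m: "(\<lambda>p. f (case p of (y, t) \<Rightarrow> line y t)) \<in> borel_measurable (unit_uniform \<Otimes>\<^sub>M lborel)"
    by measurable
  have "(\<integral>\<^sup>+x. f x \<partial>line_measure) = (\<integral>\<^sup>+p. f (case p of (y, t) \<Rightarrow> line y t) \<partial>(unit_uniform \<Otimes>\<^sub>M lborel))"
    unfolding line_measure_def by (rule nn_integral_distr) measurable
  then show ?thesis using lborel.nn_integral_fst[OF m] by simp
qed

lemma emeasure_line_measure:
  assumes A [measurable]: "A \<in> sets borel"
  shows "emeasure line_measure A = (\<integral>\<^sup>+y. emeasure lborel {t. line y t \<in> A} \<partial>unit_uniform)"
proof -
  have "emeasure line_measure A = (\<integral>\<^sup>+x. indicator A x \<partial>line_measure)" by simp
  also have "\<dots> = (\<integral>\<^sup>+y. \<integral>\<^sup>+t. indicator A (line y t) \<partial>lborel \<partial>unit_uniform)"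
    by (rule nn_integral_line_measure) measurable
  also have "\<dots> = (\<integral>\<^sup>+y. emeasure lborel {t. line y t \<in> A} \<partial>unit_uniform)"
  proof (intro nn_integral_cong)
    fix y
    have "{t \<in> space lborel. line y t \<in> A} \<in> sets lborel" by measurable
    then have "(\<integral>\<^sup>+t. indicator {t. line y t \<in> A} t \<partial>lborel) = emeasure lborel {t. line y t \<in> A}" by simp
    moreover have "indicator A (line y t) = (indicator {t. line y t \<in> A} t :: ennreal)" for t by (simp add: indicator_def)
    ultimately show "(\<integral>\<^sup>+t. indicator A (line y t) \<partial>lborel) = emeasure lborel {t. line y t \<in> A}" by simp
  qed
  finally show ?thesis .
qed

lemma AE_line_measure:
  assumes [measurable]: "Measurable.pred borel Q" and "AE y in unit_uniform. \<forall>t. Q (line y t)"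
  shows "AE x in line_measure. Q x"
proof (rule AE_I)
  show "{x \<in> space line_measure. \<not> Q x} \<subseteq> {x. \<not> Q x}" by simp
  have "{x \<in> space borel. \<not> Q x} \<in> sets borel" by measurable
  then have m: "{x. \<not> Q x} \<in> sets borel" by simp
  then show "{x. \<not> Q x} \<in> sets line_measure" by simp
  have "(\<integral>\<^sup>+y. emeasure lborel {t. line y t \<in> {x. \<not> Q x}} \<partial>unit_uniform) = (\<integral>\<^sup>+y. 0 \<partial>unit_uniform)"
    using assms(2) by (intro nn_integral_cong_AE) (auto elim!: eventually_mono)
  then show "emeasure line_measure {x. \<not> Q x} = 0" by (simp add: emeasure_line_measure[OF m])
qed

lemma AE_is_line: "AE x in line_measure. is_line x"
  by (rule AE_line_measure) auto

lemma AE_direction: "AE x in line_measure. 0 \<le> direction x \<and> direction x \<le> 1"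
  by (rule AE_line_measure) (measurable, use AE_unit_uniform in auto)

text \<open>Off the codes, on a null set, the map is the identity; the group law
  \<open>drift_drift\<close> then holds at every point and not only almost everywhere.\<close>

definition drift :: "(real \<Rightarrow> real) \<Rightarrow> real \<Rightarrow> real" where
  "drift c x = (if is_line x then line (direction x) (offset x + c (direction x)) else x)"

lemma measurable_drift [measurable]:
  assumes [measurable]: "c \<in> borel_measurable borel"
  shows "drift c \<in> borel_measurable borel"
  unfolding drift_def[abs_def] by measurable

lemma drift_line [simp]: "drift c (line y t) = line y (t + c y)"
  by (simp add: drift_def)

lemma is_line_drift [simp]: "is_line (drift c x) \<longleftrightarrow> is_line x"
  by (simp add: drift_def)

lemma direction_drift [simp]: "direction (drift c x) = direction x"
  by (simp add: drift_def)

lemma offset_drift: "is_line x \<Longrightarrow> offset (drift c x) = offset x + c (direction x)"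
  by (simp add: drift_def)

lemma drift_drift: "drift c (drift c' x) = drift (\<lambda>y. c y + c' y) x"
  by (simp add: drift_def add_ac)

lemma drift_0 [simp]: "drift (\<lambda>_. 0) x = x"
  by (simp add: drift_def is_line_def)

text \<open>On each fibre of constant direction the map is a translation, which preserves Lebesgue
  measure.\<close>

lemma distr_drift:
  assumes [measurable]: "c \<in> borel_measurable borel"
  shows "distr line_measure line_measure (drift c) = line_measure"
proof (rule measure_eqI)
  fix A assume "A \<in> sets (distr line_measure line_measure (drift c))"
  then have A [measurable]: "A \<in> sets borel" by simp
  have "emeasure (distr line_measure line_measure (drift c)) A = emeasure line_measure (drift c -` A)"
    by (subst emeasure_distr) (auto simp: measurable_cong_sets[OF sets_line_measure sets_line_measure])
  also have "\<dots> = (\<integral>\<^sup>+y. emeasure lborel {t. line y t \<in> drift c -` A} \<partial>unit_uniform)"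
    using measurable_sets[OF measurable_drift[OF assms] A] by (intro emeasure_line_measure) simp
  also have "\<dots> = (\<integral>\<^sup>+y. emeasure lborel {t. line y t \<in> A} \<partial>unit_uniform)"
  proof (intro nn_integral_cong)
    fix y
    have m: "{t \<in> space lborel. line y t \<in> A} \<in> sets lborel" by measurable
    have "emeasure lborel {t. line y t \<in> A} = emeasure (distr lborel borel ((+) (c y))) {t. line y t \<in> A}"
      by (simp add: lborel_distr_plus)
    also have "\<dots> = emeasure lborel {t. line y t \<in> drift c -` A}"
      using m by (subst emeasure_distr) (auto simp: add.commute intro!: arg_cong[where f = "emeasure lborel"])
    finally show "emeasure lborel {t. line y t \<in> drift c -` A} = emeasure lborel {t. line y t \<in> A}" by simp
  qed
  also have "\<dots> = emeasure line_measure A" by (rule emeasure_line_measure[symmetric]) simp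
  finally show "emeasure (distr line_measure line_measure (drift c)) A = emeasure line_measure A" .
qed simp

lemma emeasure_drift_vimage:
  assumes "c \<in> borel_measurable borel" "A \<in> sets borel"
  shows "emeasure line_measure (drift c -` A) = emeasure line_measure A"
proof -
  have "emeasure line_measure A = emeasure (distr line_measure line_measure (drift c)) A"
    by (simp add: distr_drift[OF assms(1)])
  also have "\<dots> = emeasure line_measure (drift c -` A)"
    using assms measurable_drift[OF assms(1)]
    by (subst emeasure_distr) (auto simp: measurable_cong_sets[OF sets_line_measure sets_line_measure])
  finally show ?thesis by simp
qed

lemma drift_vimage_sets [measurable]:
  "c \<in> borel_measurable borel \<Longrightarrow> A \<in> sets borel \<Longrightarrow> drift c -` A \<in> sets borel"
  using measurable_sets[OF measurable_drift, of c A] by simp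

lemma emeasure_line_measure_le:
  assumes "A \<in> sets borel" "0 \<le> b" "\<And>y. 0 \<le> y \<Longrightarrow> y \<le> 1 \<Longrightarrow> emeasure lborel {t. line y t \<in> A} \<le> ennreal b"
  shows "emeasure line_measure A \<le> ennreal b"
proof -
  interpret prob_space unit_uniform by (rule prob_space_unit_uniform)
  have "emeasure line_measure A \<le> (\<integral>\<^sup>+y. ennreal b \<partial>unit_uniform)"
    unfolding emeasure_line_measure[OF assms(1)]
  proof (rule nn_integral_mono_AE)
    show "AE y in unit_uniform. emeasure lborel {t. line y t \<in> A} \<le> ennreal b"
      using AE_unit_uniform by eventually_elim (use assms(3) in blast)
  qed
  then show ?thesis using emeasure_space_1 by simp
qed

text \<open>Offsets in a unit interval with a uniformly distributed direction have mass exactly 1,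
  as \<open>unit_pieces\<close> demands; \<open>int_decode\<close> runs through all
  integers.\<close>

definition strip :: "nat \<Rightarrow> real set" where "strip n = {x. \<lfloor>offset x\<rfloor> = int_decode n}"

lemma vimage_floor_eq: "{t::real. \<lfloor>t\<rfloor> = k} = {of_int k..<of_int k + 1}"
  by (auto simp: floor_eq_iff)

lemma strip_sets [measurable]: "strip n \<in> sets borel"
  unfolding strip_def by measurable

lemma strip_disjoint: "disjoint_family strip"
  unfolding disjoint_family_on_def strip_def by (auto simp: int_decode_eq)

lemma strip_cover: "(\<Union>n. strip n) = UNIV"
proof -
  have "x \<in> strip (int_encode \<lfloor>offset x\<rfloor>)" for x by (simp add: strip_def)
  then show ?thesis by blast
qed

lemma emeasure_strip: "emeasure line_measure (strip n) = 1"
proof -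
  interpret prob_space unit_uniform by (rule prob_space_unit_uniform)
  have "emeasure lborel {t. line y t \<in> strip n} = 1" for y
    by (simp add: strip_def vimage_floor_eq)
  then show ?thesis using emeasure_space_1 by (subst emeasure_line_measure) simp_all
qed

lemma unit_pieces_strip: "unit_pieces line_measure strip"
  by unfold_locales (simp_all add: strip_disjoint strip_cover emeasure_strip)

lemma sigma_finite_line_measure: "sigma_finite_measure line_measure"
proof
  show "\<exists>A. countable A \<and> A \<subseteq> sets line_measure \<and> \<Union> A = space line_measure \<and> (\<forall>a\<in>A. emeasure line_measure a \<noteq> \<infinity>)"
    by (intro exI[of _ "range strip"]) (auto simp: strip_cover emeasure_strip)
qed

lemma emeasure_line_measure_space: "emeasure line_measure UNIV = \<infinity>"
proof -
  have "emeasure line_measure UNIV = emeasure line_measure (\<Union>n. strip n)" by (simp add: strip_cover)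
  also have "\<dots> = (\<Sum>n. emeasure line_measure (strip n))"
    by (rule suminf_emeasure[symmetric]) (auto simp: strip_disjoint)
  also have "\<dots> = (\<Sum>n. 1 :: ennreal)" by (simp add: emeasure_strip)
  also have "\<dots> = \<infinity>" by (simp add: nn_integral_count_space_nat[symmetric])
  finally show ?thesis .
qed

text \<open>The offset is cut into slices of mass at most 1/m, with 1/m below the mass of
  \<open>A\<close>. Countably many slices cover \<open>A\<close>, so one of them meets it in
  positive mass.\<close>

lemma non_atomic_line_measure: "non_atomic line_measure"
  unfolding non_atomic_def
proof (intro ballI impI)
  fix A assume "A \<in> sets line_measure" and pos: "0 < emeasure line_measure A"
  then have A [measurable]: "A \<in> sets borel" by simp
  obtain m :: nat where m: "0 < m" "ennreal (1 / real m) < emeasure line_measure A"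
  proof (cases "emeasure line_measure A")
    case (real a)
    then have "0 < a" using pos by simp
    then obtain m :: nat where "0 < m" "inverse (real m) < a" using ex_inverse_of_nat_less by blast
    then show ?thesis using that[of m] real by (simp add: inverse_eq_divide ennreal_less_iff)
  next
    case top
    then show ?thesis using that[of 1] by simp
  qed
  define S where "S n = {x. \<lfloor>real m * offset x\<rfloor> = int_decode n}" for n :: nat
  have S [measurable]: "S n \<in> sets borel" for n unfolding S_def by measurable
  have SU: "(\<Union>n. A \<inter> S n) = A"
  proof -
    have "x \<in> S (int_encode \<lfloor>real m * offset x\<rfloor>)" for x by (simp add: S_def)
    then show ?thesis by blast
  qed
  have "\<exists>n. emeasure line_measure (A \<inter> S n) \<noteq> 0"
  proof (rule ccontr)
    assume "\<not> (\<exists>n. emeasure line_measure (A \<inter> S n) \<noteq> 0)"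
    then have "emeasure line_measure (\<Union>n. A \<inter> S n) = 0"
      by (intro emeasure_UN_eq_0) auto
    then show False using pos SU by simp
  qed
  then obtain n where n: "0 < emeasure line_measure (A \<inter> S n)" by (auto simp: zero_less_iff_neq_zero)
  have "emeasure line_measure (A \<inter> S n) \<le> emeasure line_measure (S n)" by (intro emeasure_mono) auto
  also have "\<dots> \<le> ennreal (1 / real m)"
  proof (rule emeasure_line_measure_le)
    fix y
    have "{t. line y t \<in> S n} = {of_int (int_decode n) / real m..<(of_int (int_decode n) + 1) / real m}"
      using m(1) by (auto simp: S_def floor_eq_iff field_simps)
    then show "emeasure lborel {t. line y t \<in> S n} \<le> ennreal (1 / real m)"
      using m(1) by (simp add: divide_simps flip: diff_divide_distrib)
  qed auto
  also have "\<dots> < emeasure line_measure A" by (rule m(2))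
  finally show "\<exists>B\<in>sets line_measure. B \<subseteq> A \<and> 0 < emeasure line_measure B \<and> emeasure line_measure B < emeasure line_measure A"
    using n by (intro bexI[of _ "A \<inter> S n"]) auto
qed

section \<open>Approximation in measure\<close>

text \<open>Closure under limits in measure replaces countable unions, since a countable union is
  approximated by its finite parts; beyond that only finite unions and complements have to be
  checked.\<close>

lemma (in finite_measure) sigma_sets_approx_induct [consumes 2, case_names generator compl union limit empty]:
  assumes G: "G \<subseteq> sets M" and E: "E \<in> sigma_sets (space M) G"
    and gen: "\<And>A. A \<in> G \<Longrightarrow> Q A"
    and compl: "\<And>A. A \<in> sets M \<Longrightarrow> Q A \<Longrightarrow> Q (space M - A)"
    and union: "\<And>A B. A \<in> sets M \<Longrightarrow> B \<in> sets M \<Longrightarrow> Q A \<Longrightarrow> Q B \<Longrightarrow> Q (A \<union> B)"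
    and limit: "\<And>A. A \<in> sets M \<Longrightarrow> (\<And>e. 0 < e \<Longrightarrow> \<exists>B\<in>sets M. Q B \<and> measure M (sym_diff A B) < e) \<Longrightarrow> Q A"
    and empty: "Q {}"
  shows "Q E"
proof -
  have sub: "sigma_sets (space M) G \<subseteq> sets M" using sets.sigma_sets_subset[OF G] .
  show ?thesis
    using E
  proof (induction rule: sigma_sets.induct)
    case (Union A)
    then have A: "A i \<in> sets M" for i using sub by auto
    have fin: "Q (\<Union>i<n. A i)" for n
    proof (induction n)
      case (Suc n)
      have "Q (A n \<union> (\<Union>i<n. A i))" using A Union.IH Suc by (intro union) auto
      then show ?case by (simp add: lessThan_Suc)
    qed (simp add: empty)
    show ?case
    proof (rule limit)
      show "(\<Union>i. A i) \<in> sets M" using A by auto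
      fix e :: real assume "0 < e"
      define R where "R n = (\<Union>i. A i) - (\<Union>i<n. A i)" for n
      have R: "range R \<subseteq> sets M" using A by (auto simp: R_def intro!: sets.Diff)
      have "decseq R" unfolding R_def by (intro decseq_SucI) (auto simp: less_Suc_eq)
      moreover have "(\<Inter>n. R n) = {}" unfolding R_def by (auto intro: lessI)
      ultimately have "(\<lambda>n. measure M (R n)) \<longlonglongrightarrow> 0"
        using finite_Lim_measure_decseq[OF R] by simp
      then have "eventually (\<lambda>n. measure M (R n) < e) sequentially"
        using \<open>0 < e\<close> by (intro order_tendstoD(2)) auto
      then obtain n where "measure M (R n) < e" by (auto simp: eventually_sequentially)
      moreover have "sym_diff (\<Union>i. A i) (\<Union>i<n. A i) = R n" unfolding R_def by auto
      ultimately show "\<exists>B\<in>sets M. Q B \<and> measure M (sym_diff (\<Union>i. A i) B) < e"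
        using fin A by (intro bexI[of _ "\<Union>i<n. A i"]) auto
    qed
  next
    case (Compl A)
    then show ?case using sub by (intro compl) auto
  qed (auto intro: gen empty)
qed

definition window :: "nat \<Rightarrow> real set" where "window N = {x. - real N \<le> offset x \<and> offset x < real N}"

lemma window_sets [measurable]: "window N \<in> sets borel"
  unfolding window_def by measurable

lemma emeasure_window: "emeasure line_measure (window N) < \<infinity>"
proof -
  have "emeasure line_measure (window N) \<le> ennreal (2 * real N)"
  proof (rule emeasure_line_measure_le)
    fix y
    have "{t. line y t \<in> window N} = {- real N..<real N}" by (auto simp: window_def)
    then show "emeasure lborel {t. line y t \<in> window N} \<le> ennreal (2 * real N)" by simp
  qed auto
  then show ?thesis by (simp add: le_less_trans)
qed

definition half_strip :: "real \<Rightarrow> real \<Rightarrow> real \<Rightarrow> real set" where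
  "half_strip b s s' = {x. direction x < b \<and> s \<le> offset x \<and> offset x < s'}"

lemma half_strip_sets [measurable]: "half_strip b s s' \<in> sets borel"
  unfolding half_strip_def by measurable

lemma sigma_sets_direction_offset:
  assumes "A \<in> sets borel"
  shows "{x. line (direction x) (offset x) \<in> A} \<in> sigma_sets UNIV (range (\<lambda>b. {x. direction x < b}) \<union> range (\<lambda>s. {x. offset x < s}))"
proof -
  let ?G = "range (\<lambda>b. {x. direction x < b}) \<union> range (\<lambda>s. {x. offset x < s})"
  let ?N = "sigma UNIV ?G"
  have [measurable]: "direction \<in> borel_measurable ?N" "offset \<in> borel_measurable ?N"
    by (auto simp: borel_measurable_iff_less)
  have "(\<lambda>x. line (direction x) (offset x)) \<in> borel_measurable ?N" by measurable
  from measurable_sets[OF this assms] show ?thesis by (simp add: vimage_def)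
qed

text \<open>Inside a window the mass is finite and \<open>sigma_sets_approx_induct\<close> applies;
  a general set of finite mass is the limit of its windows. Continuity of the action and
  approximation by grid cells are both reduced to half-strips in this way.\<close>

lemma line_measure_induct [consumes 2, case_names half_strip union diff limit]:
  assumes C: "C \<in> sets borel" "emeasure line_measure C < \<infinity>"
    and half_strip: "\<And>b s s'. Q (half_strip b s s')"
    and union: "\<And>A B. A \<in> sets borel \<Longrightarrow> B \<in> sets borel \<Longrightarrow> Q A \<Longrightarrow> Q B \<Longrightarrow> Q (A \<union> B)"
    and diff: "\<And>A B. A \<in> sets borel \<Longrightarrow> B \<in> sets borel \<Longrightarrow> Q A \<Longrightarrow> Q B \<Longrightarrow> Q (A - B)"
    and limit: "\<And>A. A \<in> sets borel \<Longrightarrow> emeasure line_measure A < \<infinity> \<Longrightarrow>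
       (\<And>e::real. 0 < e \<Longrightarrow> \<exists>B\<in>sets borel. Q B \<and> emeasure line_measure (sym_diff A B) < ennreal e) \<Longrightarrow> Q A"
  shows "Q C"
proof -
  have AE_Q: "Q A" if "A \<in> sets borel" "B \<in> sets borel" "emeasure line_measure A < \<infinity>" "Q B" "AE x in line_measure. x \<in> A \<longleftrightarrow> x \<in> B" for A B
  proof (rule limit)
    fix e :: real assume "0 < e"
    have "sym_diff A B \<in> null_sets line_measure"
      using that by (subst AE_iff_null_sets) (auto elim!: eventually_mono)
    then show "\<exists>B\<in>sets borel. Q B \<and> emeasure line_measure (sym_diff A B) < ennreal e"
      using that \<open>0 < e\<close> by (intro bexI[of _ B]) auto
  qed fact+
  have windowed: "Q (C \<inter> window N)" if C: "C \<in> sets borel" for C N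
  proof -
    define \<nu> where "\<nu> = density line_measure (indicator (window N))"
    have \<nu> [simp]: "sets \<nu> = sets borel" "space \<nu> = UNIV" by (simp_all add: \<nu>_def)
    have em: "emeasure \<nu> A = emeasure line_measure (A \<inter> window N)" if "A \<in> sets borel" for A
      unfolding \<nu>_def using that
      by (subst emeasure_density) (auto simp: indicator_inter_arith[symmetric] Int_commute nn_integral_indicator simp flip: indicator_inter_arith)
    have "finite_measure \<nu>"
      by (rule finite_measureI) (use emeasure_window[of N] in \<open>simp add: em\<close>)
    then interpret \<nu>: finite_measure \<nu> .
    have Qw: "Q (window N)"
    proof (rule AE_Q)
      \<comment> \<open>Directions lie in [0, 1] almost everywhere, so the bound 2 imposes
        nothing.\<close>
      show "Q (half_strip 2 (- real N) (real N))" by (rule half_strip)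
      show "AE x in line_measure. x \<in> window N \<longleftrightarrow> x \<in> half_strip 2 (- real N) (real N)"
        using AE_direction by eventually_elim (auto simp: window_def half_strip_def)
    qed (use emeasure_window in auto)
    \<comment> \<open>The generators see a point only through its direction and offset, so
      \<open>C\<close> is first replaced by the set read through these; the two agree on all
      lines.\<close>
    have "Q ({x. line (direction x) (offset x) \<in> C} \<inter> window N)"
    proof (rule \<nu>.sigma_sets_approx_induct[where Q = "\<lambda>A. Q (A \<inter> window N)"])
      show "range (\<lambda>b. {x. direction x < b}) \<union> range (\<lambda>s. {x. offset x < s}) \<subseteq> sets \<nu>"
        by auto
      show "{x. line (direction x) (offset x) \<in> C} \<in> sigma_sets (space \<nu>) (range (\<lambda>b. {x. direction x < b}) \<union> range (\<lambda>s. {x. offset x < s}))"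
        using sigma_sets_direction_offset[OF C] by simp
      fix A assume "A \<in> range (\<lambda>b. {x. direction x < b}) \<union> range (\<lambda>s. {x. offset x < s})"
      then consider b where "A = {x. direction x < b}" | s where "A = {x. offset x < s}" by blast
      then show "Q (A \<inter> window N)"
      proof cases
        case 1
        then have "A \<inter> window N = half_strip b (- real N) (real N)" by (auto simp: window_def half_strip_def)
        then show ?thesis by (simp add: half_strip)
      next
        case 2
        show ?thesis
        proof (rule AE_Q)
          have "{x \<in> space borel. offset x < s} \<in> sets borel" by measurable
          then show "A \<inter> window N \<in> sets borel" using 2 by (intro sets.Int) auto
          show "emeasure line_measure (A \<inter> window N) < \<infinity>"
            using emeasure_mono[of "A \<inter> window N" "window N" line_measure] emeasure_window[of N] by (auto intro: le_less_trans)
          show "Q (half_strip 2 (- real N) (min s (real N)))" by (rule half_strip)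
          show "AE x in line_measure. x \<in> A \<inter> window N \<longleftrightarrow> x \<in> half_strip 2 (- real N) (min s (real N))"
            using AE_direction by eventually_elim (auto simp: 2 window_def half_strip_def)
        qed simp
      qed
    next
      fix A assume "A \<in> sets \<nu>" "Q (A \<inter> window N)"
      then have "Q (window N - (A \<inter> window N))" using Qw by (intro diff) auto
      moreover have "window N - (A \<inter> window N) = (space \<nu> - A) \<inter> window N" by auto
      ultimately show "Q ((space \<nu> - A) \<inter> window N)" by simp
    next
      fix A B assume "A \<in> sets \<nu>" "B \<in> sets \<nu>" "Q (A \<inter> window N)" "Q (B \<inter> window N)"
      then have "Q ((A \<inter> window N) \<union> (B \<inter> window N))" by (intro union) auto
      then show "Q ((A \<union> B) \<inter> window N)" by (simp add: Int_Un_distrib2)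
    next
      fix A assume A: "A \<in> sets \<nu>" and ap: "\<And>e. 0 < e \<Longrightarrow> \<exists>B\<in>sets \<nu>. Q (B \<inter> window N) \<and> measure \<nu> (sym_diff A B) < e"
      show "Q (A \<inter> window N)"
      proof (rule limit)
        show "A \<inter> window N \<in> sets borel" using A by auto
        show "emeasure line_measure (A \<inter> window N) < \<infinity>"
          using emeasure_mono[of "A \<inter> window N" "window N" line_measure] emeasure_window[of N] by (auto intro: le_less_trans)
        fix e :: real assume "0 < e"
        then obtain B where B: "B \<in> sets \<nu>" "Q (B \<inter> window N)" "measure \<nu> (sym_diff A B) < e" using ap by blast
        have "emeasure line_measure (sym_diff (A \<inter> window N) (B \<inter> window N)) = emeasure line_measure (sym_diff A B \<inter> window N)"
          by (rule arg_cong[where f = "emeasure line_measure"]) auto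
        also have "\<dots> = ennreal (measure \<nu> (sym_diff A B))"
          using A B by (subst em[symmetric]) (auto simp: \<nu>.emeasure_eq_measure)
        also have "\<dots> < ennreal e" using B(3) \<open>0 < e\<close> by (simp add: ennreal_less_iff)
        finally show "\<exists>B\<in>sets borel. Q B \<and> emeasure line_measure (sym_diff (A \<inter> window N) B) < ennreal e"
          using B by (intro bexI[of _ "B \<inter> window N"]) auto
      qed
    next
      have "half_strip 0 0 0 = {}" by (auto simp: half_strip_def)
      then show "Q ({} \<inter> window N)" using half_strip[of 0 0 0] by simp
    qed
    then show ?thesis
    proof (rule AE_Q[rotated 3])
      show "AE x in line_measure. x \<in> C \<inter> window N \<longleftrightarrow> x \<in> {x. line (direction x) (offset x) \<in> C} \<inter> window N"
        using AE_is_line by eventually_elim (auto simp: is_line_def)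
      show "emeasure line_measure (C \<inter> window N) < \<infinity>"
        using emeasure_mono[of "C \<inter> window N" "window N" line_measure] emeasure_window[of N] by (auto intro: le_less_trans)
      show "{x. line (direction x) (offset x) \<in> C} \<inter> window N \<in> sets borel"
      proof -
        have "{x \<in> space borel. line (direction x) (offset x) \<in> C} \<in> sets borel" using C by measurable
        then show ?thesis by simp
      qed
    qed (use C in auto)
  qed
  show ?thesis
  proof (rule limit[OF C])
    fix e :: real assume e: "0 < e"
    define R where "R n = C - window n" for n
    have "(\<lambda>n. emeasure line_measure (R n)) \<longlonglongrightarrow> emeasure line_measure (\<Inter>n. R n)"
    proof (rule Lim_emeasure_decseq)
      show "range R \<subseteq> sets line_measure" using C by (auto simp: R_def)
      show "decseq R" by (intro decseq_SucI) (auto simp: R_def window_def)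
      show "emeasure line_measure (R i) \<noteq> \<infinity>" for i
        using emeasure_mono[of "R i" C line_measure] C by (auto simp: R_def top_unique)
    qed
    moreover have "(\<Inter>n. R n) = {}"
    proof -
      have "\<exists>n. x \<in> window n" for x
      proof -
        obtain n :: nat where "\<bar>offset x\<bar> < real n" using reals_Archimedean2 by blast
        then show ?thesis by (intro exI[of _ n]) (auto simp: window_def)
      qed
      then show ?thesis by (auto simp: R_def)
    qed
    ultimately have "(\<lambda>n. emeasure line_measure (R n)) \<longlonglongrightarrow> 0" by simp
    then have "eventually (\<lambda>n. emeasure line_measure (R n) < ennreal e) sequentially"
      using e by (intro order_tendstoD(2)) auto
    then obtain n where n: "emeasure line_measure (R n) < ennreal e" by (auto simp: eventually_sequentially)
    have "sym_diff C (C \<inter> window n) = R n" by (auto simp: R_def)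
    then show "\<exists>B\<in>sets borel. Q B \<and> emeasure line_measure (sym_diff C B) < ennreal e"
      using windowed[OF C(1)] n C(1) by (intro bexI[of _ "C \<inter> window n"]) auto
  qed
qed

section \<open>The moment curve and the action by translations\<close>

definition slope :: "real ^ 'd::finite \<Rightarrow> real \<Rightarrow> real" where
  "slope g y = (\<Sum>i\<in>UNIV. g $ i * y ^ to_nat i)"

lemma measurable_slope [measurable]: "slope g \<in> borel_measurable borel"
  unfolding slope_def[abs_def] by measurable

lemma slope_add: "slope (g + h) y = slope g y + slope h y"
  by (simp add: slope_def distrib_right sum.distrib)

lemma slope_diff: "slope (g - h) y = slope g y - slope h y"
  by (simp add: slope_def left_diff_distrib sum_subtractf)

lemma slope_0 [simp]: "slope 0 = (\<lambda>_. 0)"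
  by (simp add: slope_def fun_eq_iff)

lemma slope_scaleR: "slope (r *\<^sub>R g) y = r * slope g y"
  by (simp add: slope_def sum_distrib_left mult_ac)

lemma abs_slope_le:
  assumes "0 \<le> y" "y \<le> 1" shows "\<bar>slope g y\<bar> \<le> (\<Sum>i\<in>UNIV. \<bar>g $ i\<bar>)"
proof -
  have "\<bar>slope g y\<bar> \<le> (\<Sum>i\<in>UNIV. \<bar>g $ i * y ^ to_nat i\<bar>)" unfolding slope_def by (rule sum_abs)
  also have "\<dots> \<le> (\<Sum>i\<in>UNIV. \<bar>g $ i\<bar>)"
    using assms by (intro sum_mono) (auto simp: abs_mult power_abs intro!: mult_left_le power_le_one)
  finally show ?thesis .
qed

text \<open>The constant is proportional to the size \<open>N\<close> of the translation: an error
  in direction is magnified up to that factor in offset, which is why grid cells have to be narrower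
  in direction when the box grows.\<close>

lemma slope_lipschitz:
  fixes g :: "real ^ 'd::finite"
  assumes y: "0 \<le> y" "y \<le> 1" "0 \<le> y'" "y' \<le> 1" and g: "\<And>i. \<bar>g $ i\<bar> \<le> N"
  shows "\<bar>slope g y - slope g y'\<bar> \<le> N * (\<Sum>i\<in>(UNIV :: 'd set). real (to_nat i)) * \<bar>y - y'\<bar>"
proof -
  have N: "0 \<le> N" using g[of undefined] by linarith
  have "\<bar>slope g y - slope g y'\<bar> = \<bar>\<Sum>i\<in>(UNIV :: 'd set). g $ i * (y ^ to_nat i - y' ^ to_nat i)\<bar>"
    by (simp add: slope_def sum_subtractf right_diff_distrib)
  also have "\<dots> \<le> (\<Sum>i\<in>(UNIV :: 'd set). \<bar>g $ i * (y ^ to_nat i - y' ^ to_nat i)\<bar>)" by (rule sum_abs)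
  also have "\<dots> \<le> (\<Sum>i\<in>(UNIV :: 'd set). N * (real (to_nat i) * \<bar>y - y'\<bar>))"
  proof (intro sum_mono)
    fix i :: 'd
    have "\<bar>y ^ to_nat i - y' ^ to_nat i\<bar> \<le> real (to_nat i) * \<bar>y - y'\<bar>"
      using norm_power_diff[of y y' "to_nat i"] y by simp
    then show "\<bar>g $ i * (y ^ to_nat i - y' ^ to_nat i)\<bar> \<le> N * (real (to_nat i) * \<bar>y - y'\<bar>)"
      unfolding abs_mult using g[of i] N by (intro mult_mono) auto
  qed
  finally show ?thesis by (simp add: sum_distrib_left sum_distrib_right mult_ac)
qed

text \<open>The exponents \<open>to_nat i\<close> are distinct, though not necessarily 0, ..., d -
  1; hence every coordinate of \<open>g\<close> is a coefficient of the polynomial and nothing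
  cancels.\<close>

lemma finite_slope_roots:
  assumes "g \<noteq> 0" shows "finite {y. slope g y = 0}"
proof -
  define p where "p = (\<Sum>i\<in>UNIV. monom (g $ i) (to_nat i))"
  obtain j where j: "g $ j \<noteq> 0" using assms by (auto simp: vec_eq_iff)
  have "coeff p (to_nat j) = (\<Sum>i\<in>UNIV. if i = j then g $ i else 0)"
    unfolding p_def coeff_sum by (intro sum.cong) auto
  also have "\<dots> = g $ j" by simp
  finally have "p \<noteq> 0" using j by auto
  moreover have "poly p y = slope g y" for y
    by (simp add: p_def slope_def poly_sum poly_monom)
  ultimately show ?thesis using poly_roots_finite[of p] by simp
qed

lemma AE_slope: 
  assumes "g \<noteq> 0" shows "AE y in unit_uniform. slope g y \<noteq> 0"
proof -
  have "AE y in lborel. slope g y \<noteq> 0"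
    using finite_imp_null_set_lborel[OF finite_slope_roots[OF assms]]
    by (auto dest!: AE_not_in elim: eventually_mono)
  then show ?thesis unfolding unit_uniform_def by (intro AE_uniform_measureI) auto
qed

definition translate :: "real ^ 'd::finite \<Rightarrow> real \<Rightarrow> real" where
  "translate g = drift (slope g)"

lemma measurable_translate [measurable]: "translate g \<in> borel_measurable borel"
  unfolding translate_def by measurable

lemma measurable_translate_line: "translate g \<in> measurable line_measure line_measure"
  using measurable_translate by (simp add: measurable_cong_sets[OF sets_line_measure sets_line_measure])

lemma distr_translate: "distr line_measure line_measure (translate g) = line_measure"
  unfolding translate_def by (rule distr_drift) simp

lemma translate_add: "translate (g + h) x = translate g (translate h x)"
  by (simp add: translate_def drift_drift slope_add[abs_def])

lemma translate_0 [simp]: "translate 0 x = x"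
  by (simp add: translate_def)

lemma translate_line [simp]: "translate g (line y t) = line y (t + slope g y)"
  by (simp add: translate_def)

lemma emeasure_translate_vimage:
  "A \<in> sets borel \<Longrightarrow> emeasure line_measure (translate g -` A) = emeasure line_measure A"
  unfolding translate_def by (rule emeasure_drift_vimage) simp_all

lemma translate_vimage_sets [measurable]: "A \<in> sets borel \<Longrightarrow> translate g -` A \<in> sets borel"
  unfolding translate_def by (rule drift_vimage_sets) simp_all

lemma emeasure_sym_diff_triangle:
  assumes "A \<in> sets M" "B \<in> sets M" "C \<in> sets M"
  shows "emeasure M (sym_diff A C) \<le> emeasure M (sym_diff A B) + emeasure M (sym_diff B C)"
proof -
  have "emeasure M (sym_diff A C) \<le> emeasure M (sym_diff A B \<union> sym_diff B C)"
    using assms by (intro emeasure_mono) auto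
  also have "\<dots> \<le> emeasure M (sym_diff A B) + emeasure M (sym_diff B C)"
    using assms by (intro emeasure_subadditive) auto
  finally show ?thesis .
qed

lemma emeasure_sym_diff_binop:
  assumes "A \<in> sets M" "B \<in> sets M" "A' \<in> sets M" "B' \<in> sets M"
  shows "emeasure M (sym_diff (A \<union> B) (A' \<union> B')) \<le> emeasure M (sym_diff A A') + emeasure M (sym_diff B B')"
    and "emeasure M (sym_diff (A - B) (A' - B')) \<le> emeasure M (sym_diff A A') + emeasure M (sym_diff B B')"
proof -
  have sub: "emeasure M (sym_diff A A' \<union> sym_diff B B') \<le> emeasure M (sym_diff A A') + emeasure M (sym_diff B B')"
    using assms by (intro emeasure_subadditive) auto
  show "emeasure M (sym_diff (A \<union> B) (A' \<union> B')) \<le> emeasure M (sym_diff A A') + emeasure M (sym_diff B B')"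
    by (rule order.trans[OF emeasure_mono sub]) (use assms in auto)
  show "emeasure M (sym_diff (A - B) (A' - B')) \<le> emeasure M (sym_diff A A') + emeasure M (sym_diff B B')"
    by (rule order.trans[OF emeasure_mono sub]) (use assms in auto)
qed

lemma emeasure_sym_diff_translate:
  assumes "A \<in> sets borel" "B \<in> sets borel"
  shows "emeasure line_measure (sym_diff (translate g -` A) (translate g -` B)) = emeasure line_measure (sym_diff A B)"
proof -
  have "sym_diff (translate g -` A) (translate g -` B) = translate g -` sym_diff A B" by auto
  then show ?thesis using assms emeasure_translate_vimage[of "sym_diff A B" g] by simp
qed

text \<open>A three epsilon argument: \<open>f\<close> preserves the distance of sets, so replacing
  \<open>A\<close> by a good approximation \<open>B\<close> costs the same small error at
  \<open>g\<close> and at \<open>h\<close>. It is used for the base and again for the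
  suspension.\<close>

lemma tendsto_sym_diff_limit:
  fixes f :: "'g::topological_space \<Rightarrow> 'x set \<Rightarrow> 'x set"
  assumes A: "A \<in> sets N" and f: "\<And>g X. X \<in> sets N \<Longrightarrow> f g X \<in> sets N"
    and inv: "\<And>g X Y. X \<in> sets N \<Longrightarrow> Y \<in> sets N \<Longrightarrow> emeasure N (sym_diff (f g X) (f g Y)) = emeasure N (sym_diff X Y)"
    and approx: "\<And>e::real. 0 < e \<Longrightarrow> \<exists>B\<in>sets N. ((\<lambda>g. emeasure N (sym_diff (f g B) (f h B))) \<longlongrightarrow> 0) (at h) \<and>
      emeasure N (sym_diff A B) < ennreal e"
  shows "((\<lambda>g. emeasure N (sym_diff (f g A) (f h A))) \<longlongrightarrow> 0) (at h)"
proof (rule order_tendstoI)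
  fix e :: ennreal assume "0 < e"
  then obtain r where r: "0 < r" "ennreal r < e"
  proof (cases e)
    case (real b)
    then show ?thesis using \<open>0 < e\<close> that[of "b / 2"] by (auto simp: ennreal_less_iff)
  qed (auto intro: that[of 1])
  obtain B where B: "B \<in> sets N" "((\<lambda>g. emeasure N (sym_diff (f g B) (f h B))) \<longlongrightarrow> 0) (at h)"
    "emeasure N (sym_diff A B) < ennreal (r / 3)"
    using approx[of "r / 3"] r(1) by auto
  have "eventually (\<lambda>g. emeasure N (sym_diff (f g B) (f h B)) < ennreal (r / 3)) (at h)"
    using order_tendstoD(2)[OF B(2)] r(1) by simp
  then show "eventually (\<lambda>g. emeasure N (sym_diff (f g A) (f h A)) < e) (at h)"
  proof eventually_elim
    case (elim g)
    have AB: "emeasure N (sym_diff (f g' A) (f g' B)) < ennreal (r / 3)" for g'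
      using A B by (simp add: inv)
    have "emeasure N (sym_diff (f g A) (f h A)) \<le> emeasure N (sym_diff (f g A) (f g B)) + emeasure N (sym_diff (f g B) (f h A))"
      using A B(1) f by (intro emeasure_sym_diff_triangle) auto
    also have "\<dots> \<le> emeasure N (sym_diff (f g A) (f g B)) +
        (emeasure N (sym_diff (f g B) (f h B)) + emeasure N (sym_diff (f h B) (f h A)))"
      using A B(1) f by (intro add_left_mono emeasure_sym_diff_triangle) auto
    also have "\<dots> \<le> ennreal (r / 3) + (ennreal (r / 3) + ennreal (r / 3))"
      using AB[of g] AB[of h] elim by (intro add_mono) (auto simp: Un_commute)
    also have "\<dots> = ennreal r" using r(1) by (simp add: ennreal_plus[symmetric] del: ennreal_plus)
    finally show ?case using r(2) by simp
  qed
qed simp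

text \<open>On one fibre the two preimages are the same interval shifted by two amounts, so they
  differ only near its end points; the condition on the direction is unaffected by
  translations.\<close>

lemma half_strip_shift:
  assumes y: "0 \<le> y" "y \<le> 1"
  shows "emeasure lborel {t. line y t \<in> sym_diff (translate g -` half_strip b s s') (translate h -` half_strip b s s')}
    \<le> ennreal (2 * (\<Sum>i\<in>UNIV. \<bar>g $ i - h $ i\<bar>))"
proof -
  define a a' where "a = slope g y" and "a' = slope h y"
  have aa: "\<bar>a - a'\<bar> \<le> (\<Sum>i\<in>UNIV. \<bar>g $ i - h $ i\<bar>)"
    using abs_slope_le[OF y, of "g - h"] by (simp add: a_def a'_def slope_diff)
  have "{t. line y t \<in> sym_diff (translate g -` half_strip b s s') (translate h -` half_strip b s s')}
     \<subseteq> {s - max a a'..s - min a a'} \<union> {s' - max a a'..s' - min a a'}"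
    by (auto simp: half_strip_def a_def[symmetric] a'_def[symmetric] max_def min_def)
  then have "emeasure lborel {t. line y t \<in> sym_diff (translate g -` half_strip b s s') (translate h -` half_strip b s s')}
      \<le> emeasure lborel ({s - max a a'..s - min a a'} \<union> {s' - max a a'..s' - min a a'})"
    by (intro emeasure_mono) auto
  also have "\<dots> \<le> emeasure lborel {s - max a a'..s - min a a'} + emeasure lborel {s' - max a a'..s' - min a a'}"
    by (intro emeasure_subadditive) auto
  also have "\<dots> = ennreal (2 * \<bar>a - a'\<bar>)"
    by (auto simp: max_def min_def ennreal_plus[symmetric] simp del: ennreal_plus)
  also have "\<dots> \<le> ennreal (2 * (\<Sum>i\<in>UNIV. \<bar>g $ i - h $ i\<bar>))" using aa by (intro ennreal_leI) simp
  finally show ?thesis .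
qed

lemma translate_continuous:
  fixes h :: "real ^ 'd::finite"
  assumes "C \<in> sets borel" "emeasure line_measure C < \<infinity>"
  shows "((\<lambda>g. emeasure line_measure (sym_diff (translate g -` C) (translate h -` C))) \<longlongrightarrow> 0) (at h)"
  using assms
proof (induction C rule: line_measure_induct)
  case (half_strip b s s')
  have m: "sym_diff (translate g -` half_strip b s s') (translate h -` half_strip b s s') \<in> sets borel" for g :: "real ^ 'd"
    by (intro sets.Un sets.Diff translate_vimage_sets half_strip_sets)
  have "((\<lambda>g. ennreal (2 * (\<Sum>i\<in>UNIV. \<bar>g $ i - h $ i\<bar>))) \<longlongrightarrow> ennreal (2 * (\<Sum>i\<in>(UNIV :: 'd set). \<bar>h $ i - h $ i\<bar>))) (at h)"
    by (intro tendsto_intros)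
  then have lim: "((\<lambda>g. ennreal (2 * (\<Sum>i\<in>UNIV. \<bar>g $ i - h $ i\<bar>))) \<longlongrightarrow> 0) (at h)" by simp
  show ?case
  proof (rule tendsto_sandwich[OF _ _ tendsto_const lim])
    show "\<forall>\<^sub>F g in at h. emeasure line_measure (sym_diff (translate g -` half_strip b s s') (translate h -` half_strip b s s'))
        \<le> ennreal (2 * (\<Sum>i\<in>UNIV. \<bar>g $ i - h $ i\<bar>))"
      by (intro always_eventually allI emeasure_line_measure_le m half_strip_shift) (auto intro!: sum_nonneg)
  qed simp
next
  case (union A B)
  have "((\<lambda>g. emeasure line_measure (sym_diff (translate g -` A) (translate h -` A)) +
      emeasure line_measure (sym_diff (translate g -` B) (translate h -` B))) \<longlongrightarrow> 0 + 0) (at h)"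
    using union by (intro tendsto_add) auto
  then have lim: "((\<lambda>g. emeasure line_measure (sym_diff (translate g -` A) (translate h -` A)) +
      emeasure line_measure (sym_diff (translate g -` B) (translate h -` B))) \<longlongrightarrow> 0) (at h)" by simp
  show ?case
    by (rule tendsto_sandwich[OF _ _ tendsto_const lim])
      (use union emeasure_sym_diff_binop(1)[of _ line_measure] in \<open>auto simp: vimage_Un intro!: always_eventually\<close>)
next
  case (diff A B)
  have "((\<lambda>g. emeasure line_measure (sym_diff (translate g -` A) (translate h -` A)) +
      emeasure line_measure (sym_diff (translate g -` B) (translate h -` B))) \<longlongrightarrow> 0 + 0) (at h)"
    using diff by (intro tendsto_add) auto
  then have lim: "((\<lambda>g. emeasure line_measure (sym_diff (translate g -` A) (translate h -` A)) +
      emeasure line_measure (sym_diff (translate g -` B) (translate h -` B))) \<longlongrightarrow> 0) (at h)" by simp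
  show ?case
    by (rule tendsto_sandwich[OF _ _ tendsto_const lim])
      (use diff emeasure_sym_diff_binop(2)[of _ line_measure] in \<open>auto simp: vimage_Diff intro!: always_eventually\<close>)
next
  case (limit A)
  show ?case
    by (rule tendsto_sym_diff_limit[where f = "\<lambda>g X. translate g -` X"])
      (use limit emeasure_sym_diff_translate in auto)
qed

section \<open>Approximation by grid cells\<close>

text \<open>Cells have width 1/(K n) in direction and 1/K in offset. The slope of a vector with
  entries up to n is Lipschitz with constant O(n), so both roundings cost O(1/K) in the offset after
  translation.\<close>

definition cell :: "nat \<Rightarrow> nat \<Rightarrow> int \<times> int \<Rightarrow> real set" where
  "cell K n j = {x. \<lfloor>real K * real n * direction x\<rfloor> = fst j \<and> \<lfloor>real K * offset x\<rfloor> = snd j}"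

text \<open>Direction 1 needs the extra index \<open>K * n\<close>. Offsets up to
  \<open>K * n\<close> in absolute value leave room for a bounded set moved by vectors of size O(n),
  once \<open>K\<close> is large.\<close>

definition grid :: "nat \<Rightarrow> nat \<Rightarrow> (int \<times> int) set" where
  "grid K n = {0..int (K * n)} \<times> {- int (K * K * n)..<int (K * K * n)}"

lemma cell_sets [measurable]: "cell K n j \<in> sets borel"
  unfolding cell_def by measurable

lemma cell_disjoint: "j \<noteq> j' \<Longrightarrow> cell K n j \<inter> cell K n j' = {}"
  by (auto simp: cell_def prod_eq_iff)

lemma finite_grid [simp]: "finite (grid K n)"
  by (simp add: grid_def)

lemma card_grid: "1 \<le> K \<Longrightarrow> 1 \<le> n \<Longrightarrow> card (grid K n) \<le> 4 * K ^ 3 * n ^ 2"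
proof -
  assume K: "1 \<le> K" "1 \<le> n"
  have "card (grid K n) = (K * n + 1) * (2 * K * K * n)"
    by (simp add: grid_def card_cartesian_product nat_add_distrib nat_mult_distrib flip: of_nat_mult)
  also have "\<dots> \<le> (K * n + K * n) * (2 * K * K * n)" using K by (intro mult_right_mono add_left_mono) auto
  also have "\<dots> = 4 * K ^ 3 * n ^ 2" by (simp add: power2_eq_square power3_eq_cube algebra_simps)
  finally show ?thesis .
qed

lemma emeasure_unit_uniform_le:
  assumes "B \<in> sets borel" shows "emeasure unit_uniform B \<le> emeasure lborel B"
proof -
  have "emeasure unit_uniform B = emeasure lborel ({0..1} \<inter> B)"
    unfolding unit_uniform_def using assms by (subst emeasure_uniform_measure) (auto simp: divide_ennreal_def)
  also have "\<dots> \<le> emeasure lborel B" using assms by (intro emeasure_mono) auto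
  finally show ?thesis .
qed

lemma emeasure_line_rectangle_le:
  assumes A: "A \<in> sets borel" and Y: "Y \<in> sets borel" and b: "0 \<le> b" "0 \<le> c"
    and sub: "\<And>y. y \<notin> Y \<Longrightarrow> {t. line y t \<in> A} = {}"
    and le: "\<And>y. emeasure lborel {t. line y t \<in> A} \<le> ennreal b"
    and Yc: "emeasure lborel Y \<le> ennreal c"
  shows "emeasure line_measure A \<le> ennreal (b * c)"
proof -
  have "emeasure line_measure A \<le> (\<integral>\<^sup>+y. ennreal b * indicator Y y \<partial>unit_uniform)"
    unfolding emeasure_line_measure[OF A]
    by (intro nn_integral_mono) (use sub le in \<open>auto simp: indicator_def\<close>)
  also have "\<dots> = ennreal b * emeasure unit_uniform Y" using Y by (simp add: nn_integral_cmult_indicator)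
  also have "\<dots> \<le> ennreal b * ennreal c"
    using order.trans[OF emeasure_unit_uniform_le[OF Y] Yc] by (intro mult_left_mono) auto
  finally show ?thesis using b by (simp add: ennreal_mult)
qed

lemma vimage_floor_mult:
  assumes "0 < r" shows "{t::real. \<lfloor>r * t\<rfloor> = k} = {of_int k / r..<(of_int k + 1) / r}"
  using assms by (auto simp: floor_eq_iff field_simps)

lemma emeasure_vimage_floor_mult:
  assumes "0 < r" shows "emeasure lborel {t::real. \<lfloor>r * t\<rfloor> = k} = ennreal (1 / r)"
  using assms by (simp add: vimage_floor_mult divide_right_mono flip: diff_divide_distrib)

lemma emeasure_cell_le:
  assumes "1 \<le> K" "1 \<le> n"
  shows "emeasure line_measure (cell K n j) \<le> ennreal (1 / real K * (1 / (real K * real n)))"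
proof (rule emeasure_line_rectangle_le)
  let ?Y = "{y. \<lfloor>real K * real n * y\<rfloor> = fst j}"
  show "?Y \<in> sets borel" using assms by (subst vimage_floor_mult) auto
  show "emeasure lborel ?Y \<le> ennreal (1 / (real K * real n))"
    using assms by (subst emeasure_vimage_floor_mult) auto
  show "{t. line y t \<in> cell K n j} = {}" if "y \<notin> ?Y" for y using that by (auto simp: cell_def)
  have "emeasure lborel {t. line y t \<in> cell K n j} \<le> emeasure lborel {t. \<lfloor>real K * t\<rfloor> = snd j}" for y
  proof (rule emeasure_mono)
    show "{t. \<lfloor>real K * t\<rfloor> = snd j} \<in> sets lborel" using assms by (subst vimage_floor_mult) auto
  qed (auto simp: cell_def)
  then show "emeasure lborel {t. line y t \<in> cell K n j} \<le> ennreal (1 / real K)" for y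
    using assms by (simp add: emeasure_vimage_floor_mult)
qed auto

text \<open>The resolution \<open>K0\<close> depends on \<open>e\<close>, but neither on
  \<open>n\<close> nor on \<open>g\<close>: one family of cells has to serve all lattice points of a
  box, with a resolution common to all boxes. The type argument fixes the dimension, which
  \<open>C\<close> does not mention.\<close>

definition grid_approx :: "'d::finite itself \<Rightarrow> real set \<Rightarrow> bool" where
  "grid_approx _ C \<longleftrightarrow> (\<forall>e::real. 0 < e \<longrightarrow> (\<exists>K0. \<forall>K n. \<forall>g :: real ^ 'd. K0 \<le> K \<longrightarrow> 1 \<le> n \<longrightarrow>
     (\<forall>i. 0 \<le> g $ i \<and> g $ i \<le> real n) \<longrightarrow>
     (\<exists>J\<subseteq>grid K n. emeasure line_measure (sym_diff (translate g -` C) (\<Union>j\<in>J. cell K n j)) < ennreal e)))"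

lemma cell_Union_sets: "J \<subseteq> grid K n \<Longrightarrow> (\<Union>j\<in>J. cell K n j) \<in> sets borel"
  by (rule sets.finite_UN[OF finite_subset[OF _ finite_grid] cell_sets])

text \<open>A cell is kept if its corner, moved by \<open>g\<close>, falls into the half-strip. A
  point and the corner of its cell can then disagree only near the edge \<open>b\<close> in
  direction or near the edges \<open>s\<close> and \<open>s'\<close> in offset, a region of mass
  O(1/K).\<close>

lemma grid_approx_half_strip:
  "grid_approx TYPE('d::finite) (half_strip b s s')"
  unfolding grid_approx_def
proof (intro allI impI)
  fix e :: real assume e: "0 < e"
  define D where "D = real CARD('d)"
  define E where "E = (\<Sum>i\<in>(UNIV :: 'd set). real (to_nat i))"
  define S where "S = max \<bar>s\<bar> \<bar>s'\<bar>"
  \<comment> \<open>This is \<open>K\<close> times the mass of the doubtful region: the edge in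
    direction has length 2(S + 1 + E) and width 1/K, and each of the two edges in offset has
    thickness 2(1 + E)/K.\<close>
  define c where "c = 2 * (S + 1 + E) + 4 * (1 + E)"
  have E: "0 \<le> E" unfolding E_def by (intro sum_nonneg) auto
  have S: "0 \<le> S" unfolding S_def by simp
  have D: "0 \<le> D" by (simp add: D_def)
  \<comment> \<open>The first bound keeps the moved set inside the grid, the second makes
    \<open>c / K\<close> smaller than \<open>e\<close>.\<close>
  define K0 where "K0 = nat \<lceil>max (S + D + 1) (c / e + 1)\<rceil>"
  show "\<exists>K0. \<forall>K n. \<forall>g :: real ^ 'd. K0 \<le> K \<longrightarrow> 1 \<le> n \<longrightarrow> (\<forall>i. 0 \<le> g $ i \<and> g $ i \<le> real n) \<longrightarrow>
     (\<exists>J\<subseteq>grid K n. emeasure line_measure (sym_diff (translate g -` half_strip b s s') (\<Union>j\<in>J. cell K n j)) < ennreal e)"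
  proof (intro exI[of _ K0] allI impI)
    fix K n :: nat and g :: "real ^ 'd"
    assume K: "K0 \<le> K" and n: "1 \<le> n" and g: "\<forall>i. 0 \<le> g $ i \<and> g $ i \<le> real n"
    have "max (S + D + 1) (c / e + 1) \<le> real K" using K unfolding K0_def by linarith
    then have K1: "S + D + 1 \<le> real K" and K2: "c / e < real K" by auto
    have Kpos: "0 < real K" using K1 S D by linarith
    have npos: "1 \<le> real n" using n by simp
    have Kn: "0 < real K * real n" using Kpos npos by simp
    \<comment> \<open>1/K comes from rounding the offset, E/K from evaluating the slope at the
      rounded direction.\<close>
    define \<delta> where "\<delta> = (1 + E) / real K"
    have \<delta>0: "0 \<le> \<delta>" using E Kpos by (simp add: \<delta>_def)
    define \<Lambda>1 where "\<Lambda>1 = {x. b \<le> direction x \<and> direction x \<le> b + 1 / real K \<and> \<bar>offset x\<bar> \<le> S + 1 + E}"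
    define \<Lambda>2 where "\<Lambda>2 r = {x. \<bar>offset x - r\<bar> \<le> \<delta>}" for r
    have [measurable]: "\<Lambda>1 \<in> sets borel" "\<Lambda>2 r \<in> sets borel" for r
      unfolding \<Lambda>1_def \<Lambda>2_def by measurable
    define \<Lambda> where "\<Lambda> = \<Lambda>1 \<union> (\<Lambda>2 s \<union> \<Lambda>2 s')"
    have \<Lambda>: "\<Lambda> \<in> sets borel" unfolding \<Lambda>_def by measurable
    have \<Lambda>1: "emeasure line_measure \<Lambda>1 \<le> ennreal (2 * (S + 1 + E) * (1 / real K))"
    proof (rule emeasure_line_rectangle_le[where Y = "{b..b + 1 / real K}"])
      show "emeasure lborel {t. line y t \<in> \<Lambda>1} \<le> ennreal (2 * (S + 1 + E))" for y
      proof -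
        have "{t. line y t \<in> \<Lambda>1} \<subseteq> {- (S + 1 + E)..S + 1 + E}" by (auto simp: \<Lambda>1_def)
        then have "emeasure lborel {t. line y t \<in> \<Lambda>1} \<le> emeasure lborel {- (S + 1 + E)..S + 1 + E}"
          by (intro emeasure_mono) auto
        also have "\<dots> = ennreal (2 * (S + 1 + E))" using S E by (subst emeasure_lborel_Icc) (auto simp: algebra_simps)
        finally show ?thesis .
      qed
    qed (use S E Kpos in \<open>auto simp: \<Lambda>1_def\<close>)
    have \<Lambda>2: "emeasure line_measure (\<Lambda>2 r) \<le> ennreal (2 * \<delta>)" for r
    proof (rule emeasure_line_measure_le)
      fix y
      have "{t. line y t \<in> \<Lambda>2 r} = {r - \<delta>..r + \<delta>}" by (auto simp: \<Lambda>2_def)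
      then show "emeasure lborel {t. line y t \<in> \<Lambda>2 r} \<le> ennreal (2 * \<delta>)" using E Kpos by (simp add: \<delta>_def)
    qed (use E Kpos in \<open>auto simp: \<delta>_def\<close>)
    have "emeasure line_measure \<Lambda> \<le> emeasure line_measure \<Lambda>1 + (emeasure line_measure (\<Lambda>2 s) + emeasure line_measure (\<Lambda>2 s'))"
      unfolding \<Lambda>_def by (intro order.trans[OF emeasure_subadditive] add_left_mono emeasure_subadditive) auto
    also have "\<dots> \<le> ennreal (2 * (S + 1 + E) * (1 / real K)) + (ennreal (2 * \<delta>) + ennreal (2 * \<delta>))"
      by (intro add_mono \<Lambda>1 \<Lambda>2)
    also have "\<dots> = ennreal (2 * (S + 1 + E) * (1 / real K) + (2 * \<delta> + 2 * \<delta>))"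
    proof -
      have "0 \<le> 2 * (S + 1 + E) * (1 / real K)" "0 \<le> 2 * \<delta>" "0 \<le> 2 * \<delta> + 2 * \<delta>" using S E Kpos \<delta>0 by auto
      then show ?thesis by (simp only: ennreal_plus)
    qed
    also have "2 * (S + 1 + E) * (1 / real K) + (2 * \<delta> + 2 * \<delta>) = c / real K"
      by (simp add: \<delta>_def c_def add_divide_distrib[symmetric])
    also have "ennreal (c / real K) < ennreal e"
      using K2 e Kpos by (intro ennreal_lessI) (auto simp: field_simps)
    finally have small: "emeasure line_measure \<Lambda> < ennreal e" .
    define J where "J = {j \<in> grid K n. of_int (fst j) / (real K * real n) < b \<and>
       s \<le> of_int (snd j) / real K + slope g (of_int (fst j) / (real K * real n)) \<and>
       of_int (snd j) / real K + slope g (of_int (fst j) / (real K * real n)) < s'}"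
    have J: "J \<subseteq> grid K n" by (auto simp: J_def)
    have "AE x in line_measure. x \<in> sym_diff (translate g -` half_strip b s s') (\<Union>j\<in>J. cell K n j) \<longrightarrow> x \<in> translate g -` \<Lambda>"
      using AE_is_line AE_direction
    proof eventually_elim
      case (elim x)
      define y t where "y = direction x" and "t = offset x"
      define a \<beta> where "a = \<lfloor>real K * real n * y\<rfloor>" and "\<beta> = \<lfloor>real K * t\<rfloor>"
      define y' t' where "y' = of_int a / (real K * real n)" and "t' = of_int \<beta> / real K"
      define u v where "u = t + slope g y" and "v = t' + slope g y'"
      have y: "0 \<le> y" "y \<le> 1" using elim by (auto simp: y_def)
      have T: "direction (translate g x) = y" "offset (translate g x) = u"
        using elim by (auto simp: translate_def y_def t_def u_def offset_drift)
      have a: "0 \<le> a" "of_int a \<le> real K * real n * y" "real K * real n * y < of_int a + 1"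
        using y Kn by (auto simp: a_def)
      have y': "0 \<le> y'" "y' \<le> y" "y \<le> y' + 1 / (real K * real n)"
      proof -
        have "of_int a \<le> y * (real K * real n)" "y * (real K * real n) \<le> of_int a + 1" using a by (simp_all add: mult.commute)
        then have "of_int a / (real K * real n) \<le> y" "y \<le> (of_int a + 1) / (real K * real n)"
          using Kn by (simp_all only: pos_divide_le_eq pos_le_divide_eq)
        then show "0 \<le> y'" "y' \<le> y" "y \<le> y' + 1 / (real K * real n)"
          using a(1) Kn by (simp_all add: y'_def add_divide_distrib)
      qed
      have "1 / (real K * real n) \<le> 1 / real K" using Kpos npos by (simp add: field_simps)
      then have yK: "y \<le> y' + 1 / real K" using y'(3) by linarith
      have t': "t' \<le> t" "t \<le> t' + 1 / real K"
      proof -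
        have "of_int \<beta> \<le> t * real K" "t * real K \<le> of_int \<beta> + 1"
          using of_int_floor_le[of "real K * t"] real_of_int_floor_add_one_ge[of "real K * t"] by (simp_all add: \<beta>_def mult.commute)
        then have "of_int \<beta> / real K \<le> t" "t \<le> (of_int \<beta> + 1) / real K"
          using Kpos by (simp_all only: pos_divide_le_eq pos_le_divide_eq)
        then show "t' \<le> t" "t \<le> t' + 1 / real K" by (simp_all add: t'_def add_divide_distrib)
      qed
      have "\<bar>slope g y - slope g y'\<bar> \<le> real n * E * \<bar>y - y'\<bar>"
        unfolding E_def using y y' g by (intro slope_lipschitz) (auto simp: abs_le_iff intro: order.trans)
      also have "\<dots> \<le> real n * E * (1 / (real K * real n))"
        using y' E npos by (intro mult_left_mono) auto
      also have "\<dots> = E / real K" using npos by simp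
      finally have "\<bar>u - v\<bar> \<le> 1 / real K + E / real K"
        using t' unfolding u_def v_def by linarith
      then have uv: "\<bar>u - v\<bar> \<le> \<delta>" by (simp add: \<delta>_def add_divide_distrib)
      have inJ: "x \<in> (\<Union>j\<in>J. cell K n j) \<longleftrightarrow> (a, \<beta>) \<in> grid K n \<and> y' < b \<and> s \<le> v \<and> v < s'"
        by (auto simp: J_def cell_def a_def \<beta>_def y'_def t'_def v_def y_def t_def)
      have inH: "x \<in> translate g -` half_strip b s s' \<longleftrightarrow> y < b \<and> s \<le> u \<and> u < s'"
        by (simp add: half_strip_def T)
      show ?case
      proof (rule impI, rule ccontr)
        assume sd: "x \<in> sym_diff (translate g -` half_strip b s s') (\<Union>j\<in>J. cell K n j)"
          and "x \<notin> translate g -` \<Lambda>"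
        then have nL: "\<not> (b \<le> y \<and> y \<le> b + 1 / real K \<and> \<bar>u\<bar> \<le> S + 1 + E)" "\<delta> < \<bar>u - s\<bar>" "\<delta> < \<bar>u - s'\<bar>"
          by (auto simp: \<Lambda>_def \<Lambda>1_def \<Lambda>2_def T)
        \<comment> \<open>At a distance of more than \<open>\<delta>\<close> from \<open>s\<close>
          and \<open>s'\<close>, the true position \<open>u\<close> and the rounded position
          \<open>v\<close> lie on the same side of both.\<close>
        have eq: "s \<le> u \<longleftrightarrow> s \<le> v" "u < s' \<longleftrightarrow> v < s'" using uv nL by linarith+
        have uS: "\<bar>u\<bar> \<le> S" if "s \<le> u" "u < s'" using that unfolding S_def by linarith
        consider "x \<in> translate g -` half_strip b s s'" "x \<notin> (\<Union>j\<in>J. cell K n j)"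
          | "x \<notin> translate g -` half_strip b s s'" "x \<in> (\<Union>j\<in>J. cell K n j)" using sd by blast
        then show False
        proof cases
          \<comment> \<open>The corner satisfies all three inequalities, so the cell could only be
            missing by lying outside the grid, which the size of \<open>K\<close> excludes.\<close>
          case 1
          then have h: "y < b" "s \<le> u" "u < s'" using inH by auto
          have "\<bar>slope g y\<bar> \<le> (\<Sum>i\<in>UNIV. \<bar>g $ i\<bar>)" by (rule abs_slope_le[OF y])
          also have "\<dots> \<le> (\<Sum>i\<in>(UNIV :: 'd set). real n)" using g by (intro sum_mono) auto
          also have "\<dots> = real n * D" by (simp add: D_def)
          finally have "\<bar>t\<bar> \<le> S + real n * D" using uS[OF h(2,3)] unfolding u_def by linarith
          moreover have "S + real n * D < real K * real n"
          proof -
            have "S \<le> S * real n" using S npos by (simp add: mult_le_cancel_left1)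
            then have "S + real n * D < (S + D + 1) * real n" using npos by (simp add: algebra_simps)
            also have "\<dots> \<le> real K * real n" using K1 by (intro mult_right_mono) auto
            finally show ?thesis .
          qed
          ultimately have tb: "- (real K * real n) < t" "t < real K * real n" by auto
          have "real K * (- (real K * real n)) < real K * t" "real K * t < real K * (real K * real n)"
            using tb Kpos by (simp_all only: mult_less_cancel_left_pos)
          then have "- int (K * K * n) \<le> \<beta>" "\<beta> < int (K * K * n)"
            unfolding \<beta>_def by (simp_all add: le_floor_iff floor_less_iff mult_ac)
          moreover have "a \<le> int (K * n)"
          proof -
            have "real K * real n * y \<le> real K * real n" using y Kn by (intro mult_left_le) auto
            then have "real_of_int a \<le> real K * real n" using a by linarith
            then have "real_of_int a \<le> real_of_int (int (K * n))" by simp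
            then show ?thesis by (simp only: of_int_le_iff)
          qed
          ultimately have "(a, \<beta>) \<in> grid K n" using a by (simp add: grid_def)
          then have "x \<in> (\<Union>j\<in>J. cell K n j)" using inJ h y' eq by auto
          then show False using 1 by simp
        next
          \<comment> \<open>The corner lies below the edge \<open>b\<close> while the point does
            not, which puts the point into the doubtful region at that edge.\<close>
          case 2
          then have h: "y' < b" "s \<le> u" "u < s'" using inJ eq by auto
          then have "b \<le> y" using 2 inH by auto
          moreover have "y \<le> b + 1 / real K" using yK h by linarith
          moreover have "\<bar>u\<bar> \<le> S + 1 + E" using uS[OF h(2,3)] E by linarith
          ultimately show False using nL by blast
        qed
      qed
    qed
    then have "emeasure line_measure (sym_diff (translate g -` half_strip b s s') (\<Union>j\<in>J. cell K n j)) \<le> emeasure line_measure (translate g -` \<Lambda>)"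
      using \<Lambda> by (intro emeasure_mono_AE) auto
    also have "\<dots> = emeasure line_measure \<Lambda>" by (rule emeasure_translate_vimage[OF \<Lambda>])
    also note small
    finally show "\<exists>J\<subseteq>grid K n. emeasure line_measure (sym_diff (translate g -` half_strip b s s') (\<Union>j\<in>J. cell K n j)) < ennreal e"
      using J by blast
  qed
qed

text \<open>Union and difference are treated at once: both commute with preimages and with unions of
  cells, and both at most add up symmetric differences, so each argument may use half of the
  error.\<close>

lemma grid_approx_binop:
  fixes op :: "real set \<Rightarrow> real set \<Rightarrow> real set" and opJ :: "(int \<times> int) set \<Rightarrow> (int \<times> int) set \<Rightarrow> (int \<times> int) set"
  assumes A: "A \<in> sets borel" "B \<in> sets borel" and Q: "grid_approx TYPE('d::finite) A" "grid_approx TYPE('d) B"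
    and op: "\<And>A B A' B'. A \<in> sets line_measure \<Longrightarrow> B \<in> sets line_measure \<Longrightarrow> A' \<in> sets line_measure \<Longrightarrow> B' \<in> sets line_measure \<Longrightarrow>
       emeasure line_measure (sym_diff (op A B) (op A' B')) \<le> emeasure line_measure (sym_diff A A') + emeasure line_measure (sym_diff B B')"
    and vim: "\<And>g :: real ^ 'd. translate g -` op A B = op (translate g -` A) (translate g -` B)"
    and opJ: "\<And>J J'. opJ J J' \<subseteq> J \<union> J'" "\<And>J J' K n. (\<Union>j\<in>opJ J J'. cell K n j) = op (\<Union>j\<in>J. cell K n j) (\<Union>j\<in>J'. cell K n j)"
  shows "grid_approx TYPE('d) (op A B)"
  unfolding grid_approx_def
proof (intro allI impI)
  fix e :: real assume "0 < e"
  then have e: "0 < e / 2" by simp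
  obtain K1 where K1: "\<And>K n. \<And>g :: real ^ 'd. K1 \<le> K \<Longrightarrow> 1 \<le> n \<Longrightarrow> \<forall>i. 0 \<le> g $ i \<and> g $ i \<le> real n \<Longrightarrow>
     \<exists>J\<subseteq>grid K n. emeasure line_measure (sym_diff (translate g -` A) (\<Union>j\<in>J. cell K n j)) < ennreal (e / 2)"
    using Q(1) e unfolding grid_approx_def by meson
  obtain K2 where K2: "\<And>K n. \<And>g :: real ^ 'd. K2 \<le> K \<Longrightarrow> 1 \<le> n \<Longrightarrow> \<forall>i. 0 \<le> g $ i \<and> g $ i \<le> real n \<Longrightarrow>
     \<exists>J\<subseteq>grid K n. emeasure line_measure (sym_diff (translate g -` B) (\<Union>j\<in>J. cell K n j)) < ennreal (e / 2)"
    using Q(2) e unfolding grid_approx_def by meson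
  show "\<exists>K0. \<forall>K n. \<forall>g :: real ^ 'd. K0 \<le> K \<longrightarrow> 1 \<le> n \<longrightarrow> (\<forall>i. 0 \<le> g $ i \<and> g $ i \<le> real n) \<longrightarrow>
     (\<exists>J\<subseteq>grid K n. emeasure line_measure (sym_diff (translate g -` op A B) (\<Union>j\<in>J. cell K n j)) < ennreal e)"
  proof (intro exI[of _ "max K1 K2"] allI impI)
    fix K n :: nat and g :: "real ^ 'd"
    assume *: "max K1 K2 \<le> K" "1 \<le> n" "\<forall>i. 0 \<le> g $ i \<and> g $ i \<le> real n"
    obtain J where J: "J \<subseteq> grid K n" "emeasure line_measure (sym_diff (translate g -` A) (\<Union>j\<in>J. cell K n j)) < ennreal (e / 2)"
      using K1[of K n g] * by auto
    obtain J' where J': "J' \<subseteq> grid K n" "emeasure line_measure (sym_diff (translate g -` B) (\<Union>j\<in>J'. cell K n j)) < ennreal (e / 2)"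
      using K2[of K n g] * by auto
    have "emeasure line_measure (sym_diff (translate g -` op A B) (\<Union>j\<in>opJ J J'. cell K n j)) \<le>
        emeasure line_measure (sym_diff (translate g -` A) (\<Union>j\<in>J. cell K n j)) + emeasure line_measure (sym_diff (translate g -` B) (\<Union>j\<in>J'. cell K n j))"
      unfolding vim opJ(2) using A cell_Union_sets[OF J(1)] cell_Union_sets[OF J'(1)] by (intro op) auto
    also have "\<dots> < ennreal (e / 2) + ennreal (e / 2)" by (rule add_strict_mono[OF J(2) J'(2)])
    also have "\<dots> = ennreal e" using e by (simp add: ennreal_plus[symmetric] del: ennreal_plus)
    finally show "\<exists>J\<subseteq>grid K n. emeasure line_measure (sym_diff (translate g -` op A B) (\<Union>j\<in>J. cell K n j)) < ennreal e"
      using J(1) J'(1) opJ(1)[of J J'] by (intro exI[of _ "opJ J J'"]) auto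
  qed
qed

lemma cell_Union_eq:
  "(\<Union>j\<in>J. cell K n j) = {x. (\<lfloor>real K * real n * direction x\<rfloor>, \<lfloor>real K * offset x\<rfloor>) \<in> J}"
  by (auto simp: cell_def)

lemma cell_Union_Diff: "(\<Union>j\<in>J - J'. cell K n j) = (\<Union>j\<in>J. cell K n j) - (\<Union>j\<in>J'. cell K n j)"
  unfolding cell_Union_eq by auto

lemma grid_approx_finite:
  assumes "C \<in> sets borel" "emeasure line_measure C < \<infinity>"
  shows "grid_approx TYPE('d::finite) C"
  using assms
proof (induction C rule: line_measure_induct)
  case (half_strip b s s')
  show ?case by (rule grid_approx_half_strip)
next
  case (union A B)
  show ?case
    by (rule grid_approx_binop[where op = "(\<union>)" and opJ = "(\<union>)", OF union emeasure_sym_diff_binop(1) vimage_Un order_refl UN_Un])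
next
  case (diff A B)
  show ?case
    by (rule grid_approx_binop[where op = "(-)" and opJ = "(-)", OF diff emeasure_sym_diff_binop(2) vimage_Diff le_supI1[OF Diff_subset] cell_Union_Diff])
next
  case (limit A)
  show ?case
    unfolding grid_approx_def
  proof (intro allI impI)
    fix e :: real assume "0 < e"
    then have e: "0 < e / 2" by simp
    obtain B where B: "B \<in> sets borel" "grid_approx TYPE('d) B" "emeasure line_measure (sym_diff A B) < ennreal (e / 2)"
      using limit(3)[OF e] by auto
    obtain K0 where K0: "\<And>K n. \<And>g :: real ^ 'd. K0 \<le> K \<Longrightarrow> 1 \<le> n \<Longrightarrow> \<forall>i. 0 \<le> g $ i \<and> g $ i \<le> real n \<Longrightarrow>
       \<exists>J\<subseteq>grid K n. emeasure line_measure (sym_diff (translate g -` B) (\<Union>j\<in>J. cell K n j)) < ennreal (e / 2)"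
      using B(2) e unfolding grid_approx_def by meson
    show "\<exists>K0. \<forall>K n. \<forall>g :: real ^ 'd. K0 \<le> K \<longrightarrow> 1 \<le> n \<longrightarrow> (\<forall>i. 0 \<le> g $ i \<and> g $ i \<le> real n) \<longrightarrow>
       (\<exists>J\<subseteq>grid K n. emeasure line_measure (sym_diff (translate g -` A) (\<Union>j\<in>J. cell K n j)) < ennreal e)"
    proof (intro exI[of _ K0] allI impI)
      fix K n :: nat and g :: "real ^ 'd"
      assume *: "K0 \<le> K" "1 \<le> n" "\<forall>i. 0 \<le> g $ i \<and> g $ i \<le> real n"
      obtain J where J: "J \<subseteq> grid K n" "emeasure line_measure (sym_diff (translate g -` B) (\<Union>j\<in>J. cell K n j)) < ennreal (e / 2)"
        using K0[OF *] by auto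
      have "emeasure line_measure (sym_diff (translate g -` A) (\<Union>j\<in>J. cell K n j)) \<le>
          emeasure line_measure (sym_diff (translate g -` A) (translate g -` B)) + emeasure line_measure (sym_diff (translate g -` B) (\<Union>j\<in>J. cell K n j))"
        using limit(1) B(1) cell_Union_sets[OF J(1)] by (intro emeasure_sym_diff_triangle) auto
      also have "\<dots> < ennreal (e / 2) + ennreal (e / 2)"
        using B J(2) limit(1) by (intro add_strict_mono) (auto simp: emeasure_sym_diff_translate)
      also have "\<dots> = ennreal e" using e by (simp add: ennreal_plus[symmetric] del: ennreal_plus)
      finally show "\<exists>J\<subseteq>grid K n. emeasure line_measure (sym_diff (translate g -` A) (\<Union>j\<in>J. cell K n j)) < ennreal e"
        using J(1) by blast
    qed
  qed
qed

section \<open>The Poisson suspension of the action by translations\<close>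

definition poisson_lines :: "real measure measure" where
  "poisson_lines = unit_pieces.sampled line_measure strip"

interpretation lines: poisson_law line_measure poisson_lines
proof (rule poisson_law.intro)
  show "laplace_poisson line_measure poisson_lines"
    unfolding poisson_lines_def by (rule unit_pieces.laplace_poisson_sampled[OF unit_pieces_strip])
qed (rule sigma_finite_line_measure)

definition translate_lines :: "real ^ 'd::finite \<Rightarrow> real measure \<Rightarrow> real measure" where
  "translate_lines g = suspend line_measure (translate g)"

lemma translate_lines_configuration:
  "\<omega> \<in> configurations line_measure \<Longrightarrow> translate_lines g \<omega> \<in> configurations line_measure"
  unfolding translate_lines_def by (rule suspend_configuration[OF measurable_translate_line])

lemma emeasure_translate_lines:
  assumes "\<omega> \<in> configurations line_measure" "A \<in> sets borel"
  shows "emeasure (translate_lines g \<omega>) A = emeasure \<omega> (translate g -` A)"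
  unfolding translate_lines_def using assms by (simp add: emeasure_suspend[OF measurable_translate_line])

lemma measurable_translate_lines [measurable]: "translate_lines g \<in> measurable poisson_lines poisson_lines"
  unfolding translate_lines_def
  using measurable_suspend[OF measurable_translate_line] by (simp add: measurable_cong_sets[OF lines.sets_P lines.sets_P])

lemma translate_lines_add:
  assumes "\<omega> \<in> configurations line_measure"
  shows "translate_lines (g + h) \<omega> = translate_lines g (translate_lines h \<omega>)"
proof -
  have "translate (g + h) = translate g \<circ> translate h" by (simp add: fun_eq_iff translate_add)
  then show ?thesis
    unfolding translate_lines_def
    by (simp add: suspend_suspend[OF measurable_translate_line measurable_translate_line assms])
qed

lemma translate_lines_0: "\<omega> \<in> configurations line_measure \<Longrightarrow> translate_lines 0 \<omega> = \<omega>"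
  unfolding translate_lines_def by (rule suspend_id) simp_all

lemma distr_translate_lines: "distr poisson_lines poisson_lines (translate_lines g) = poisson_lines"
  unfolding translate_lines_def by (rule lines.distr_suspend[OF measurable_translate_line distr_translate])

lemma emeasure_translate_lines_vimage:
  assumes "E \<in> sets poisson_lines"
  shows "emeasure poisson_lines (translate_lines g -` E \<inter> space poisson_lines) = emeasure poisson_lines E"
proof -
  have "emeasure poisson_lines E = emeasure (distr poisson_lines poisson_lines (translate_lines g)) E"
    by (simp only: distr_translate_lines)
  also have "\<dots> = emeasure poisson_lines (translate_lines g -` E \<inter> space poisson_lines)"
    by (rule emeasure_distr[OF measurable_translate_lines assms])
  finally show ?thesis by simp
qed

lemma AE_lines: "(\<And>\<omega>. \<omega> \<in> configurations line_measure \<Longrightarrow> Q \<omega>) \<Longrightarrow> AE \<omega> in poisson_lines. Q \<omega>"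
  by (rule AE_I2) simp

lemma iso_mod0_translate: "iso_mod0 line_measure line_measure (translate g)"
  unfolding iso_mod0_def
proof (intro conjI bexI[of _ "translate (- g)"])
  show "AE x in line_measure. translate (- g) (translate g x) = x"
    "AE x in line_measure. translate g (translate (- g) x) = x"
    by (simp_all add: translate_add[symmetric])
qed (simp_all add: measurable_translate_line distr_translate)

lemma iso_mod0_translate_lines: "iso_mod0 poisson_lines poisson_lines (translate_lines g)"
  unfolding iso_mod0_def
proof (intro conjI bexI[of _ "translate_lines (- g)"])
  show "AE x in poisson_lines. translate_lines (- g) (translate_lines g x) = x"
    "AE x in poisson_lines. translate_lines g (translate_lines (- g) x) = x"
    by (auto intro!: AE_lines simp: translate_lines_add[symmetric] translate_lines_0)
qed (simp_all add: distr_translate_lines measurable_translate_lines)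

lemma mp_action_translate: "mp_action line_measure (translate :: real ^ 'd::finite \<Rightarrow> real \<Rightarrow> real)"
  unfolding mp_action_def using iso_mod0_translate translate_continuous
  by (auto simp: translate_add)

lemma count_differs_subset:
  assumes \<omega>: "\<omega> \<in> configurations line_measure" and A: "A \<in> sets borel" "B \<in> sets borel"
    and 0: "emeasure \<omega> (sym_diff A B) = 0"
  shows "emeasure \<omega> A = emeasure \<omega> B"
proof -
  have s: "sets \<omega> = sets borel" using \<omega> by simp
  have "sym_diff A B \<in> null_sets \<omega>" using 0 A by (intro null_setsI) (auto simp: s)
  then have "AE x in \<omega>. x \<in> A \<longleftrightarrow> x \<in> B" by (rule AE_I') auto
  then show ?thesis using A by (intro emeasure_eq_AE) (auto simp: s)
qed

text \<open>Two counts differ only if some point falls into the symmetric difference, which has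
  probability at most its mass. This converts approximations in the base into approximations of
  events.\<close>

lemma emeasure_count_differs:
  assumes F: "finite F" and A: "\<And>q. q \<in> F \<Longrightarrow> A q \<in> sets borel" "\<And>q. q \<in> F \<Longrightarrow> B q \<in> sets borel"
  shows "emeasure poisson_lines {\<omega> \<in> space poisson_lines. \<exists>q\<in>F. emeasure \<omega> (A q) \<noteq> emeasure \<omega> (B q)}
    \<le> (\<Sum>q\<in>F. emeasure line_measure (sym_diff (A q) (B q)))"
proof -
  define H where "H q = {\<omega> \<in> space poisson_lines. emeasure \<omega> (sym_diff (A q) (B q)) \<noteq> 0}" for q
  have H: "H q \<in> sets poisson_lines" for q
    unfolding H_def lines.space_P by (rule lines.count_event_not)
  have "emeasure poisson_lines {\<omega> \<in> space poisson_lines. \<exists>q\<in>F. emeasure \<omega> (A q) \<noteq> emeasure \<omega> (B q)} \<le> emeasure poisson_lines (\<Union>q\<in>F. H q)"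
  proof (rule emeasure_mono)
    show "{\<omega> \<in> space poisson_lines. \<exists>q\<in>F. emeasure \<omega> (A q) \<noteq> emeasure \<omega> (B q)} \<subseteq> (\<Union>q\<in>F. H q)"
      using count_differs_subset[OF _ A] by (auto simp: H_def)
    show "(\<Union>q\<in>F. H q) \<in> sets poisson_lines" using F H by (intro sets.finite_UN)
  qed
  also have "\<dots> \<le> (\<Sum>q\<in>F. emeasure poisson_lines (H q))"
    using F H by (intro emeasure_subadditive_finite) auto
  also have "\<dots> \<le> (\<Sum>q\<in>F. emeasure line_measure (sym_diff (A q) (B q)))"
    unfolding H_def using A by (intro sum_mono lines.emeasure_hit_le) auto
  finally show ?thesis .
qed

lemma translate_lines_vimage_sets:
  "E \<in> sets poisson_lines \<Longrightarrow> translate_lines g -` E \<inter> space poisson_lines \<in> sets poisson_lines"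
  by (rule measurable_sets[OF measurable_translate_lines])

lemma emeasure_sym_diff_translate_lines:
  assumes "X \<in> sets poisson_lines" "Y \<in> sets poisson_lines"
  shows "emeasure poisson_lines (sym_diff (translate_lines g -` X \<inter> space poisson_lines) (translate_lines g -` Y \<inter> space poisson_lines)) =
    emeasure poisson_lines (sym_diff X Y)"
proof -
  have "sym_diff (translate_lines g -` X \<inter> space poisson_lines) (translate_lines g -` Y \<inter> space poisson_lines) =
      translate_lines g -` sym_diff X Y \<inter> space poisson_lines" by auto
  then show ?thesis using assms by (simp only:) (rule emeasure_translate_lines_vimage, auto)
qed

lemma count_events_unfold:
  assumes "E \<in> count_events line_measure UNIV"
  obtains F :: "(real set \<times> nat) set" where "finite F" "\<And>q. q \<in> F \<Longrightarrow> fst q \<in> sets borel"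
    "\<And>q. q \<in> F \<Longrightarrow> emeasure line_measure (fst q) < \<infinity>"
    "E = {\<omega> \<in> space poisson_lines. \<forall>q\<in>F. emeasure \<omega> (fst q) = of_nat (snd q)}"
proof -
  obtain F :: "(real set \<times> nat) set" where
    F: "E = {\<omega> \<in> configurations line_measure. \<forall>(A, k)\<in>F. emeasure \<omega> A = of_nat k}" "finite F"
      "\<forall>(A, k)\<in>F. A \<in> sets line_measure \<and> A \<subseteq> UNIV \<and> emeasure line_measure A < \<infinity>"
    using assms unfolding count_events_def by blast
  show ?thesis
  proof (rule that[OF F(2)])
    show "E = {\<omega> \<in> space poisson_lines. \<forall>q\<in>F. emeasure \<omega> (fst q) = of_nat (snd q)}"
      unfolding F(1) by (simp add: case_prod_beta)
  qed (use F(3) in \<open>auto simp: case_prod_beta\<close>)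
qed

lemma sets_poisson_lines: "sets poisson_lines = sigma_sets (space poisson_lines) (count_events line_measure UNIV)"
  using sets_configuration_algebra_eq[OF sigma_finite_line_measure] by simp

text \<open>For events fixed by finitely many counts, continuity comes from the base; it passes to
  limits because translations preserve the distance of events.\<close>

lemma translate_lines_continuous:
  fixes h :: "real ^ 'd::finite"
  assumes "E \<in> sets poisson_lines"
  shows "((\<lambda>g. emeasure poisson_lines (sym_diff (translate_lines g -` E \<inter> space poisson_lines) (translate_lines h -` E \<inter> space poisson_lines))) \<longlongrightarrow> 0) (at h)"
proof -
  let ?P = "poisson_lines"
  have G: "count_events line_measure UNIV \<subseteq> sets ?P" using count_events_sets by simp
  have E: "E \<in> sigma_sets (space ?P) (count_events line_measure UNIV)" using assms by (simp only: sets_poisson_lines)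
  show ?thesis
    using G E
  proof (induction rule: lines.sigma_sets_approx_induct)
    case (generator E)
    obtain F :: "(real set \<times> nat) set" where F: "finite F" "\<And>q. q \<in> F \<Longrightarrow> fst q \<in> sets borel"
      "\<And>q. q \<in> F \<Longrightarrow> emeasure line_measure (fst q) < \<infinity>"
      "E = {\<omega> \<in> space poisson_lines. \<forall>q\<in>F. emeasure \<omega> (fst q) = of_nat (snd q)}"
      using count_events_unfold[OF generator] by blast
    have "((\<lambda>g. \<Sum>q\<in>F. emeasure line_measure (sym_diff (translate g -` fst q) (translate h -` fst q))) \<longlongrightarrow> (\<Sum>q\<in>F. 0)) (at h)"
      using F by (intro tendsto_sum translate_continuous) auto
    then have lim: "((\<lambda>g. \<Sum>q\<in>F. emeasure line_measure (sym_diff (translate g -` fst q) (translate h -` fst q))) \<longlongrightarrow> 0) (at h)" by simp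
    have le: "emeasure ?P (sym_diff (translate_lines g -` E \<inter> space ?P) (translate_lines h -` E \<inter> space ?P)) \<le>
       (\<Sum>q\<in>F. emeasure line_measure (sym_diff (translate g -` fst q) (translate h -` fst q)))" for g :: "real ^ 'd"
    proof -
      have eq: "emeasure (translate_lines g \<omega>) (fst q) = emeasure \<omega> (translate g -` fst q)" if "\<omega> \<in> space ?P" "q \<in> F" for \<omega> q and g :: "real ^ 'd"
        using that F(2) by (simp add: emeasure_translate_lines)
      have mem: "translate_lines g -` E \<inter> space ?P = {\<omega> \<in> space ?P. \<forall>q\<in>F. emeasure \<omega> (translate g -` fst q) = of_nat (snd q)}"
        for g :: "real ^ 'd"
      proof (intro set_eqI)
        fix \<omega>
        show "\<omega> \<in> translate_lines g -` E \<inter> space ?P \<longleftrightarrow> \<omega> \<in> {\<omega> \<in> space ?P. \<forall>q\<in>F. emeasure \<omega> (translate g -` fst q) = of_nat (snd q)}"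
          by (cases "\<omega> \<in> space ?P") (simp_all add: F(4) eq translate_lines_configuration cong: ball_cong)
      qed
      have "sym_diff (translate_lines g -` E \<inter> space ?P) (translate_lines h -` E \<inter> space ?P) \<subseteq>
          {\<omega> \<in> space ?P. \<exists>q\<in>F. emeasure \<omega> (translate g -` fst q) \<noteq> emeasure \<omega> (translate h -` fst q)}"
        unfolding mem by fastforce
      moreover have "{\<omega> \<in> space ?P. \<exists>q\<in>F. emeasure \<omega> (translate g -` fst q) \<noteq> emeasure \<omega> (translate h -` fst q)} \<in> sets ?P"
      proof -
        have "{\<omega> \<in> space ?P. emeasure \<omega> A \<noteq> emeasure \<omega> B} \<in> sets ?P" for A B by measurable
        then show ?thesis using F(1) by (intro sets.sets_Collect_finite_Ex) auto
      qed
      ultimately have "emeasure ?P (sym_diff (translate_lines g -` E \<inter> space ?P) (translate_lines h -` E \<inter> space ?P)) \<le>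
          emeasure ?P {\<omega> \<in> space ?P. \<exists>q\<in>F. emeasure \<omega> (translate g -` fst q) \<noteq> emeasure \<omega> (translate h -` fst q)}"
        by (rule emeasure_mono)
      also have "\<dots> \<le> (\<Sum>q\<in>F. emeasure line_measure (sym_diff (translate g -` fst q) (translate h -` fst q)))"
        using F by (intro emeasure_count_differs translate_vimage_sets) auto
      finally show ?thesis .
    qed
    show ?case
      by (rule tendsto_sandwich[OF _ _ tendsto_const lim]) (simp_all only: le zero_le eventually_True)
  next
    case (compl A)
    have "sym_diff (translate_lines g -` (space ?P - A) \<inter> space ?P) (translate_lines h -` (space ?P - A) \<inter> space ?P) =
      sym_diff (translate_lines g -` A \<inter> space ?P) (translate_lines h -` A \<inter> space ?P)" for g :: "real ^ 'd"
      using measurable_space[OF measurable_translate_lines, of _ g] measurable_space[OF measurable_translate_lines, of _ h] by blast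
    then show ?case using compl(2) by (simp only:)
  next
    case (union A B)
    let ?f = "\<lambda>g X. translate_lines g -` X \<inter> space ?P"
    have "((\<lambda>g. emeasure ?P (sym_diff (?f g A) (?f h A)) + emeasure ?P (sym_diff (?f g B) (?f h B))) \<longlongrightarrow> 0 + 0) (at h)"
      by (intro tendsto_add union)
    then have lim: "((\<lambda>g. emeasure ?P (sym_diff (?f g A) (?f h A)) + emeasure ?P (sym_diff (?f g B) (?f h B))) \<longlongrightarrow> 0) (at h)" by simp
    have le: "emeasure ?P (sym_diff (?f g (A \<union> B)) (?f h (A \<union> B))) \<le> emeasure ?P (sym_diff (?f g A) (?f h A)) + emeasure ?P (sym_diff (?f g B) (?f h B))"
      for g :: "real ^ 'd"
      unfolding vimage_Un Int_Un_distrib2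
      by (intro emeasure_sym_diff_binop(1) translate_lines_vimage_sets union)
    show ?case
      by (rule tendsto_sandwich[OF _ _ tendsto_const lim]) (simp_all only: le zero_le eventually_True)
  next
    case (limit A)
    show ?case
    proof (rule tendsto_sym_diff_limit[where f = "\<lambda>g X. translate_lines g -` X \<inter> space ?P"])
      fix e :: real assume "0 < e"
      then obtain B where B: "B \<in> sets ?P" "((\<lambda>g. emeasure ?P (sym_diff (translate_lines g -` B \<inter> space ?P) (translate_lines h -` B \<inter> space ?P))) \<longlongrightarrow> 0) (at h)"
        "measure ?P (sym_diff A B) < e" using limit(2) by blast
      have "emeasure ?P (sym_diff A B) < ennreal e"
        using B(3) \<open>0 < e\<close> by (simp add: lines.emeasure_eq_measure ennreal_less_iff)
      then show "\<exists>B\<in>sets ?P. ((\<lambda>g. emeasure ?P (sym_diff (translate_lines g -` B \<inter> space ?P) (translate_lines h -` B \<inter> space ?P))) \<longlongrightarrow> 0) (at h) \<and>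
         emeasure ?P (sym_diff A B) < ennreal e" using B by blast
    qed (use limit translate_lines_vimage_sets emeasure_sym_diff_translate_lines in auto)
  qed simp
qed

lemma mp_action_translate_lines: "mp_action poisson_lines (translate_lines :: real ^ 'd::finite \<Rightarrow> _)"
  unfolding mp_action_def
  using iso_mod0_translate_lines translate_lines_continuous
  by (auto intro!: AE_lines simp: translate_lines_add translate_lines_0)

lemma standard_measure_poisson_lines: "standard_measure poisson_lines"
  by (rule standard_measure_poisson_law[OF lines.poisson_law_axioms, of strip])
    (simp_all add: strip_disjoint strip_cover emeasure_strip)

lemma poisson_action_translate_lines: "poisson_action poisson_lines (translate_lines :: real ^ 'd::finite \<Rightarrow> _)"
  unfolding poisson_action_def pp_action_def
proof (intro conjI exI)
  show "prob_space poisson_lines" by (rule lines.prob_space_axioms)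
  show "standard_measure poisson_lines" by (rule standard_measure_poisson_lines)
  show "mp_action poisson_lines (translate_lines :: real ^ 'd \<Rightarrow> _)" by (rule mp_action_translate_lines)
  show "standard_measure line_measure" by (rule standard_measure_borel[OF sets_line_measure sigma_finite_line_measure])
  show "non_atomic line_measure" by (rule non_atomic_line_measure)
  show "emeasure line_measure (space line_measure) = \<infinity>" by (simp only: space_line_measure emeasure_line_measure_space)
  show "mp_action line_measure (translate :: real ^ 'd \<Rightarrow> _)" by (rule mp_action_translate)
  show "is_poisson_measure line_measure poisson_lines" by (rule lines.is_poisson_measure)
  show "iso_mod0 poisson_lines poisson_lines (\<lambda>x. x)"
    unfolding iso_mod0_def by (auto intro!: bexI[of _ "\<lambda>x. x"] simp: distr_id)
  show "\<forall>g :: real ^ 'd. AE \<omega> in poisson_lines. translate_lines g \<omega> = suspend line_measure (translate g) \<omega>"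
    by (simp add: translate_lines_def)
qed

section \<open>Zero entropy of the action\<close>

lemma (in prob_space) partition_entropy_cong:
  assumes Y: "simple_function M Y" and eq: "\<And>\<omega>. \<omega> \<in> space M \<Longrightarrow> X \<omega> = Y \<omega>"
  shows "partition_entropy M X = partition_entropy M Y"
proof -
  have X: "simple_function M X" using Y simple_function_cong[of M X Y] eq by simp
  have "X ` space M = Y ` space M" "X -` {x} \<inter> space M = Y -` {x} \<inter> space M" for x
    using eq by (auto simp: image_def)
  then show ?thesis unfolding partition_entropy_eq[OF X] partition_entropy_eq[OF Y] by simp
qed

text \<open>\<open>F\<close> lists prescribed counts, and the signature is the part of the list that
  \<open>\<omega>\<close> satisfies. Whatever depends only on the truth of these prescriptions
  factors through it, and for finite \<open>F\<close> it takes finitely many values.\<close>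

definition signature :: "(real set \<times> nat) set \<Rightarrow> real measure \<Rightarrow> (real set \<times> nat) set" where
  "signature F \<omega> = {q \<in> F. emeasure \<omega> (fst q) = of_nat (snd q)}"

definition signature_set :: "(real set \<times> nat) set \<Rightarrow> bool" where
  "signature_set F \<longleftrightarrow> finite F \<and> (\<forall>q\<in>F. fst q \<in> sets borel \<and> emeasure line_measure (fst q) < \<infinity>)"

lemma simple_function_subset_selection:
  assumes F: "finite F" and m: "\<And>q. q \<in> F \<Longrightarrow> {\<omega> \<in> space P. R q \<omega>} \<in> sets P"
  shows "simple_function P (\<lambda>\<omega>. {q \<in> F. R q \<omega>})"
  unfolding simple_function_def
proof (intro conjI ballI)
  have "(\<lambda>\<omega>. {q \<in> F. R q \<omega>}) ` space P \<subseteq> Pow F" by auto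
  then show "finite ((\<lambda>\<omega>. {q \<in> F. R q \<omega>}) ` space P)" using F by (meson finite_Pow_iff finite_subset)
  fix S assume "S \<in> (\<lambda>\<omega>. {q \<in> F. R q \<omega>}) ` space P"
  then have S: "S \<subseteq> F" by auto
  have "(\<lambda>\<omega>. {q \<in> F. R q \<omega>}) -` {S} \<inter> space P = {\<omega> \<in> space P. \<forall>q\<in>F. R q \<omega> \<longleftrightarrow> q \<in> S}"
    using S by auto
  also have "\<dots> \<in> sets P"
  proof (rule sets.sets_Collect_finite_All[OF _ F])
    fix q assume q: "q \<in> F"
    show "{\<omega> \<in> space P. R q \<omega> \<longleftrightarrow> q \<in> S} \<in> sets P"
      using m[OF q] sets.sets_Collect_neg[OF m[OF q]] by (cases "q \<in> S") simp_all
  qed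
  finally show "(\<lambda>\<omega>. {q \<in> F. R q \<omega>}) -` {S} \<inter> space P \<in> sets P" .
qed

lemma simple_function_signature: "finite F \<Longrightarrow> simple_function poisson_lines (signature F)"
  unfolding signature_def[abs_def]
  by (rule simple_function_subset_selection) (auto simp: lines.count_event[unfolded lines.sets_P])

lemma signature_event: "finite F \<Longrightarrow> {\<omega> \<in> space poisson_lines. \<Phi> (signature F \<omega>)} \<in> sets poisson_lines"
  using simple_functionD(2)[OF simple_function_signature, of F "{S. \<Phi> S}"]
  by (simp only: vimage_def mem_Collect_eq Int_def conj_commute)

lemma signature_Int: "F' \<subseteq> F \<Longrightarrow> signature F \<omega> \<inter> F' = signature F' \<omega>"
  by (auto simp: signature_def)

text \<open>Events read off from signatures contain the generators and are closed under complements
  and finite unions, hence are dense in measure.\<close>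

lemma signature_approx:
  assumes "E \<in> sets poisson_lines" "0 < e"
  shows "\<exists>F \<Phi>. signature_set F \<and> measure poisson_lines (sym_diff E {\<omega> \<in> space poisson_lines. \<Phi> (signature F \<omega>)}) < e"
proof -
  let ?P = "poisson_lines" and ?C = "\<lambda>F \<Phi>. {\<omega> \<in> space poisson_lines. \<Phi> (signature F \<omega>)}"
  have G: "count_events line_measure UNIV \<subseteq> sets ?P" using count_events_sets by simp
  have E: "E \<in> sigma_sets (space ?P) (count_events line_measure UNIV)" using assms(1) by (simp only: sets_poisson_lines)
  have C: "?C F \<Phi> \<in> sets ?P" if "signature_set F" for F \<Phi>
    using signature_event that by (simp only: signature_set_def)
  have "\<forall>e>0. \<exists>F \<Phi>. signature_set F \<and> measure ?P (sym_diff E (?C F \<Phi>)) < e"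
    using G E
  proof (induction rule: lines.sigma_sets_approx_induct)
    case (generator E)
    obtain F :: "(real set \<times> nat) set" where F: "finite F" "\<And>q. q \<in> F \<Longrightarrow> fst q \<in> sets borel"
      "\<And>q. q \<in> F \<Longrightarrow> emeasure line_measure (fst q) < \<infinity>"
      "E = {\<omega> \<in> space ?P. \<forall>q\<in>F. emeasure \<omega> (fst q) = of_nat (snd q)}"
      using count_events_unfold[OF generator] by blast
    have "signature F \<omega> = F \<longleftrightarrow> (\<forall>q\<in>F. emeasure \<omega> (fst q) = of_nat (snd q))" for \<omega>
      unfolding signature_def by blast
    then have "?C F (\<lambda>S. S = F) = E" unfolding F(4) by (simp only:)
    then have m: "measure ?P (sym_diff E (?C F (\<lambda>S. S = F))) = 0" by (simp only: Diff_cancel Un_empty_left measure_empty)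
    have "signature_set F" using F by (simp add: signature_set_def)
    then show ?case using m by (intro allI impI exI[of _ F] exI[of _ "\<lambda>S. S = F"]) (simp only:)
  next
    case (compl A)
    show ?case
    proof (intro allI impI)
      fix e :: real assume "0 < e"
      then obtain F \<Phi> where F: "signature_set F" "measure ?P (sym_diff A (?C F \<Phi>)) < e" using compl(2) by blast
      have "sym_diff (space ?P - A) (?C F (\<lambda>S. \<not> \<Phi> S)) = sym_diff A (?C F \<Phi>)"
        using sets.sets_into_space[OF compl(1)] by blast
      then show "\<exists>F \<Phi>. signature_set F \<and> measure ?P (sym_diff (space ?P - A) (?C F \<Phi>)) < e"
        using F by (intro exI[of _ F] exI[of _ "\<lambda>S. \<not> \<Phi> S"]) (simp only:)
    qed
  next
    case (union A B)
    show ?case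
    proof (intro allI impI)
      fix e :: real assume "0 < e"
      then have e: "0 < e / 2" by simp
      obtain F \<Phi> where F: "signature_set F" "measure ?P (sym_diff A (?C F \<Phi>)) < e / 2" using union(3) e by blast
      obtain F' \<Phi>' where F': "signature_set F'" "measure ?P (sym_diff B (?C F' \<Phi>')) < e / 2" using union(4) e by blast
      \<comment> \<open>Both predicates are evaluated on the joint signature, from which each
        separate signature is recovered by intersection.\<close>
      let ?\<Psi> = "\<lambda>S. \<Phi> (S \<inter> F) \<or> \<Phi>' (S \<inter> F')"
      have FF: "signature_set (F \<union> F')" using F(1) F'(1) by (auto simp: signature_set_def)
      have sub: "sym_diff (A \<union> B) (?C (F \<union> F') ?\<Psi>) \<subseteq> sym_diff A (?C F \<Phi>) \<union> sym_diff B (?C F' \<Phi>')"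
      proof -
        have "signature (F \<union> F') \<omega> \<inter> F = signature F \<omega>" "signature (F \<union> F') \<omega> \<inter> F' = signature F' \<omega>" for \<omega>
          by (rule signature_Int, blast)+
        then show ?thesis by (simp only:) blast
      qed
      have "measure ?P (sym_diff (A \<union> B) (?C (F \<union> F') ?\<Psi>)) \<le> measure ?P (sym_diff A (?C F \<Phi>) \<union> sym_diff B (?C F' \<Phi>'))"
        using C[OF F(1)] C[OF F'(1)] union(1,2) by (intro lines.finite_measure_mono[OF sub]) blast
      also have "\<dots> \<le> measure ?P (sym_diff A (?C F \<Phi>)) + measure ?P (sym_diff B (?C F' \<Phi>'))"
        using C[OF F(1)] C[OF F'(1)] union(1,2) by (intro measure_Un_le) blast+
      also have "\<dots> < e" using F(2) F'(2) by linarith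
      finally show "\<exists>F \<Phi>. signature_set F \<and> measure ?P (sym_diff (A \<union> B) (?C F \<Phi>)) < e"
        using FF by (intro exI[of _ "F \<union> F'"] exI[of _ ?\<Psi>] conjI)
    qed
  next
    case (limit A)
    show ?case
    proof (intro allI impI)
      fix e :: real assume "0 < e"
      then have e: "0 < e / 2" by simp
      obtain B where B: "B \<in> sets ?P" "\<forall>e>0. \<exists>F \<Phi>. signature_set F \<and> measure ?P (sym_diff B (?C F \<Phi>)) < e"
        "measure ?P (sym_diff A B) < e / 2" using limit(2)[OF e] by blast
      obtain F \<Phi> where F: "signature_set F" "measure ?P (sym_diff B (?C F \<Phi>)) < e / 2" using B(2) e by blast
      have sub: "sym_diff A (?C F \<Phi>) \<subseteq> sym_diff A B \<union> sym_diff B (?C F \<Phi>)" by blast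
      have "measure ?P (sym_diff A (?C F \<Phi>)) \<le> measure ?P (sym_diff A B \<union> sym_diff B (?C F \<Phi>))"
        using C[OF F(1)] B(1) limit(1) by (intro lines.finite_measure_mono[OF sub]) blast
      also have "\<dots> \<le> measure ?P (sym_diff A B) + measure ?P (sym_diff B (?C F \<Phi>))"
        using C[OF F(1)] B(1) limit(1) by (intro measure_Un_le) blast+
      also have "\<dots> < e" using F(2) B(3) by linarith
      finally show "\<exists>F \<Phi>. signature_set F \<and> measure ?P (sym_diff A (?C F \<Phi>)) < e"
        using F(1) by (intro exI[of _ F] exI[of _ \<Phi>] conjI)
    qed
  next
    case empty
    have "sym_diff {} (?C {} (\<lambda>_. False)) = {}" by blast
    then have m: "measure ?P (sym_diff {} (?C {} (\<lambda>_. False))) = 0" by (simp only: measure_empty)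
    have "signature_set {}" by (simp add: signature_set_def)
    then show ?case using m by (intro allI impI exI[of _ "{}"] exI[of _ "\<lambda>_. False"]) (simp only:)
  qed
  then show ?thesis using assms(2) by blast
qed

text \<open>Each of the \<open>k\<close> level sets is approximated within \<open>e / k\<close>. Off
  the union of the errors exactly one index below \<open>k\<close> has its predicate satisfied, so
  the least such index is the true label; 0 is the default.\<close>

lemma label_approx:
  assumes \<xi>: "finite_partition poisson_lines \<xi>" and k: "\<And>\<omega>. \<omega> \<in> space poisson_lines \<Longrightarrow> \<xi> \<omega> < k" and e: "0 < e"
  shows "\<exists>F \<psi>. signature_set F \<and> (\<forall>S. \<psi> S < k) \<and> measure poisson_lines {\<omega> \<in> space poisson_lines. \<xi> \<omega> \<noteq> \<psi> (signature F \<omega>)} < e"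
proof -
  let ?P = "poisson_lines"
  obtain \<omega>0 where "\<omega>0 \<in> space ?P" using lines.not_empty by blast
  then have k0: "0 < k" using k[of \<omega>0] by simp
  have \<xi>m: "\<xi> -` {i} \<inter> space ?P \<in> sets ?P" for i
    by (rule measurable_sets[OF conjunct1[OF \<xi>[unfolded finite_partition_def]]]) simp
  have "0 < e / real k" using e k0 by simp
  then have "\<exists>F \<Phi>. signature_set F \<and> measure ?P (sym_diff (\<xi> -` {i} \<inter> space ?P) {\<omega> \<in> space ?P. \<Phi> (signature F \<omega>)}) < e / real k" for i
    by (rule signature_approx[OF \<xi>m])
  then have "\<exists>p. signature_set (fst p) \<and> measure ?P (sym_diff (\<xi> -` {i} \<inter> space ?P) {\<omega> \<in> space ?P. snd p (signature (fst p) \<omega>)}) < e / real k" for i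
    by (simp only: split_paired_Ex fst_conv snd_conv)
  then obtain p where p: "\<And>i. signature_set (fst (p i)) \<and>
      measure ?P (sym_diff (\<xi> -` {i} \<inter> space ?P) {\<omega> \<in> space ?P. snd (p i) (signature (fst (p i)) \<omega>)}) < e / real k"
    using choice[of "\<lambda>i p. signature_set (fst p) \<and>
      measure ?P (sym_diff (\<xi> -` {i} \<inter> space ?P) {\<omega> \<in> space ?P. snd p (signature (fst p) \<omega>)}) < e / real k"] by blast
  define F \<Phi> where "F i = fst (p i)" and "\<Phi> i = snd (p i)" for i
  have F: "signature_set (F i)" "measure ?P (sym_diff (\<xi> -` {i} \<inter> space ?P) {\<omega> \<in> space ?P. \<Phi> i (signature (F i) \<omega>)}) < e / real k" for i
    unfolding F_def \<Phi>_def by (rule conjunct1[OF p], rule conjunct2[OF p])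
  define G where "G = (\<Union>i<k. F i)"
  have G: "signature_set G" using F(1) by (auto simp: G_def signature_set_def)
  define \<psi> where "\<psi> S = (if \<exists>i<k. \<Phi> i (S \<inter> F i) then LEAST i. i < k \<and> \<Phi> i (S \<inter> F i) else 0)" for S
  have \<psi>: "\<psi> S < k" for S
  proof (cases "\<exists>i<k. \<Phi> i (S \<inter> F i)")
    case True
    then have "(LEAST i. i < k \<and> \<Phi> i (S \<inter> F i)) < k" by (rule conjunct1[OF LeastI_ex])
    then show ?thesis using True by (simp only: \<psi>_def if_True)
  next
    case False
    then show ?thesis using k0 by (simp only: \<psi>_def if_False)
  qed
  define D where "D i = sym_diff (\<xi> -` {i} \<inter> space ?P) {\<omega> \<in> space ?P. \<Phi> i (signature (F i) \<omega>)}" for i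
  have D: "D i \<in> sets ?P" for i
    unfolding D_def by (intro sets.Un sets.Diff \<xi>m signature_event conjunct1[OF F(1)[unfolded signature_set_def]])
  have sub: "{\<omega> \<in> space ?P. \<xi> \<omega> \<noteq> \<psi> (signature G \<omega>)} \<subseteq> (\<Union>i<k. D i)"
  proof (rule subsetI, rule ccontr)
    fix \<omega> assume \<omega>: "\<omega> \<in> {\<omega> \<in> space ?P. \<xi> \<omega> \<noteq> \<psi> (signature G \<omega>)}" and n: "\<omega> \<notin> (\<Union>i<k. D i)"
    have "signature G \<omega> \<inter> F i = signature (F i) \<omega>" if "i < k" for i
      using that by (intro signature_Int) (auto simp: G_def)
    then have iff: "\<Phi> i (signature G \<omega> \<inter> F i) \<longleftrightarrow> \<xi> \<omega> = i" if "i < k" for i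
    proof -
      have "\<omega> \<notin> D i" "\<omega> \<in> space ?P" using that n \<omega> by blast+
      then have "\<omega> \<in> \<xi> -` {i} \<longleftrightarrow> \<Phi> i (signature (F i) \<omega>)" unfolding D_def by blast
      then show ?thesis using \<open>\<And>i. i < k \<Longrightarrow> signature G \<omega> \<inter> F i = signature (F i) \<omega>\<close>[OF that] by (simp only: vimage_singleton_eq)
    qed
    have \<xi>k: "\<xi> \<omega> < k" using k \<omega> by blast
    have "\<psi> (signature G \<omega>) = (LEAST i. i < k \<and> \<Phi> i (signature G \<omega> \<inter> F i))"
    proof -
      have "\<exists>i<k. \<Phi> i (signature G \<omega> \<inter> F i)" using \<xi>k iff[OF \<xi>k] by blast
      then show ?thesis by (simp only: \<psi>_def if_True)
    qed
    also have "\<dots> = \<xi> \<omega>" by (rule Least_equality) (use \<xi>k iff in auto)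
    finally show False using \<omega> by simp
  qed
  have "measure ?P {\<omega> \<in> space ?P. \<xi> \<omega> \<noteq> \<psi> (signature G \<omega>)} \<le> measure ?P (\<Union>i<k. D i)"
    by (rule lines.finite_measure_mono[OF sub sets.finite_UN[OF finite_lessThan D]])
  also have "\<dots> \<le> (\<Sum>i<k. measure ?P (D i))"
    by (rule lines.finite_measure_subadditive_finite[OF finite_lessThan image_subsetI[OF D]])
  also have "\<dots> < (\<Sum>i<k. e / real k)"
    using F(2) k0 unfolding D_def by (intro sum_strict_mono) auto
  also have "\<dots> = e" using k0 by simp
  finally show ?thesis using G \<psi> by (intro exI[of _ G] exI[of _ \<psi>] conjI allI)
qed

text \<open>Cutting counts off at \<open>\<kappa>\<close>, infinite ones included, leaves finitely
  many values, as entropy requires; comparisons with numbers below \<open>\<kappa>\<close>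
  survive.\<close>

definition truncated_count :: "nat \<Rightarrow> ennreal \<Rightarrow> nat" where
  "truncated_count \<kappa> x = card {i. i < \<kappa> \<and> of_nat (Suc i) \<le> x}"

lemma truncated_count_of_nat: "truncated_count \<kappa> (of_nat m) = min m \<kappa>"
proof -
  have "{i. i < \<kappa> \<and> of_nat (Suc i) \<le> (of_nat m :: ennreal)} = {..<min m \<kappa>}"
    by (auto simp del: of_nat_Suc)
  then show ?thesis by (simp add: truncated_count_def)
qed

lemma truncated_count_le: "truncated_count \<kappa> x \<le> \<kappa>"
proof -
  have "card {i. i < \<kappa> \<and> of_nat (Suc i) \<le> x} \<le> card {..<\<kappa>}" by (intro card_mono) auto
  then show ?thesis by (simp add: truncated_count_def)
qed

text \<open>A summand of at least \<open>\<kappa>\<close> makes both sides false; otherwise nothing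
  is cut off and the sums agree.\<close>

lemma truncated_count_sum:
  assumes J: "finite J" and x: "\<And>j. j \<in> J \<Longrightarrow> x j = \<infinity> \<or> (\<exists>k::nat. x j = of_nat k)" and m: "m < \<kappa>"
  shows "(\<Sum>j\<in>J. x j) = of_nat m \<longleftrightarrow> (\<Sum>j\<in>J. truncated_count \<kappa> (x j)) = m"
proof (cases "\<exists>j\<in>J. x j = \<infinity> \<or> of_nat \<kappa> \<le> x j")
  case True
  then obtain j where j: "j \<in> J" "x j = \<infinity> \<or> of_nat \<kappa> \<le> x j" by blast
  then have ge: "of_nat \<kappa> \<le> x j" by auto
  have "truncated_count \<kappa> (x j) = \<kappa>"
  proof -
    have "{i. i < \<kappa> \<and> of_nat (Suc i) \<le> x j} = {..<\<kappa>}"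
    proof (intro set_eqI iffI)
      fix i assume "i \<in> {..<\<kappa>}"
      then have "of_nat (Suc i) \<le> (of_nat \<kappa> :: ennreal)" by (simp del: of_nat_Suc add: of_nat_le_iff)
      then show "i \<in> {i. i < \<kappa> \<and> of_nat (Suc i) \<le> x j}" using \<open>i \<in> {..<\<kappa>}\<close> ge by (auto intro: order.trans)
    qed auto
    then show ?thesis by (simp add: truncated_count_def)
  qed
  then have "\<kappa> \<le> (\<Sum>j\<in>J. truncated_count \<kappa> (x j))"
    using member_le_sum[of j J "\<lambda>j. truncated_count \<kappa> (x j)"] J j(1) by simp
  moreover have "of_nat \<kappa> \<le> (\<Sum>j\<in>J. x j)"
    using member_le_sum[of j J x] J j(1) ge by (auto intro: order.trans)
  then have "(\<Sum>j\<in>J. x j) \<noteq> of_nat m"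
    using m by (auto simp: of_nat_le_iff)
  ultimately show ?thesis using m by auto
next
  case False
  then have "\<forall>j\<in>J. \<exists>k::nat. x j = of_nat k \<and> k < \<kappa>" using x by (fastforce simp: not_le of_nat_less_iff)
  then obtain y :: "_ \<Rightarrow> nat" where y: "\<forall>j\<in>J. x j = of_nat (y j) \<and> y j < \<kappa>" by (rule bchoice[THEN exE])
  have "(\<Sum>j\<in>J. x j) = of_nat (\<Sum>j\<in>J. y j)" using y by simp
  moreover have "(\<Sum>j\<in>J. truncated_count \<kappa> (x j)) = (\<Sum>j\<in>J. y j)"
    using y by (intro sum.cong) (auto simp: truncated_count_of_nat)
  ultimately show ?thesis by (simp only: of_nat_eq_iff)
qed

lemma simple_function_truncated_count:
  "simple_function poisson_lines (\<lambda>\<omega>. truncated_count \<kappa> (emeasure \<omega> A))"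
proof -
  have "{\<omega> \<in> space poisson_lines. of_nat (Suc i) \<le> emeasure \<omega> A} \<in> sets poisson_lines" for i
    by measurable
  then have "simple_function poisson_lines (\<lambda>\<omega>. {i \<in> {..<\<kappa>}. of_nat (Suc i) \<le> emeasure \<omega> A})"
    by (intro simple_function_subset_selection) auto
  from simple_function_compose1[OF this, of card] show ?thesis by (simp add: truncated_count_def)
qed

text \<open>Subadditivity over at most 4 K^3 n^2 cells, each of entropy at most 2(\<kappa> + 1)
  times the square root of its mass bound 1/(K^2 n).\<close>

lemma grid_entropy_le:
  assumes K: "1 \<le> K" and n: "1 \<le> n"
  shows "partition_entropy poisson_lines (\<lambda>\<omega>. \<lambda>j\<in>grid K n. truncated_count \<kappa> (emeasure \<omega> (cell K n j)))
    \<le> 8 * real (Suc \<kappa>) * real K ^ 2 * (real n * sqrt (real n))"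
proof -
  let ?P = "poisson_lines"
  let ?p = "1 / real K * (1 / (real K * real n))"
  have one: "partition_entropy ?P (\<lambda>\<omega>. truncated_count \<kappa> (emeasure \<omega> (cell K n j))) \<le> 2 * real (Suc \<kappa>) * sqrt ?p" for j
  proof (rule lines.partition_entropy_small[OF simple_function_truncated_count])
    have "(\<lambda>\<omega>. truncated_count \<kappa> (emeasure \<omega> (cell K n j))) ` space ?P \<subseteq> {..\<kappa>}" using truncated_count_le by auto
    then have "card ((\<lambda>\<omega>. truncated_count \<kappa> (emeasure \<omega> (cell K n j))) ` space ?P) \<le> card {..\<kappa>}" by (intro card_mono) auto
    then show "card ((\<lambda>\<omega>. truncated_count \<kappa> (emeasure \<omega> (cell K n j))) ` space ?P) \<le> Suc \<kappa>" by simp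
    have "{\<omega> \<in> space ?P. truncated_count \<kappa> (emeasure \<omega> (cell K n j)) \<noteq> 0} \<subseteq> {\<omega> \<in> space ?P. emeasure \<omega> (cell K n j) \<noteq> 0}"
      using truncated_count_of_nat[of \<kappa> 0] by auto
    moreover have "{\<omega> \<in> space ?P. emeasure \<omega> (cell K n j) \<noteq> 0} \<in> sets ?P"
      using lines.count_event_not by (simp only: lines.space_P)
    ultimately have "measure ?P {\<omega> \<in> space ?P. truncated_count \<kappa> (emeasure \<omega> (cell K n j)) \<noteq> 0} \<le> measure ?P {\<omega> \<in> space ?P. emeasure \<omega> (cell K n j) \<noteq> 0}"
      by (rule lines.finite_measure_mono)
    also have "ennreal (measure ?P {\<omega> \<in> space ?P. emeasure \<omega> (cell K n j) \<noteq> 0}) \<le> ennreal ?p"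
      unfolding lines.emeasure_eq_measure[symmetric]
      by (rule order.trans[OF lines.emeasure_hit_le emeasure_cell_le[OF K n]]) simp
    then have "measure ?P {\<omega> \<in> space ?P. emeasure \<omega> (cell K n j) \<noteq> 0} \<le> ?p"
      by (subst (asm) ennreal_le_iff) auto
    finally show "measure ?P {\<omega> \<in> space ?P. truncated_count \<kappa> (emeasure \<omega> (cell K n j)) \<noteq> 0} \<le> ?p" .
  qed
  have "partition_entropy ?P (\<lambda>\<omega>. \<lambda>j\<in>grid K n. truncated_count \<kappa> (emeasure \<omega> (cell K n j))) \<le>
     (\<Sum>j\<in>grid K n. partition_entropy ?P (\<lambda>\<omega>. truncated_count \<kappa> (emeasure \<omega> (cell K n j))))"
    by (rule lines.partition_entropy_family[OF finite_grid simple_function_truncated_count])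
  also have "\<dots> \<le> (\<Sum>j\<in>grid K n. 2 * real (Suc \<kappa>) * sqrt ?p)" by (rule sum_mono[OF one])
  also have "\<dots> = real (card (grid K n)) * (2 * real (Suc \<kappa>) * sqrt ?p)" by (simp only: sum_constant)
  also have "\<dots> \<le> real (4 * K ^ 3 * n ^ 2) * (2 * real (Suc \<kappa>) * sqrt ?p)"
    using card_grid[OF K n] by (intro mult_right_mono) (auto simp del: of_nat_mult of_nat_power)
  also have "sqrt ?p = 1 / (real K * sqrt (real n))"
    using K by (simp add: real_sqrt_divide real_sqrt_mult)
  also have "real (4 * K ^ 3 * n ^ 2) * (2 * real (Suc \<kappa>) * (1 / (real K * sqrt (real n)))) = 8 * real (Suc \<kappa>) * real K ^ 2 * (real n * (real n / sqrt (real n)))"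
    using K n by (simp add: power2_eq_square power3_eq_cube field_simps)
  also have "real n / sqrt (real n) = sqrt (real n)" by (rule real_div_sqrt) simp
  finally show ?thesis .
qed

section \<open>Entropy of the labels on a box of lattice points\<close>

lemma card_integer_box: "finite (integer_box n :: (int ^ 'd::finite) set)" "card (integer_box n :: (int ^ 'd) set) = n ^ CARD('d)"
proof -
  have eq: "(integer_box n :: (int ^ 'd) set) = vec_lambda ` (PiE UNIV (\<lambda>_. {0..<int n}))"
  proof (intro set_eqI iffI)
    fix z :: "int ^ 'd" assume "z \<in> integer_box n"
    then have "vec_nth z \<in> PiE UNIV (\<lambda>_. {0..<int n})" by (auto simp: integer_box_def)
    then show "z \<in> vec_lambda ` (PiE UNIV (\<lambda>_. {0..<int n}))" by (metis image_eqI vec_nth_inverse)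
  qed (auto simp: integer_box_def PiE_iff)
  have inj: "inj_on vec_lambda (PiE UNIV (\<lambda>_::'d. {0..<int n}))" by (auto simp: inj_on_def vec_lambda_inject)
  show "finite (integer_box n :: (int ^ 'd) set)" unfolding eq by (intro finite_imageI finite_PiE) auto
  show "card (integer_box n :: (int ^ 'd) set) = n ^ CARD('d)" unfolding eq card_image[OF inj] by (simp add: card_PiE)
qed

lemma emeasure_sum_cells:
  assumes "\<omega> \<in> configurations line_measure" "finite J"
  shows "emeasure \<omega> (\<Union>j\<in>J. cell K n j) = (\<Sum>j\<in>J. emeasure \<omega> (cell K n j))"
proof (rule sum_emeasure[symmetric])
  show "cell K n ` J \<subseteq> sets \<omega>" using assms(1) by auto
  show "disjoint_family_on (cell K n) J" unfolding disjoint_family_on_def using cell_disjoint by blast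
qed fact

text \<open>The labels at all lattice points of the box are predicted from one family of cell
  counts. A prediction fails with probability at most \<open>2 * e\<close>: one \<open>e\<close> for
  approximating \<open>\<xi>\<close> by finitely many counts, which invariance carries to every
  lattice point, and one for replacing translated sets by unions of cells. The constant
  \<open>c\<close> may depend on \<open>e\<close>, but not on \<open>n\<close>.\<close>

lemma window_entropy_le:
  fixes \<xi> :: "real measure \<Rightarrow> nat" and dummy :: "'d::finite itself"
  assumes \<xi>: "finite_partition poisson_lines \<xi>" and k: "\<And>\<omega>. \<omega> \<in> space poisson_lines \<Longrightarrow> \<xi> \<omega> < k" and e: "0 < e"
  shows "\<exists>c. \<forall>n\<ge>1. partition_entropy poisson_lines (join_partition \<xi> (\<lambda>z :: int ^ 'd. translate_lines (lattice_point z)) (integer_box n))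
    \<le> c * (real n * sqrt (real n)) + real (n ^ CARD('d)) * (2 * real (Suc k) * sqrt (2 * e))"
proof -
  let ?P = "poisson_lines"
  obtain F \<psi> where F: "signature_set F" "\<And>S. \<psi> S < k" "measure ?P {\<omega> \<in> space ?P. \<xi> \<omega> \<noteq> \<psi> (signature F \<omega>)} < e"
    using label_approx[OF \<xi> k e] by blast
  have finF: "finite F" and Fb: "\<And>q. q \<in> F \<Longrightarrow> fst q \<in> sets borel" and Ffin: "\<And>q. q \<in> F \<Longrightarrow> emeasure line_measure (fst q) < \<infinity>"
    using F(1) by (auto simp: signature_set_def)
  \<comment> \<open>The errors of all sets in \<open>F\<close> then add up to at most
    \<open>e\<close>; the summand 1 covers an empty \<open>F\<close>.\<close>
  define \<delta> where "\<delta> = e / (real (card F) + 1)"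
  have \<delta>: "0 < \<delta>" using e by (simp add: \<delta>_def)
  have "\<forall>q\<in>F. \<exists>K0. \<forall>K n. \<forall>g :: real ^ 'd. K0 \<le> K \<longrightarrow> 1 \<le> n \<longrightarrow> (\<forall>i. 0 \<le> g $ i \<and> g $ i \<le> real n) \<longrightarrow>
     (\<exists>J\<subseteq>grid K n. emeasure line_measure (sym_diff (translate g -` fst q) (\<Union>j\<in>J. cell K n j)) < ennreal \<delta>)"
    using grid_approx_finite[OF Fb Ffin, where 'd = 'd] \<delta> unfolding grid_approx_def by blast
  then obtain K0 where K0: "\<forall>q\<in>F. \<forall>K n. \<forall>g :: real ^ 'd. K0 q \<le> K \<longrightarrow> 1 \<le> n \<longrightarrow> (\<forall>i. 0 \<le> g $ i \<and> g $ i \<le> real n) \<longrightarrow>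
     (\<exists>J\<subseteq>grid K n. emeasure line_measure (sym_diff (translate g -` fst q) (\<Union>j\<in>J. cell K n j)) < ennreal \<delta>)"
    by (rule bchoice[THEN exE])
  \<comment> \<open>A sum serves as a common upper bound, here for all \<open>K0 q\<close> and below
    for all prescribed counts; the successor gives \<open>1 \<le> K\<close> here and a strict bound
    there.\<close>
  define K where "K = Suc (\<Sum>q\<in>F. K0 q)"
  have K1: "1 \<le> K" by (simp add: K_def)
  have K: "K0 q \<le> K" if "q \<in> F" for q using member_le_sum[of q F K0] finF that by (simp add: K_def)
  define \<kappa> where "\<kappa> = Suc (\<Sum>q\<in>F. snd q)"
  have \<kappa>: "snd q < \<kappa>" if "q \<in> F" for q using member_le_sum[of q F snd] finF that by (simp add: \<kappa>_def)
  have main: "partition_entropy ?P (join_partition \<xi> (\<lambda>z :: int ^ 'd. translate_lines (lattice_point z)) (integer_box n))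
    \<le> 8 * real (Suc \<kappa>) * real K ^ 2 * (real n * sqrt (real n)) + real (n ^ CARD('d)) * (2 * real (Suc k) * sqrt (2 * e))"
    if n: "1 \<le> n" for n
  proof -
    let ?B = "integer_box n :: (int ^ 'd) set"
    have "\<exists>J\<subseteq>grid K n. emeasure line_measure (sym_diff (translate (lattice_point z) -` fst q) (\<Union>j\<in>J. cell K n j)) < ennreal \<delta>"
      if "z \<in> ?B" "q \<in> F" for z q
    proof -
      have "0 \<le> lattice_point z $ i \<and> lattice_point z $ i \<le> real n" for i
      proof -
        have "0 \<le> z $ i" "z $ i < int n" using that(1) by (auto simp: integer_box_def)
        then have "(0::real) \<le> of_int (z $ i)" "of_int (z $ i) \<le> real n" by linarith+
        then show ?thesis by (simp add: lattice_point_def)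
      qed
      then show ?thesis using K0 K[OF that(2)] n that(2) by blast
    qed
    then have "\<forall>z q. \<exists>J. z \<in> ?B \<longrightarrow> q \<in> F \<longrightarrow> J \<subseteq> grid K n \<and>
      emeasure line_measure (sym_diff (translate (lattice_point z) -` fst q) (\<Union>j\<in>J. cell K n j)) < ennreal \<delta>" by blast
    then obtain J where J: "\<And>z q. z \<in> ?B \<Longrightarrow> q \<in> F \<Longrightarrow> J z q \<subseteq> grid K n"
      "\<And>z q. z \<in> ?B \<Longrightarrow> q \<in> F \<Longrightarrow> emeasure line_measure (sym_diff (translate (lattice_point z) -` fst q) (\<Union>j\<in>J z q. cell K n j)) < ennreal \<delta>"
      by metis
    define U where "U z q = (\<Union>j\<in>J z q. cell K n j)" for z q
    have U: "U z q \<in> sets borel" if "z \<in> ?B" "q \<in> F" for z q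
      unfolding U_def by (rule cell_Union_sets[OF J(1)[OF that]])
    \<comment> \<open>The predicted label at \<open>z\<close>: the signature is computed with unions
      of cells in place of the translated sets.\<close>
    define Y where "Y z \<omega> = \<psi> {q \<in> F. emeasure \<omega> (U z q) = of_nat (snd q)}" for z and \<omega> :: "real measure"
    define c where "c \<omega> = (\<lambda>j\<in>grid K n. truncated_count \<kappa> (emeasure \<omega> (cell K n j)))" for \<omega> :: "real measure"
    define X where "X z \<omega> = \<xi> (translate_lines (lattice_point z) \<omega>)" for z :: "int ^ 'd" and \<omega>
    have cs: "simple_function ?P c"
      unfolding c_def[abs_def] by (rule lines.simple_function_restrict[OF finite_grid simple_function_truncated_count])
    have Ys: "simple_function ?P (Y z)" for z
    proof -
      have "simple_function ?P (\<lambda>\<omega>. {q \<in> F. emeasure \<omega> (U z q) = of_nat (snd q)})"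
        by (rule simple_function_subset_selection[OF finF]) (simp only: lines.space_P lines.count_event)
      from simple_function_compose1[OF this, of \<psi>] show ?thesis by (simp add: Y_def[abs_def])
    qed
    have Xs: "simple_function ?P (X z)" for z
      unfolding X_def[abs_def] by (rule lines.simple_function_finite_partition[OF \<xi> measurable_translate_lines])
    have err: "measure ?P {\<omega> \<in> space ?P. X z \<omega> \<noteq> Y z \<omega>} \<le> 2 * e" if z: "z \<in> ?B" for z
    proof -
      let ?g = "lattice_point z"
      define E1 where "E1 = {\<omega> \<in> space ?P. \<xi> \<omega> \<noteq> \<psi> (signature F \<omega>)}"
      define E2 where "E2 = {\<omega> \<in> space ?P. \<exists>q\<in>F. emeasure \<omega> (translate ?g -` fst q) \<noteq> emeasure \<omega> (U z q)}"
      have E1: "E1 \<in> sets ?P"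
      proof -
        have "simple_function ?P (\<lambda>\<omega>. (\<xi> \<omega>, signature F \<omega>))"
          using lines.simple_function_finite_partition[OF \<xi> measurable_ident] simple_function_signature[OF finF]
          by (intro simple_function_Pair) auto
        from simple_functionD(2)[OF this, of "{p. fst p \<noteq> \<psi> (snd p)}"]
        have "(\<lambda>\<omega>. (\<xi> \<omega>, signature F \<omega>)) -` {p. fst p \<noteq> \<psi> (snd p)} \<inter> space ?P \<in> sets ?P" .
        also have "(\<lambda>\<omega>. (\<xi> \<omega>, signature F \<omega>)) -` {p. fst p \<noteq> \<psi> (snd p)} \<inter> space ?P = E1"
          by (auto simp: E1_def)
        finally show ?thesis .
      qed
      have E2: "E2 \<in> sets ?P"
      proof -
        have "{\<omega> \<in> space ?P. emeasure \<omega> A \<noteq> emeasure \<omega> B} \<in> sets ?P" for A B by measurable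
        then show ?thesis unfolding E2_def by (intro sets.sets_Collect_finite_Ex finF)
      qed
      let ?V1 = "translate_lines ?g -` E1 \<inter> space ?P"
      have V1: "?V1 \<in> sets ?P" by (rule translate_lines_vimage_sets[OF E1])
      have sub: "{\<omega> \<in> space ?P. X z \<omega> \<noteq> Y z \<omega>} \<subseteq> ?V1 \<union> E2"
      proof (rule subsetI, rule ccontr)
        fix \<omega> assume \<omega>: "\<omega> \<in> {\<omega> \<in> space ?P. X z \<omega> \<noteq> Y z \<omega>}" and no: "\<omega> \<notin> ?V1 \<union> E2"
        then have conf: "\<omega> \<in> configurations line_measure" by simp
        have 1: "X z \<omega> = \<psi> (signature F (translate_lines ?g \<omega>))"
          using no \<omega> translate_lines_configuration[OF conf, of ?g] by (auto simp: E1_def X_def)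
        have "emeasure (translate_lines ?g \<omega>) (fst q) = emeasure \<omega> (U z q)" if "q \<in> F" for q
          using no \<omega> that emeasure_translate_lines[OF conf Fb[OF that], of ?g] by (auto simp: E2_def)
        then have "signature F (translate_lines ?g \<omega>) = {q \<in> F. emeasure \<omega> (U z q) = of_nat (snd q)}"
          unfolding signature_def by (intro Collect_cong conj_cong refl) simp
        then show False using 1 \<omega> by (simp add: Y_def)
      qed
      have m2: "measure ?P E2 \<le> e"
      proof -
        have "emeasure ?P E2 \<le> (\<Sum>q\<in>F. emeasure line_measure (sym_diff (translate ?g -` fst q) (U z q)))"
          unfolding E2_def by (rule emeasure_count_differs[OF finF translate_vimage_sets[OF Fb] U[OF z]])
        also have "\<dots> \<le> (\<Sum>q\<in>F. ennreal \<delta>)"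
          using J(2)[OF z] unfolding U_def by (intro sum_mono less_imp_le)
        also have "\<dots> = ennreal (real (card F) * \<delta>)" using \<delta> by (simp add: ennreal_mult ennreal_of_nat_eq_real_of_nat)
        also have "\<dots> \<le> ennreal e" using e by (intro ennreal_leI) (simp add: \<delta>_def divide_simps)
        finally show ?thesis using e by (simp add: lines.emeasure_eq_measure)
      qed
      have m1: "measure ?P ?V1 < e"
        using F(3) emeasure_translate_lines_vimage[OF E1, of ?g] unfolding E1_def by (simp add: measure_def)
      have "measure ?P {\<omega> \<in> space ?P. X z \<omega> \<noteq> Y z \<omega>} \<le> measure ?P (?V1 \<union> E2)"
        by (rule lines.finite_measure_mono[OF sub sets.Un[OF V1 E2]])
      also have "\<dots> \<le> measure ?P ?V1 + measure ?P E2" by (rule measure_Un_le[OF V1 E2])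
      also have "\<dots> \<le> 2 * e" using m1 m2 by linarith
      finally show ?thesis .
    qed
    have Xk: "X z \<omega> < k" if "\<omega> \<in> space ?P" for z \<omega>
      unfolding X_def by (rule k[OF measurable_space[OF measurable_translate_lines that]])
    have "partition_entropy ?P (\<lambda>\<omega>. \<lambda>z\<in>?B. X z \<omega>) \<le> partition_entropy ?P (\<lambda>\<omega>. \<lambda>z\<in>?B. Y z \<omega>) + real (card ?B) * (2 * real (Suc k) * sqrt (2 * e))"
      by (rule lines.partition_entropy_approx[OF card_integer_box(1) Xs Ys Xk err])
    also have "partition_entropy ?P (\<lambda>\<omega>. \<lambda>z\<in>?B. Y z \<omega>) \<le> partition_entropy ?P c"
    proof -
      \<comment> \<open>Prescribed counts lie below \<open>\<kappa>\<close>, so the truncated cell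
        counts decide them, and the predictions at all lattice points are one function of
        \<open>c\<close>.\<close>
      define h where "h v = (\<lambda>z\<in>?B. \<psi> {q \<in> F. (\<Sum>j\<in>J z q. v j) = snd q})" for v :: "int \<times> int \<Rightarrow> nat"
      have eq: "(\<lambda>z\<in>?B. Y z \<omega>) = h (c \<omega>)" if \<omega>: "\<omega> \<in> space ?P" for \<omega>
      proof -
        have conf: "\<omega> \<in> configurations line_measure" using \<omega> by simp
        have iff: "emeasure \<omega> (U z q) = of_nat (snd q) \<longleftrightarrow> (\<Sum>j\<in>J z q. c \<omega> j) = snd q" if z: "z \<in> ?B" and q: "q \<in> F" for z q
        proof -
          have fJ: "finite (J z q)" by (rule finite_subset[OF J(1)[OF z q] finite_grid])
          have "emeasure \<omega> (U z q) = (\<Sum>j\<in>J z q. emeasure \<omega> (cell K n j))"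
            unfolding U_def using conf fJ
            by (intro emeasure_sum_cells) auto
          moreover have "(\<Sum>j\<in>J z q. c \<omega> j) = (\<Sum>j\<in>J z q. truncated_count \<kappa> (emeasure \<omega> (cell K n j)))"
            using J(1)[OF z q] by (intro sum.cong) (auto simp: c_def)
          ultimately show ?thesis
            using truncated_count_sum[OF fJ configuration_vals[OF conf] \<kappa>[OF q]] by simp
        qed
        show ?thesis unfolding h_def Y_def by (intro restrict_ext arg_cong[where f = \<psi>] Collect_cong conj_cong refl iff)
      qed
      have hs: "simple_function ?P (\<lambda>\<omega>. h (c \<omega>))" by (rule simple_function_compose1[OF cs])
      have "partition_entropy ?P (\<lambda>\<omega>. \<lambda>z\<in>?B. Y z \<omega>) = partition_entropy ?P (\<lambda>\<omega>. h (c \<omega>))"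
        by (rule lines.partition_entropy_cong[OF hs eq])
      also have "\<dots> \<le> partition_entropy ?P c" by (rule lines.partition_entropy_compose[OF cs])
      finally show ?thesis .
    qed
    also have "partition_entropy ?P c \<le> 8 * real (Suc \<kappa>) * real K ^ 2 * (real n * sqrt (real n))"
      unfolding c_def[abs_def] by (rule grid_entropy_le[OF K1 n])
    finally show ?thesis
      unfolding join_partition_def[abs_def] X_def card_integer_box(2) by simp
  qed
  then show ?thesis by blast
qed

lemma action_entropy_translate_lines:
  assumes d: "CARD('d::finite) \<ge> 2"
  shows "action_entropy poisson_lines (translate_lines :: real ^ 'd \<Rightarrow> _) = 0"
  unfolding action_entropy_def
proof (rule lines.ks_entropy_eq_0I)
  show "translate_lines (lattice_point z) \<in> measurable poisson_lines poisson_lines" for z :: "int ^ 'd"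
    by (rule measurable_translate_lines)
  show "finite (integer_box n :: (int ^ 'd) set)" for n by (rule card_integer_box)
  fix \<xi> :: "real measure \<Rightarrow> nat" and e :: real
  assume \<xi>: "finite_partition poisson_lines \<xi>" and e: "0 < e"
  obtain k where k: "\<And>\<omega>. \<omega> \<in> space poisson_lines \<Longrightarrow> \<xi> \<omega> < k"
  proof -
    have "finite (\<xi> ` space poisson_lines)" using \<xi> by (simp add: finite_partition_def)
    then obtain k where "\<forall>i\<in>\<xi> ` space poisson_lines. i < k" by (metis finite_nat_set_iff_bounded)
    then show ?thesis using that by blast
  qed
  \<comment> \<open>Chosen such that \<open>sqrt (2 * \<epsilon>) = r\<close> and wrong predictions
    cost \<open>e / 2\<close> for each lattice point.\<close>
  define r where "r = e / (4 * real (Suc k))"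
  define \<epsilon> where "\<epsilon> = r\<^sup>2 / 2"
  have r: "0 < r" using e by (simp add: r_def)
  then have \<epsilon>: "0 < \<epsilon>" by (simp add: \<epsilon>_def)
  have "sqrt (2 * \<epsilon>) = r" using r by (simp add: \<epsilon>_def)
  then have sq: "2 * real (Suc k) * sqrt (2 * \<epsilon>) = e / 2" by (simp add: r_def field_simps)
  obtain c where c: "\<And>n. 1 \<le> n \<Longrightarrow> partition_entropy poisson_lines (join_partition \<xi> (\<lambda>z :: int ^ 'd. translate_lines (lattice_point z)) (integer_box n))
    \<le> c * (real n * sqrt (real n)) + real (n ^ CARD('d)) * (2 * real (Suc k) * sqrt (2 * \<epsilon>))"
    using window_entropy_le[OF \<xi> k \<epsilon>, where 'd = 'd] by blast
  have "(\<lambda>n. \<bar>c\<bar> / sqrt (real n)) \<longlonglongrightarrow> 0"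
    by (intro tendsto_divide_0[OF tendsto_const] filterlim_at_top_imp_at_infinity filterlim_compose[OF sqrt_at_top filterlim_real_sequentially])
  then have "eventually (\<lambda>n. \<bar>c\<bar> / sqrt (real n) < e / 2) sequentially" using e by (intro order_tendstoD(2)) auto
  then show "eventually (\<lambda>n. partition_entropy poisson_lines (join_partition \<xi> (\<lambda>z :: int ^ 'd. translate_lines (lattice_point z)) (integer_box n)) /
      real (card (integer_box n :: (int ^ 'd) set)) \<le> e) sequentially"
    using eventually_ge_at_top[of 1]
  proof eventually_elim
    case (elim n)
    define N where "N = real (n ^ CARD('d))"
    have n: "1 \<le> real n" using elim by simp
    have N: "0 < N" using elim by (simp add: N_def)
    \<comment> \<open>The dimension enters here: the box has at least \<open>n ^ 2\<close> points,
      against grid counts of entropy of order \<open>n * sqrt n\<close>.\<close>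
    have "real n ^ 2 \<le> real n ^ CARD('d)" using n d by (intro power_increasing) auto
    then have nN: "real n * real n \<le> N" by (simp add: N_def power2_eq_square)
    have "c * (real n * sqrt (real n)) \<le> \<bar>c\<bar> * (real n * sqrt (real n))" using n by (intro mult_right_mono) auto
    also have "\<dots> = \<bar>c\<bar> / sqrt (real n) * (real n * real n)"
      using n by (simp add: field_simps real_sqrt_mult_self)
    also have "\<dots> \<le> e / 2 * (real n * real n)" using elim by (intro mult_right_mono) auto
    also have "\<dots> \<le> e / 2 * N" using nN e by (intro mult_left_mono) auto
    finally have "partition_entropy poisson_lines (join_partition \<xi> (\<lambda>z :: int ^ 'd. translate_lines (lattice_point z)) (integer_box n)) \<le> e / 2 * N + N * (e / 2)"
      using c[of n] elim unfolding sq N_def by linarith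
    also have "\<dots> = e * N" by simp
    finally show ?case using N unfolding card_integer_box(2) N_def[symmetric] by (simp add: pos_divide_le_eq)
  qed
qed

section \<open>Every nontrivial translation is Bernoullian\<close>

text \<open>\<open>N\<close> is the image law of \<open>\<phi>\<close>, so a measurable property of
  almost all \<open>\<phi> x\<close> holds almost everywhere in \<open>N\<close>; the second inverse
  relation thus follows from the first.\<close>

lemma iso_mod0I:
  assumes \<phi>: "\<phi> \<in> measurable M N" "distr M N \<phi> = N" and \<psi>: "\<psi> \<in> measurable N M"
    and inv: "AE x in M. \<psi> (\<phi> x) = x" and meas: "{y \<in> space N. \<phi> (\<psi> y) = y} \<in> sets N"
  shows "iso_mod0 M N \<phi>"
proof -
  have "AE x in M. \<phi> (\<psi> (\<phi> x)) = \<phi> x" using inv by eventually_elim simp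
  then have "AE y in distr M N \<phi>. \<phi> (\<psi> y) = y" by (subst AE_distr_iff[OF \<phi>(1) meas])
  then have "AE y in N. \<phi> (\<psi> y) = y" by (simp only: \<phi>(2))
  then show ?thesis unfolding iso_mod0_def using \<phi> \<psi> inv by blast
qed

text \<open>Dividing the offset by the slope measures it in steps of \<open>g\<close>: up to a null
  set, the slab with \<open>m = 1\<close> and \<open>l = 0\<close> is a fundamental domain for the
  translations by multiples of \<open>g\<close>, and a larger \<open>m\<close> cuts it into
  \<open>m\<close> layers of equal mass. With slope 0 excluded, a step of \<open>g\<close> always
  shifts the index by \<open>m\<close>.\<close>

definition slab :: "nat \<Rightarrow> real ^ 'd::finite \<Rightarrow> int \<Rightarrow> real set" where
  "slab m g l = {x. is_line x \<and> slope g (direction x) \<noteq> 0 \<and> \<lfloor>real m * (offset x / slope g (direction x))\<rfloor> = l}"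

lemma slab_sets [measurable]: "slab m g l \<in> sets borel"
proof -
  have "(\<lambda>x. slope g (direction x)) \<in> borel_measurable borel"
    by (rule measurable_compose[OF measurable_direction measurable_slope])
  then have "{x \<in> space borel. is_line x \<and> slope g (direction x) \<noteq> 0 \<and> \<lfloor>real m * (offset x / slope g (direction x))\<rfloor> = l} \<in> sets borel"
    by measurable
  then show ?thesis by (simp add: slab_def)
qed

lemma slab_disjoint: "l \<noteq> l' \<Longrightarrow> slab m g l \<inter> slab m g l' = {}"
  by (auto simp: slab_def)

lemma translate_vimage_slab: "translate (of_int n *\<^sub>R g) -` slab m g l = slab m g (l - int m * n)"
proof (intro set_eqI)
  fix x
  show "x \<in> translate (of_int n *\<^sub>R g) -` slab m g l \<longleftrightarrow> x \<in> slab m g (l - int m * n)"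
  proof (cases "is_line x \<and> slope g (direction x) \<noteq> 0")
    case True
    let ?c = "slope g (direction x)"
    have "real m * ((offset x + of_int n * ?c) / ?c) = real m * (offset x / ?c) + of_int (int m * n)"
      using True by (simp add: field_simps)
    then have "\<lfloor>real m * ((offset x + of_int n * ?c) / ?c)\<rfloor> = \<lfloor>real m * (offset x / ?c)\<rfloor> + int m * n"
      by (simp only: floor_add_int)
    then show ?thesis using True by (auto simp: slab_def translate_def offset_drift slope_scaleR)
  next
    case False
    then show ?thesis by (auto simp: slab_def translate_def)
  qed
qed

lemma emeasure_lborel_floor_divide:
  assumes m: "1 \<le> m" and c: "c \<noteq> 0"
  shows "emeasure lborel {t::real. \<lfloor>real m * (t / c)\<rfloor> = l} = ennreal (\<bar>c\<bar> / real m)"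
proof (cases "0 < c")
  case True
  then show ?thesis using m emeasure_vimage_floor_mult[of "real m / c" l] by simp
next
  \<comment> \<open>For negative \<open>c\<close> the interval is half-open at the other end; its
    length is the same.\<close>
  case False
  then have c0: "c < 0" using c by simp
  define r where "r = real m / (- c)"
  have r: "0 < r" unfolding r_def by (rule divide_pos_pos) (use m c0 in auto)
  have "real m * (t / c) = - (r * t)" for t using c by (simp add: r_def)
  then have "{t::real. \<lfloor>real m * (t / c)\<rfloor> = l} = {t. of_int l \<le> - (r * t) \<and> - (r * t) < of_int l + 1}"
    by (simp add: floor_eq_iff)
  also have "\<dots> = {- (of_int l + 1) / r<..- of_int l / r}"
  proof -
    have "of_int l \<le> - (r * t) \<longleftrightarrow> t \<le> - of_int l / r" "- (r * t) < of_int l + 1 \<longleftrightarrow> - (of_int l + 1) / r < t" for t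
      unfolding pos_le_divide_eq[OF r] pos_divide_less_eq[OF r] mult.commute[of t r] by linarith+
    then show ?thesis by (simp only: greaterThanAtMost_iff set_eq_iff mem_Collect_eq) blast
  qed
  also have "emeasure lborel \<dots> = ennreal (- of_int l / r - - (of_int l + 1) / r)"
    using r by (intro emeasure_lborel_Ioc divide_right_mono) auto
  also have "- of_int l / r - - (of_int l + 1) / r = \<bar>c\<bar> / real m"
  proof -
    have "- of_int l / r - - (of_int l + 1) / r = 1 / r" unfolding diff_divide_distrib[symmetric] by simp
    also have "1 / r = \<bar>c\<bar> / real m" using c0 by (simp add: r_def)
    finally show ?thesis .
  qed
  finally show ?thesis .
qed

text \<open>The mass of the fundamental domain for \<open>g \<noteq> 0\<close>: the mean length of
  the step that \<open>g\<close> makes in offset.\<close>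

definition slab_mass :: "real ^ 'd::finite \<Rightarrow> real" where
  "slab_mass g = enn2real (\<integral>\<^sup>+y. ennreal \<bar>slope g y\<bar> \<partial>unit_uniform)"

lemma slab_mass:
  assumes g: "g \<noteq> 0"
  shows "0 < slab_mass g" "(\<integral>\<^sup>+y. ennreal \<bar>slope g y\<bar> \<partial>unit_uniform) = ennreal (slab_mass g)"
proof -
  interpret prob_space unit_uniform by (rule prob_space_unit_uniform)
  let ?I = "\<integral>\<^sup>+y. ennreal \<bar>slope g y\<bar> \<partial>unit_uniform"
  have "?I \<le> (\<integral>\<^sup>+y. ennreal (\<Sum>i\<in>UNIV. \<bar>g $ i\<bar>) \<partial>unit_uniform)"
  proof (rule nn_integral_mono_AE)
    show "AE y in unit_uniform. ennreal \<bar>slope g y\<bar> \<le> ennreal (\<Sum>i\<in>UNIV. \<bar>g $ i\<bar>)"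
      using AE_unit_uniform by eventually_elim (intro ennreal_leI abs_slope_le, simp_all)
  qed
  also have "\<dots> = ennreal (\<Sum>i\<in>UNIV. \<bar>g $ i\<bar>)" using emeasure_space_1 by simp
  finally have fin: "?I < \<infinity>" by (simp add: le_less_trans)
  have "?I \<noteq> 0"
  proof
    assume "?I = 0"
    then have "AE y in unit_uniform. ennreal \<bar>slope g y\<bar> = 0"
      by (subst (asm) nn_integral_0_iff_AE) measurable
    with AE_slope[OF g] have "AE y in unit_uniform. False" by eventually_elim simp
    then show False by simp
  qed
  then show "?I = ennreal (slab_mass g)" "0 < slab_mass g"
    using fin unfolding slab_mass_def by (simp_all add: enn2real_positive_iff zero_less_iff_neq_zero)
qed

lemma emeasure_slab:
  assumes g: "g \<noteq> 0" and m: "1 \<le> m"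
  shows "emeasure line_measure (slab m g l) = ennreal (slab_mass g / real m)"
proof -
  have "emeasure line_measure (slab m g l) = (\<integral>\<^sup>+y. emeasure lborel {t. line y t \<in> slab m g l} \<partial>unit_uniform)"
    by (rule emeasure_line_measure) simp
  also have "\<dots> = (\<integral>\<^sup>+y. ennreal \<bar>slope g y\<bar> * ennreal (1 / real m) \<partial>unit_uniform)"
  proof (rule nn_integral_cong_AE)
    show "AE y in unit_uniform. emeasure lborel {t. line y t \<in> slab m g l} = ennreal \<bar>slope g y\<bar> * ennreal (1 / real m)"
      using AE_slope[OF g]
    proof eventually_elim
      case (elim y)
      then have "{t. line y t \<in> slab m g l} = {t. \<lfloor>real m * (t / slope g y)\<rfloor> = l}" by (simp add: slab_def)
      then show ?case using emeasure_lborel_floor_divide[OF m elim] by (simp add: ennreal_mult'[symmetric])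
    qed
  qed
  also have "\<dots> = ennreal (slab_mass g) * ennreal (1 / real m)"
    by (subst nn_integral_multc) (simp_all add: slab_mass(2)[OF g])
  also have "\<dots> = ennreal (slab_mass g / real m)"
    using slab_mass(1)[OF g] by (simp add: ennreal_mult[symmetric])
  finally show ?thesis .
qed

lemma emeasure_slab_Union:
  assumes g: "g \<noteq> 0"
  shows "emeasure line_measure (UNIV - (\<Union>l. slab 1 g l)) = 0"
proof -
  have "AE x in line_measure. slope g (direction x) \<noteq> 0"
  proof (rule AE_line_measure)
    have "(\<lambda>x. slope g (direction x)) \<in> borel_measurable borel"
      by (rule measurable_compose[OF measurable_direction measurable_slope])
    then show "Measurable.pred borel (\<lambda>x. slope g (direction x) \<noteq> 0)" by measurable
    show "AE y in unit_uniform. \<forall>t. slope g (direction (line y t)) \<noteq> 0"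
      using AE_slope[OF g] by simp
  qed
  then have "AE x in line_measure. x \<notin> UNIV - (\<Union>l. slab 1 g l)"
    using AE_is_line by eventually_elim (simp add: slab_def)
  moreover have "UNIV - (\<Union>l. slab 1 g l) \<in> sets borel" by (intro sets.Diff sets.countable_UN) auto
  ultimately have "UNIV - (\<Union>l. slab 1 g l) \<in> null_sets line_measure"
    by (simp only: AE_iff_null_sets sets_line_measure)
  then show ?thesis by (rule null_setsD1)
qed

text \<open>The content of slab \<open>- n\<close>, translated to slab 0 and packed into one real. A
  fixed reference slab makes all sites follow the same law and turns the action of \<open>g\<close>
  into a shift of \<open>n\<close>.\<close>

definition site_code :: "real ^ 'd::finite \<Rightarrow> int \<Rightarrow> real measure \<Rightarrow> real" where
  "site_code g n \<omega> = seq_enc (config_code (slab 1 g 0) (translate_lines (of_int n *\<^sub>R g) \<omega>))"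

text \<open>Counts of the translated configuration within slab 0 are counts of the original one
  within slab \<open>- n\<close>. So the code is measurable for the algebra of that slab alone, and
  disjoint slabs yield independence.\<close>

lemma measurable_site_code:
  assumes g: "g \<noteq> 0"
  shows "site_code g n \<in> borel_measurable (count_algebra line_measure (slab 1 g (- n)))"
proof -
  let ?T = "translate (of_int n *\<^sub>R g)" and ?N = "count_algebra line_measure (slab 1 g (- n))"
  have m: "(\<lambda>\<omega>. emeasure (translate_lines (of_int n *\<^sub>R g) \<omega>) (slab 1 g 0 \<inter> B)) \<in> borel_measurable ?N" if B: "B \<in> sets borel" for B
  proof -
    have AB: "slab 1 g 0 \<inter> B \<in> sets borel" using B by simp
    have sub: "?T -` (slab 1 g 0 \<inter> B) \<subseteq> slab 1 g (- n)"
      using translate_vimage_slab[of n g 1 0] by auto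
    have "emeasure line_measure (?T -` (slab 1 g 0 \<inter> B)) \<le> emeasure line_measure (slab 1 g (- n))"
      by (rule emeasure_mono[OF sub]) simp
    also have "\<dots> < \<infinity>" by (simp add: emeasure_slab[OF g])
    finally have "(\<lambda>\<omega>. emeasure \<omega> (?T -` (slab 1 g 0 \<inter> B))) \<in> borel_measurable ?N"
      using sub translate_vimage_sets[OF AB] by (intro measurable_count_algebra) simp_all
    then show ?thesis
      by (subst measurable_cong[where g = "\<lambda>\<omega>. emeasure \<omega> (?T -` (slab 1 g 0 \<inter> B))"])
        (simp_all only: space_count_algebra emeasure_translate_lines[OF _ AB])
  qed
  have "(\<lambda>\<omega>. config_code (slab 1 g 0) (translate_lines (of_int n *\<^sub>R g) \<omega>) j) \<in> borel_measurable ?N" for j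
  proof (rule measurable_config_code)
    show "(\<lambda>\<omega>. emeasure (translate_lines (of_int n *\<^sub>R g) \<omega>) (slab 1 g 0 \<inter> {..q})) \<in> borel_measurable ?N" for q
      by (rule m) simp
    show "(\<lambda>\<omega>. emeasure (translate_lines (of_int n *\<^sub>R g) \<omega>) (slab 1 g 0)) \<in> borel_measurable ?N"
      using m[of UNIV] by simp
  qed
  then show ?thesis unfolding site_code_def[abs_def] by (rule measurable_seq_enc)
qed

lemma indep_site_code:
  assumes g: "g \<noteq> 0"
  shows "lines.indep_vars (\<lambda>_. borel) (site_code g) UNIV"
proof -
  have "disjoint_family_on (\<lambda>n. slab 1 g (- n)) UNIV"
    unfolding disjoint_family_on_def using slab_disjoint[of _ _ 1 g] by auto
  then have i: "lines.indep_sets (\<lambda>n. sets (count_algebra line_measure (slab 1 g (- n)))) UNIV"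
    by (rule lines.indep_sets_count_algebra)
  have rv: "site_code g n \<in> borel_measurable poisson_lines" for n
    using measurable_site_code[OF g, of n] sets_count_algebra_subset[of line_measure "slab 1 g (- n)"]
    by (auto simp: measurable_def)
  have sub: "{site_code g n -` A \<inter> space poisson_lines |A. A \<in> sets borel} \<subseteq> sets (count_algebra line_measure (slab 1 g (- n)))" for n
    using measurable_sets[OF measurable_site_code[OF g, of n]] by auto
  show ?thesis
    unfolding lines.indep_vars_def2 using rv lines.indep_sets_mono_sets[OF i sub] by blast
qed

text \<open>\<open>\<phi>\<close> lists the site codes, which are independent by
  \<open>indep_site_code\<close> and have the common law \<open>B\<close> by invariance, so its law
  is the product. \<open>\<psi>\<close> decodes every site and moves its points back to their
  slab.\<close>

lemma bernoullian_translate_lines: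
  assumes g: "g \<noteq> 0"
  shows "bernoullian poisson_lines (translate_lines g)"
proof -
  let ?P = "poisson_lines"
  define V where "V n = translate_lines (of_int n *\<^sub>R g)" for n :: int
  define T where "T n = translate (of_int n *\<^sub>R g)" for n :: int
  define W where "W n = slab 1 g n" for n :: int
  have W: "W n \<in> sets borel" for n by (simp add: W_def)
  have TW: "T n -` W 0 = W (- n)" for n
    unfolding T_def W_def using translate_vimage_slab[of n g 1 0] by simp
  define B where "B = distr ?P borel (site_code g 0)"
  have rv: "site_code g n \<in> borel_measurable ?P" for n
    using indep_site_code[OF g] unfolding lines.indep_vars_def by blast
  have B: "prob_space B" unfolding B_def by (rule lines.prob_space_distr[OF rv])
  have setsB: "sets B = sets borel" by (simp add: B_def)
  have sitelaw: "distr ?P borel (site_code g n) = B" for n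
  proof -
    have "site_code g n \<omega> = (site_code g 0 \<circ> V n) \<omega>" if "\<omega> \<in> space ?P" for \<omega>
      using that by (simp add: site_code_def V_def translate_lines_0 translate_lines_configuration)
    then have "distr ?P borel (site_code g n) = distr ?P borel (site_code g 0 \<circ> V n)"
      by (intro distr_cong) auto
    also have "\<dots> = distr (distr ?P ?P (V n)) borel (site_code g 0)"
      unfolding V_def by (rule distr_distr[symmetric, OF rv measurable_translate_lines])
    also have "\<dots> = B" unfolding V_def distr_translate_lines B_def ..
    finally show ?thesis .
  qed
  define N where "N = PiM (UNIV :: int set) (\<lambda>_. B)"
  define \<phi> where "\<phi> \<omega> n = site_code g n \<omega>" for \<omega> n
  define \<psi> where "\<psi> b = glue line_measure (\<lambda>n. T (- n)) (\<lambda>n. seq_dec (b n))" for b :: "int \<Rightarrow> real"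
  have setsN: "sets N = sets (PiM (UNIV :: int set) (\<lambda>_. borel))"
    unfolding N_def by (intro sets_PiM_cong refl setsB)
  have \<phi>m: "\<phi> \<in> measurable ?P N"
    unfolding measurable_cong_sets[OF refl setsN] \<phi>_def using rv by (intro measurable_PiM_single') auto
  have \<phi>d: "distr ?P N \<phi> = N"
  proof -
    have "distr ?P (PiM UNIV (\<lambda>_::int. borel)) (\<lambda>\<omega>. \<lambda>i\<in>UNIV. site_code g i \<omega>) = PiM UNIV (\<lambda>i. distr ?P borel (site_code g i))"
      using lines.indep_vars_iff_distr_eq_PiM'[where I = UNIV and M' = "\<lambda>_. borel" and X = "site_code g"] rv indep_site_code[OF g] by simp
    then have "distr ?P (PiM UNIV (\<lambda>_::int. borel)) \<phi> = N"
      unfolding sitelaw N_def by (simp add: restrict_UNIV \<phi>_def[abs_def])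
    moreover have "distr ?P N \<phi> = distr ?P (PiM UNIV (\<lambda>_::int. borel)) \<phi>"
      by (rule distr_cong[OF refl setsN refl])
    ultimately show ?thesis by simp
  qed
  have comp: "(\<lambda>b. b n) \<in> borel_measurable N" for n
    using measurable_component_singleton[of n UNIV "\<lambda>_. borel :: real measure"] by (simp add: measurable_cong_sets[OF setsN refl])
  have \<psi>m: "\<psi> \<in> measurable N ?P"
    unfolding measurable_cong_sets[OF refl lines.sets_P] \<psi>_def[abs_def]
  proof (rule measurable_glue)
    show "(\<lambda>b. seq_dec (b n) j) \<in> borel_measurable N" for n j by (rule measurable_seq_dec[OF comp])
    show "T (- n) \<in> measurable borel line_measure" for n
      unfolding T_def using measurable_translate by (simp add: measurable_cong_sets[OF refl sets_line_measure])
  qed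
  \<comment> \<open>The configurations left out have infinitely many points in some slab or a point
    outside all slabs; both happen with probability 0.\<close>
  have inv: "\<psi> (\<phi> \<omega>) = \<omega>" if conf: "\<omega> \<in> configurations line_measure" and fin: "\<forall>n. emeasure \<omega> (W n) < \<infinity>"
    and null: "emeasure \<omega> (UNIV - (\<Union>n. W n)) = 0" for \<omega>
  proof -
    have s\<omega>: "sets \<omega> = sets borel" using conf by simp
    have e: "emeasure (V n \<omega>) A = emeasure \<omega> (T n -` A)" if "A \<in> sets borel" for n A
      unfolding V_def T_def by (rule emeasure_translate_lines[OF conf that])
    have "glue line_measure (\<lambda>n. T (- n)) (\<lambda>n. config_code (W 0) (V n \<omega>)) = \<omega>"
    proof (rule glue_config_code[where W = "\<lambda>_. W 0"])
      show "T (- n) \<in> borel_measurable borel" for n unfolding T_def by (rule measurable_translate)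
      show "V n \<omega> \<in> configurations line_measure" for n unfolding V_def by (rule translate_lines_configuration[OF conf])
      show "emeasure (V n \<omega>) (W 0) < \<infinity>" for n using fin by (simp add: e[OF W] TW)
      fix A :: "real set" assume A: "A \<in> sets borel"
      have "emeasure (V n \<omega>) (W 0 \<inter> T (- n) -` A) = emeasure \<omega> (W (- n) \<inter> A)" for n
      proof -
        have "T (- n) -` A \<in> sets borel" unfolding T_def by (rule translate_vimage_sets[OF A])
        then have "emeasure (V n \<omega>) (W 0 \<inter> T (- n) -` A) = emeasure \<omega> (T n -` (W 0 \<inter> T (- n) -` A))"
          by (intro e sets.Int W)
        also have "T n -` (W 0 \<inter> T (- n) -` A) = W (- n) \<inter> A"
        proof -
          have "T (- n) (T n x) = x" for x unfolding T_def by (simp add: translate_add[symmetric])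
          then show ?thesis unfolding vimage_Int TW by auto
        qed
        finally show ?thesis .
      qed
      then have "(\<integral>\<^sup>+n. emeasure (V n \<omega>) (W 0 \<inter> T (- n) -` A) \<partial>count_space UNIV) = (\<integral>\<^sup>+n. emeasure \<omega> (W (- n) \<inter> A) \<partial>count_space UNIV)"
        by simp
      also have "\<dots> = emeasure \<omega> (\<Union>n. W (- n) \<inter> A)"
      proof (rule emeasure_UN_countable[symmetric])
        show "disjoint_family_on (\<lambda>n. W (- n) \<inter> A) UNIV"
          unfolding disjoint_family_on_def
        proof (intro ballI impI)
          fix n n' :: int assume "n \<noteq> n'"
          then have "W (- n) \<inter> W (- n') = {}" unfolding W_def by (intro slab_disjoint) simp
          then show "W (- n) \<inter> A \<inter> (W (- n') \<inter> A) = {}" by blast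
        qed
      qed (use A W in \<open>simp_all add: s\<omega>\<close>)
      also have "\<dots> = emeasure \<omega> A"
      proof (rule emeasure_eq_AE)
        have "UNIV - (\<Union>n. W n) \<in> sets \<omega>" unfolding s\<omega> using W by (intro sets.Diff sets.countable_UN) auto
        then have N0: "UNIV - (\<Union>n. W n) \<in> null_sets \<omega>" by (rule null_setsI[OF null])
        show "AE x in \<omega>. x \<in> (\<Union>n. W (- n) \<inter> A) \<longleftrightarrow> x \<in> A"
          using AE_not_in[OF N0]
        proof eventually_elim
          case (elim x)
          then obtain n where "x \<in> W n" by blast
          then have "x \<in> W (- (- n))" by simp
          then show ?case by blast
        qed
        have "W (- n) \<inter> A \<in> sets \<omega>" for n unfolding s\<omega> by (rule sets.Int[OF W A])
        then show "(\<Union>n. W (- n) \<inter> A) \<in> sets \<omega>" by (intro sets.countable_UN) blast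
        show "A \<in> sets \<omega>" unfolding s\<omega> by (rule A)
      qed
      finally show "emeasure \<omega> A = (\<integral>\<^sup>+n. emeasure (V n \<omega>) (W 0 \<inter> T (- n) -` A) \<partial>count_space UNIV)" by simp
    qed (simp_all add: W conf)
    then show ?thesis by (simp add: \<psi>_def \<phi>_def site_code_def V_def W_def)
  qed
  have "AE \<omega> in ?P. \<forall>n. emeasure \<omega> (W n) < \<infinity>"
    unfolding AE_all_countable W_def by (intro allI lines.AE_count_finite) (simp_all add: emeasure_slab[OF g])
  moreover have "AE \<omega> in ?P. emeasure \<omega> (UNIV - (\<Union>n. W n)) = 0"
  proof (rule lines.AE_count_0)
    show "UNIV - (\<Union>n. W n) \<in> sets line_measure" using W by (auto intro!: sets.Diff sets.countable_UN)
    show "emeasure line_measure (UNIV - (\<Union>n. W n)) = 0" unfolding W_def by (rule emeasure_slab_Union[OF g])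
  qed
  moreover have "AE \<omega> in ?P. \<omega> \<in> configurations line_measure" by (rule AE_lines)
  ultimately have AEinv: "AE \<omega> in ?P. \<psi> (\<phi> \<omega>) = \<omega>" by eventually_elim (rule inv)
  have iso: "iso_mod0 ?P N \<phi>"
  proof (rule iso_mod0I[where \<phi> = \<phi> and \<psi> = \<psi> and M = ?P and N = N, OF \<phi>m \<phi>d \<psi>m AEinv])
    \<comment> \<open>Equality of two sequences indexed by the integers is a countable conjunction
      of measurable conditions.\<close>
    have "(\<lambda>b. \<phi> (\<psi> b) n) \<in> borel_measurable N" for n
      using measurable_compose[OF measurable_compose[OF \<psi>m \<phi>m] comp] by simp
    then have "{b \<in> space N. \<phi> (\<psi> b) n = b n} \<in> sets N" for n
      by (rule measurable_equality_set[OF _ comp])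
    then have "{b \<in> space N. \<forall>n. \<phi> (\<psi> b) n = b n} \<in> sets N" by (rule sets.sets_Collect_countable_All)
    then show "{b \<in> space N. \<phi> (\<psi> b) = b} \<in> sets N" by (simp only: fun_eq_iff)
  qed
  have eqv: "AE \<omega> in ?P. \<phi> (translate_lines g \<omega>) = (\<lambda>n. \<phi> \<omega> (n + 1))"
  proof (rule AE_lines, rule ext)
    fix \<omega> n assume "\<omega> \<in> configurations line_measure"
    from translate_lines_add[OF this, of "of_int n *\<^sub>R g" g]
    show "\<phi> (translate_lines g \<omega>) n = \<phi> \<omega> (n + 1)"
      by (simp add: \<phi>_def site_code_def scaleR_left_distrib)
  qed
  have stB: "standard_measure B"
    by (rule standard_measure_borel[OF setsB]) (rule prob_space_imp_sigma_finite[OF B])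
  show ?thesis
    using B stB iso[unfolded N_def] eqv unfolding bernoullian_def by (intro exI[of _ B] exI[of _ \<phi>] conjI)
qed

section \<open>Infinite entropy of the translations\<close>

text \<open>The layers are disjoint, so the events that they are void are independent, each of
  probability \<open>q\<close>. For the lower bound only the value \<open>False\<close>, of
  probability \<open>1 - q\<close>, is kept in the entropy of each.\<close>

lemma entropy_of_slabs:
  fixes g :: "real ^ 'd::finite" and m n :: nat
  assumes g: "g \<noteq> 0" and m: "1 \<le> m"
  defines "q \<equiv> exp (- (slab_mass g / real m))"
  defines "I \<equiv> {..<n} \<times> {..<m}"
  shows "real n * (real m * - ((1 - q) * ln (1 - q)))
    \<le> partition_entropy poisson_lines (\<lambda>\<omega>. \<lambda>p\<in>I. emeasure \<omega> (slab m g (int (snd p) - int m * int (fst p))) = 0)"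
proof -
  let ?P = "poisson_lines"
  define U where "U p = slab m g (int (snd p) - int m * int (fst p))" for p :: "nat \<times> nat"
  define X where "X p \<omega> = (emeasure \<omega> (U p) = 0)" for p \<omega>
  have U: "U p \<in> sets borel" for p by (simp add: U_def)
  have q: "0 < q" "q < 1" using slab_mass(1)[OF g] m by (auto simp: q_def divide_pos_pos)
  have ev: "{\<omega> \<in> space ?P. X p \<omega>} \<in> sets ?P" "{\<omega> \<in> space ?P. \<not> X p \<omega>} \<in> sets ?P" for p
    unfolding X_def lines.space_P by (rule lines.count_event lines.count_event_not)+
  have pT: "measure ?P {\<omega> \<in> space ?P. X p \<omega>} = q" for p
  proof -
    have "ennreal (measure ?P {\<omega> \<in> space ?P. X p \<omega>}) = laplace (emeasure line_measure (U p))"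
      unfolding lines.emeasure_eq_measure[symmetric] X_def by (rule lines.emeasure_void) (simp add: U)
    also have "\<dots> = ennreal q"
      using slab_mass(1)[OF g] by (simp add: U_def emeasure_slab[OF g m] laplace_ennreal q_def)
    finally show ?thesis using q by simp
  qed
  have pF: "measure ?P {\<omega> \<in> space ?P. \<not> X p \<omega>} = 1 - q" for p
    using lines.prob_neg[OF ev(1)[of p]] pT[of p] by simp
  have vim: "X p -` {b} \<inter> space ?P = (if b then {\<omega> \<in> space ?P. X p \<omega>} else {\<omega> \<in> space ?P. \<not> X p \<omega>})" for p b
    by auto
  have Xs: "simple_function ?P (X p)" for p
    unfolding simple_function_def vim using ev by auto
  have pb: "measure ?P (X p -` {b} \<inter> space ?P) = (if b then q else 1 - q)" for p b
    unfolding vim using pT pF by simp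
  have one: "- ((1 - q) * ln (1 - q)) \<le> partition_entropy ?P (X p)" for p
  proof -
    have F: "False \<in> X p ` space ?P"
    proof (rule ccontr)
      assume "False \<notin> X p ` space ?P"
      then have "X p -` {False} \<inter> space ?P = {}" by auto
      then show False using pb[of p False] q by simp
    qed
    have "- ((1 - q) * ln (1 - q)) \<le> (\<Sum>x\<in>X p ` space ?P. - (measure ?P (X p -` {x} \<inter> space ?P) * ln (measure ?P (X p -` {x} \<inter> space ?P))))"
      using member_le_sum[of False "X p ` space ?P" "\<lambda>x. - (measure ?P (X p -` {x} \<inter> space ?P) * ln (measure ?P (X p -` {x} \<inter> space ?P)))"]
        F lines.mult_ln_nonpos pb[of p False] by simp
    then show ?thesis unfolding lines.partition_entropy_eq[OF Xs] by (simp add: sum_negf)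
  qed
  have dis: "disjoint_family_on U I"
    unfolding disjoint_family_on_def
  proof (intro ballI impI)
    fix p p' assume p: "p \<in> I" "p' \<in> I" "p \<noteq> p'"
    \<comment> \<open>Division with remainder by \<open>m\<close> recovers both coordinates, so
      distinct pairs name distinct layers.\<close>
    have "int (snd p) - int m * int (fst p) \<noteq> int (snd p') - int m * int (fst p')"
    proof
      assume eq: "int (snd p) - int m * int (fst p) = int (snd p') - int m * int (fst p')"
      then have "(int (snd p) - int m * int (fst p)) mod int m = (int (snd p') - int m * int (fst p')) mod int m" by simp
      then have "int (snd p) mod int m = int (snd p') mod int m" by (simp add: mod_diff_eq[symmetric] mod_mult_self1_is_0)
      then have "snd p = snd p'" using p by (auto simp: I_def)
      moreover from this eq have "fst p = fst p'" using m by simp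
      ultimately show False using p(3) by (simp add: prod_eq_iff)
    qed
    then show "U p \<inter> U p' = {}" unfolding U_def by (rule slab_disjoint)
  qed
  have indep: "measure ?P {\<omega> \<in> space ?P. \<forall>p\<in>I. X p \<omega> = x p} = (\<Prod>p\<in>I. measure ?P (X p -` {x p} \<inter> space ?P))" for x
  proof (cases "I = {}")
    case True
    then show ?thesis using lines.prob_space by simp
  next
    case False
    have A: "X p -` {x p} \<inter> space ?P \<in> sets (count_algebra line_measure (U p))" for p
    proof -
      have "(\<lambda>\<omega>. emeasure \<omega> (U p)) \<in> borel_measurable (count_algebra line_measure (U p))"
        by (rule measurable_count_algebra) (simp_all add: U, simp add: U_def emeasure_slab[OF g m])
      from measurable_sets[OF this, of "{0}"] have 0: "{\<omega> \<in> configurations line_measure. emeasure \<omega> (U p) = 0} \<in> sets (count_algebra line_measure (U p))"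
        by (simp add: vimage_def Int_def conj_commute)
      have "{\<omega> \<in> configurations line_measure. emeasure \<omega> (U p) \<noteq> 0} = space (count_algebra line_measure (U p)) - {\<omega> \<in> configurations line_measure. emeasure \<omega> (U p) = 0}"
        by auto
      then have "{\<omega> \<in> configurations line_measure. emeasure \<omega> (U p) \<noteq> 0} \<in> sets (count_algebra line_measure (U p))"
        using sets.compl_sets[OF 0] by (simp only:)
      with 0 show ?thesis unfolding vim by (simp add: X_def)
    qed
    have "measure ?P (\<Inter>p\<in>I. X p -` {x p} \<inter> space ?P) = (\<Prod>p\<in>I. measure ?P (X p -` {x p} \<inter> space ?P))"
      by (rule lines.indep_setsD[OF lines.indep_sets_count_algebra[OF dis] order_refl False]) (simp add: I_def, intro ballI A)
    moreover have "(\<Inter>p\<in>I. X p -` {x p} \<inter> space ?P) = {\<omega> \<in> space ?P. \<forall>p\<in>I. X p \<omega> = x p}"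
      using False by blast
    ultimately show ?thesis by simp
  qed
  have finI: "finite I" by (simp add: I_def)
  have "partition_entropy ?P (\<lambda>\<omega>. \<lambda>p\<in>I. X p \<omega>) = (\<Sum>p\<in>I. partition_entropy ?P (X p))"
    by (rule lines.partition_entropy_indep[OF finI Xs _ indep]) (use pb q in auto)
  moreover have "(\<Sum>p\<in>I. - ((1 - q) * ln (1 - q))) \<le> (\<Sum>p\<in>I. partition_entropy ?P (X p))"
    by (rule sum_mono[OF one])
  moreover have "(\<Sum>p\<in>I. - ((1 - q) * ln (1 - q))) = real n * (real m * - ((1 - q) * ln (1 - q)))"
    by (simp add: I_def card_cartesian_product)
  ultimately show ?thesis unfolding X_def U_def by linarith
qed

text \<open>With a = w/m \<le> 1 a layer is occupied with probability between a/2 and a, so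
  \<open>m\<close> layers together have entropy at least (w/2) ln(m/w), which is unbounded in
  \<open>m\<close>.\<close>

lemma slab_entropy_unbounded:
  assumes w: "0 < w"
  shows "\<exists>m\<ge>1. B \<le> real m * - ((1 - exp (- (w / real m))) * ln (1 - exp (- (w / real m))))"
proof -
  \<comment> \<open>The three bounds give \<open>m \<ge> 1\<close>, \<open>a \<le> 1\<close> and
    \<open>2 * B / w \<le> - ln a\<close>.\<close>
  obtain m :: nat where m: "max (max 1 w) (w * exp (2 * B / w)) \<le> real m" using real_arch_simple by blast
  then have m1: "1 \<le> real m" and mw: "w \<le> real m" and mB: "w * exp (2 * B / w) \<le> real m" by auto
  define a where "a = w / real m"
  have a: "0 < a" "a \<le> 1" using w m1 mw by (auto simp: a_def divide_pos_pos)
  define p where "p = 1 - exp (- a)"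
  have pa: "p \<le> a" using exp_ge_add_one_self[of "- a"] by (simp add: p_def)
  have "exp (- a) \<le> 1 / (1 + a)"
    using exp_ge_add_one_self[of a] a by (simp add: exp_minus inverse_eq_divide frac_le)
  then have "a / (1 + a) \<le> p" using a by (simp add: p_def field_simps)
  moreover have "a / 2 \<le> a / (1 + a)" using a by (intro divide_left_mono) auto
  ultimately have ap: "a / 2 \<le> p" by linarith
  then have p0: "0 < p" using a by linarith
  have lnp: "- ln a \<le> - ln p" using pa p0 by simp
  have lna: "2 * B / w \<le> - ln a"
  proof -
    have "2 * B / w = ln (exp (2 * B / w))" by simp
    also have "\<dots> \<le> ln (real m / w)"
      using mB w m1 by (intro ln_mono) (auto simp: pos_le_divide_eq mult.commute)
    also have "\<dots> = - ln a" using w m1 by (simp add: a_def ln_div)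
    finally show ?thesis .
  qed
  have "0 \<le> - ln a" using a by simp
  have "B = (w / 2) * (2 * B / w)" using w by simp
  also have "\<dots> \<le> (w / 2) * (- ln a)" using lna w by (intro mult_left_mono) auto
  also have "w / 2 = real m * (a / 2)" using m1 by (simp add: a_def)
  also have "real m * (a / 2) * (- ln a) \<le> real m * p * (- ln p)"
    using ap lnp a m1 p0 \<open>0 \<le> - ln a\<close> by (intro mult_mono) auto
  finally have "B \<le> real m * - (p * ln p)" by simp
  then show ?thesis using m1 unfolding p_def a_def by (intro exI[of _ m]) auto
qed

lemma funpow_translate_lines:
  assumes "\<omega> \<in> configurations line_measure"
  shows "(translate_lines g ^^ i) \<omega> = translate_lines (of_int (int i) *\<^sub>R g) \<omega>"
proof (induction i)
  case 0
  then show ?case using assms by (simp add: translate_lines_0)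
next
  case (Suc i)
  have "(translate_lines g ^^ Suc i) \<omega> = translate_lines (g + of_int (int i) *\<^sub>R g) \<omega>"
    using Suc by (simp add: translate_lines_add[OF assms])
  then show ?case by (simp add: scaleR_left_distrib)
qed

text \<open>The partition records which of the \<open>m\<close> layers of the fundamental domain are
  void, the subset being coded as a natural number by \<open>set_encode\<close>. Over
  \<open>n\<close> steps its translates inspect \<open>n * m\<close> disjoint layers, so its entropy
  rate reaches any bound for suitable \<open>m\<close>.\<close>

lemma transformation_entropy_translate_lines:
  assumes g: "g \<noteq> 0"
  shows "transformation_entropy poisson_lines (translate_lines g) = \<infinity>"
  unfolding transformation_entropy_def
proof (rule lines.ks_entropy_eq_topI)
  fix B :: real
  let ?P = "poisson_lines"
  obtain m where m: "1 \<le> m" and mB: "B \<le> real m * - ((1 - exp (- (slab_mass g / real m))) * ln (1 - exp (- (slab_mass g / real m))))"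
    using slab_entropy_unbounded[OF slab_mass(1)[OF g], of B] by blast
  define void where "void \<omega> = {j \<in> {..<m}. emeasure \<omega> (slab m g (int j)) = 0}" for \<omega>
  define \<xi> where "\<xi> \<omega> = set_encode (void \<omega>)" for \<omega>
  have vs: "simple_function ?P void"
    unfolding void_def[abs_def] by (rule simple_function_subset_selection) (simp_all only: finite_lessThan lines.space_P lines.count_event)
  have "simple_function ?P \<xi>" unfolding \<xi>_def[abs_def] by (rule simple_function_compose1[OF vs])
  then have \<xi>: "finite_partition ?P \<xi>"
    unfolding finite_partition_def by (intro conjI measurable_simple_function simple_functionD(1))
  have bound: "B \<le> partition_entropy ?P (join_partition \<xi> (\<lambda>i. translate_lines g ^^ i) {..<n}) / real (card {..<n})" if n: "1 \<le> n" for n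
  proof -
    let ?I = "{..<n} \<times> {..<m}"
    let ?Y = "join_partition \<xi> (\<lambda>i. translate_lines g ^^ i) {..<n}"
    define h where "h v = (\<lambda>p\<in>?I. snd p \<in> set_decode (v (fst p)))" for v :: "nat \<Rightarrow> nat"
    have fm: "(translate_lines g ^^ i) \<in> measurable ?P ?P" for i
      by (induction i) (auto intro: measurable_compose[OF _ measurable_translate_lines] simp: id_def comp_def)
    have Ys: "simple_function ?P ?Y"
      unfolding join_partition_def[abs_def]
      by (intro lines.simple_function_restrict lines.simple_function_finite_partition[OF \<xi> fm]) simp
    have eq: "(\<lambda>p\<in>?I. emeasure \<omega> (slab m g (int (snd p) - int m * int (fst p))) = 0) = h (?Y \<omega>)" if "\<omega> \<in> space ?P" for \<omega>
      unfolding h_def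
    proof (rule restrict_ext)
      have conf: "\<omega> \<in> configurations line_measure" using that by simp
      fix p assume p: "p \<in> ?I"
      have "finite (void \<omega>')" for \<omega>' by (simp add: void_def)
      then have "set_decode (?Y \<omega> (fst p)) = void ((translate_lines g ^^ fst p) \<omega>)"
        using p by (auto simp: join_partition_def \<xi>_def)
      also have "snd p \<in> \<dots> \<longleftrightarrow> emeasure \<omega> (translate (of_int (int (fst p)) *\<^sub>R g) -` slab m g (int (snd p))) = 0"
        using p unfolding void_def funpow_translate_lines[OF conf] by (auto simp only: emeasure_translate_lines[OF conf slab_sets] mem_Collect_eq mem_Times_iff)
      finally show "(emeasure \<omega> (slab m g (int (snd p) - int m * int (fst p))) = 0) = (snd p \<in> set_decode (?Y \<omega> (fst p)))"
        unfolding translate_vimage_slab by simp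
    qed
    have "real n * B \<le> real n * (real m * - ((1 - exp (- (slab_mass g / real m))) * ln (1 - exp (- (slab_mass g / real m)))))"
      using mB by (intro mult_left_mono) auto
    also have "\<dots> \<le> partition_entropy ?P (\<lambda>\<omega>. \<lambda>p\<in>?I. emeasure \<omega> (slab m g (int (snd p) - int m * int (fst p))) = 0)"
      by (rule entropy_of_slabs[OF g m])
    also have "\<dots> = partition_entropy ?P (\<lambda>\<omega>. h (?Y \<omega>))"
      by (rule lines.partition_entropy_cong[OF simple_function_compose1[OF Ys, of h] eq])
    also have "\<dots> \<le> partition_entropy ?P ?Y" by (rule lines.partition_entropy_compose[OF Ys])
    finally show ?thesis using n by (simp add: pos_le_divide_eq mult.commute)
  qed
  show "\<exists>\<xi>. finite_partition ?P \<xi> \<and>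
      eventually (\<lambda>n. B \<le> partition_entropy ?P (join_partition \<xi> (\<lambda>i. translate_lines g ^^ i) {..<n}) / real (card {..<n})) sequentially"
    using \<xi> bound by (intro exI[of _ \<xi>] conjI eventually_sequentiallyI[of 1])
qed

theorem proposition5p7:
  assumes "CARD('d::finite) \<ge> 2"
  shows "\<exists>(\<Omega> :: real measure measure) (V :: real ^ 'd \<Rightarrow> real measure \<Rightarrow> real measure).
           poisson_action \<Omega> V \<and>
           action_entropy \<Omega> V = 0 \<and>
           (\<forall>g. g \<noteq> 0 \<longrightarrow>
              bernoullian \<Omega> (V g) \<and> transformation_entropy \<Omega> (V g) = \<infinity>)"
  using poisson_action_translate_lines action_entropy_translate_lines[OF assms]
    bernoullian_translate_lines transformation_entropy_translate_lines
  by blast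

end
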